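(* Let $m\in\mathbb{Z}$ and $X=\mathbb{WP}^{1|1}(1,1\,|\,m)$ over $k$. Then $$\dim_kH^1(X,\mathcal{T}_X)=\begin{cases}0\,|\,{-m-1}&\text{for }m<-1,\\ 0\,|\,0&\text{for }-1\le m\le3,\\ 0\,|\,m-3&\text{for }m>3.\end{cases}$$ In particular, for $m<-1$ and $m>3$, the weighted projective superspaces $\mathbb{WP}^{1|1}(1,1\,|\,m)$ are not rigid.
   Context: $k$ is an algebraically closed field of characteristic $0$. $\mathbb{WP}^{1|1}(1,1\,|\,m)=\operatorname{Proj}k[u,v\,|\,\theta]$ with $u,v$ even of $\mathbb{Z}$-degree $1$ and $\theta$ odd of $\mathbb{Z}$-degree $m$; equivalently, it is $\mathbb{P}^1$ with structure sheaf $\mathcal{O}_{\mathbb{P}^1}\oplus\Pi\mathcal{O}_{\mathbb{P}^1}(-m)$, where $\Pi$ is parity change. $\mathcal{T}_X$ is the tangent sheaf, and $a\,|\,b$ denotes the dimension of a super vector space with even part of dimension $a$ and odd part of dimension $b$. A superscheme $X$ is rigid if every first-order deformation is trivial, i.e. $H^1(X,\mathcal{T}_X)=0$. *)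

theory Defs
  imports
    "HOL-Analysis.Abstract_Topology"
    "HOL-Library.Function_Algebras"
    "HOL-Library.Product_Plus"
    "HOL-Library.Z2"
    "HOL-Computational_Algebra.Polynomial"
    "HOL-Computational_Algebra.Fraction_Field"
    "HOL-Algebra.Module"
begin

section \<open>Sheaves of vector spaces and their first cohomology\<close>

text \<open>
  Sections over all open sets live in one type, with the addition of that type; \<open>rest F V\<close> is the
  restriction to \<open>V\<close> of sections over any larger open set.
\<close>

record ('x, 'k, 's) vsheaf =
  base :: "'x topology"
  sect :: "'x set \<Rightarrow> 's set"
  rest :: "'x set \<Rightarrow> 's \<Rightarrow> 's"
  scal :: "'k \<Rightarrow> 's \<Rightarrow> 's"

text \<open>Open covers are indexed by their own members.\<close>

definition open_cover :: "('x, 'k, 's) vsheaf \<Rightarrow> 'x set set \<Rightarrow> bool" where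
  "open_cover F \<U> \<longleftrightarrow> (\<forall>U\<in>\<U>. openin (base F) U) \<and> \<Union>\<U> = topspace (base F)"

definition cech_cocycles :: "('x, 'k, 's::ab_group_add) vsheaf \<Rightarrow> 'x set set \<Rightarrow> ('x set \<Rightarrow> 'x set \<Rightarrow> 's) set" where
  "cech_cocycles F \<U> = {g.
     (\<forall>U\<in>\<U>. \<forall>V\<in>\<U>. g U V \<in> sect F (U \<inter> V)) \<and>
     (\<forall>U V. U \<notin> \<U> \<or> V \<notin> \<U> \<longrightarrow> g U V = 0) \<and>
     (\<forall>U\<in>\<U>. \<forall>V\<in>\<U>. \<forall>W\<in>\<U>.
        rest F (U \<inter> V \<inter> W) (g V W) - rest F (U \<inter> V \<inter> W) (g U W) + rest F (U \<inter> V \<inter> W) (g U V) = 0)}"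

definition cech_delta :: "('x, 'k, 's::ab_group_add) vsheaf \<Rightarrow> 'x set set \<Rightarrow> ('x set \<Rightarrow> 's) \<Rightarrow> 'x set \<Rightarrow> 'x set \<Rightarrow> 's" where
  "cech_delta F \<U> h = (\<lambda>U V. if U \<in> \<U> \<and> V \<in> \<U>
     then rest F (U \<inter> V) (h V) - rest F (U \<inter> V) (h U) else 0)"

definition cech_coboundaries :: "('x, 'k, 's::ab_group_add) vsheaf \<Rightarrow> 'x set set \<Rightarrow> ('x set \<Rightarrow> 'x set \<Rightarrow> 's) set" where
  "cech_coboundaries F \<U> = {cech_delta F \<U> h | h. \<forall>U\<in>\<U>. h U \<in> sect F U}"

definition refinement :: "'x set set \<Rightarrow> 'x set set \<Rightarrow> ('x set \<Rightarrow> 'x set) \<Rightarrow> bool" where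
  "refinement \<W> \<U> \<tau> \<longleftrightarrow> (\<forall>W\<in>\<W>. \<tau> W \<in> \<U> \<and> W \<subseteq> \<tau> W)"

definition cech_pull :: "('x, 'k, 's::ab_group_add) vsheaf \<Rightarrow> 'x set set \<Rightarrow> ('x set \<Rightarrow> 'x set)
    \<Rightarrow> ('x set \<Rightarrow> 'x set \<Rightarrow> 's) \<Rightarrow> 'x set \<Rightarrow> 'x set \<Rightarrow> 's" where
  "cech_pull F \<W> \<tau> g = (\<lambda>V W. if V \<in> \<W> \<and> W \<in> \<W> then rest F (V \<inter> W) (g (\<tau> V) (\<tau> W)) else 0)"

text \<open>
  The first cohomology is the colimit of the groups \<open>cech_cocycles F \<U> / cech_coboundaries F \<U>\<close>
  over \<^emph>\<open>all\<close> open covers ordered by refinement; for every sheaf of abelian groups on every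
  topological space this agrees with the derived functor \<open>H\<^sup>1\<close>.
\<close>

definition cech_pairs :: "('x, 'k, 's::ab_group_add) vsheaf \<Rightarrow> ('x set set \<times> ('x set \<Rightarrow> 'x set \<Rightarrow> 's)) set" where
  "cech_pairs F = {(\<U>, g). open_cover F \<U> \<and> g \<in> cech_cocycles F \<U>}"

definition cech_rel :: "('x, 'k, 's::ab_group_add) vsheaf \<Rightarrow> ('x set set \<times> ('x set \<Rightarrow> 'x set \<Rightarrow> 's)) rel" where
  "cech_rel F = {((\<U>, g), (\<V>, h)). (\<U>, g) \<in> cech_pairs F \<and> (\<V>, h) \<in> cech_pairs F \<and>
     (\<exists>\<W> \<tau> \<sigma>. open_cover F \<W> \<and> refinement \<W> \<U> \<tau> \<and> refinement \<W> \<V> \<sigma> \<and>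
        cech_pull F \<W> \<tau> g - cech_pull F \<W> \<sigma> h \<in> cech_coboundaries F \<W>)}"

text \<open>
  The unions below are unions of equal classes. Only the additive part and the scalar
  multiplication of the record are meaningful.
\<close>

definition sheaf_H1 :: "('x, 'k, 's::ab_group_add) vsheaf
    \<Rightarrow> ('k, ('x set set \<times> ('x set \<Rightarrow> 'x set \<Rightarrow> 's)) set) module" where
  "sheaf_H1 F = \<lparr>
     carrier = cech_pairs F // cech_rel F,
     mult = undefined, one = undefined,
     zero = cech_rel F `` {({topspace (base F)}, 0)},
     add = (\<lambda>A B. \<Union>{cech_rel F `` {(\<W>, cech_pull F \<W> \<tau> g + cech_pull F \<W> \<sigma> h)} | \<U> g \<V> h \<W> \<tau> \<sigma>.
              (\<U>, g) \<in> A \<and> (\<V>, h) \<in> B \<and> open_cover F \<W> \<and> refinement \<W> \<U> \<tau> \<and> refinement \<W> \<V> \<sigma>}),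
     smult = (\<lambda>c A. \<Union>{cech_rel F `` {(\<U>, \<lambda>U V. scal F c (g U V))} | \<U> g. (\<U>, g) \<in> A}) \<rparr>"

definition has_dimension :: "('k, 'v) module \<Rightarrow> nat \<Rightarrow> bool" where
  "has_dimension M n \<longleftrightarrow> (\<exists>B. B \<subseteq> carrier M \<and> finite B \<and> card B = n \<and>
     (\<forall>x\<in>carrier M. \<exists>!c. c \<in> extensional B \<and> x = finsum M (\<lambda>b. smult M (c b) b) B))"


section \<open>Superspaces and the tangent sheaf\<close>

text \<open>
  A space with a sheaf of supercommutative algebras: \<open>sp_sec X p U\<close> are the sections over \<open>U\<close> of
  parity \<open>p\<close>; restriction and ambient type are handled as for \<open>vsheaf\<close>.
\<close>

record ('x, 'k, 's) superspace =
  sp_top :: "'x topology"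
  sp_sec :: "bit \<Rightarrow> 'x set \<Rightarrow> 's set"
  sp_res :: "'x set \<Rightarrow> 's \<Rightarrow> 's"
  sp_mult :: "'s \<Rightarrow> 's \<Rightarrow> 's"
  sp_scale :: "'k \<Rightarrow> 's \<Rightarrow> 's"

definition sp_all :: "('x, 'k, 's::ab_group_add) superspace \<Rightarrow> 'x set \<Rightarrow> 's set" where
  "sp_all X U = {f + g | f g. f \<in> sp_sec X 0 U \<and> g \<in> sp_sec X 1 U}"

definition koszul :: "bit \<Rightarrow> bit \<Rightarrow> 's::ab_group_add \<Rightarrow> 's" where
  "koszul p q x = (if p = 1 \<and> q = 1 then - x else x)"

text \<open>\<open>k\<close>-linear superderivations of parity \<open>d\<close> of the algebra of sections over \<open>U\<close>, set to \<open>0\<close>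
  outside this algebra.\<close>

definition superderiv :: "('x, 'k, 's::ab_group_add) superspace \<Rightarrow> bit \<Rightarrow> 'x set \<Rightarrow> ('s \<Rightarrow> 's) \<Rightarrow> bool" where
  "superderiv X d U D \<longleftrightarrow>
     (\<forall>p. \<forall>f\<in>sp_sec X p U. D f \<in> sp_sec X (p + d) U) \<and>
     (\<forall>f\<in>sp_all X U. \<forall>g\<in>sp_all X U. D (f + g) = D f + D g) \<and>
     (\<forall>c. \<forall>f\<in>sp_all X U. D (sp_scale X c f) = sp_scale X c (D f)) \<and>
     (\<forall>p q. \<forall>f\<in>sp_sec X p U. \<forall>g\<in>sp_sec X q U.
        D (sp_mult X f g) = sp_mult X (D f) g + koszul d p (sp_mult X f (D g))) \<and>
     (\<forall>f. f \<notin> sp_all X U \<longrightarrow> D f = 0)"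

text \<open>
  The parity \<open>d\<close> part of the tangent sheaf \<open>Der\<^sub>k(\<O>\<^sub>X)\<close>: a section over \<open>U\<close> is a derivation of the
  sheaf of algebras restricted to \<open>U\<close>, i.e. a family indexed by the open subsets \<open>W\<close> of \<open>U\<close>.
\<close>

definition tangent_sections :: "('x, 'k, 's::ab_group_add) superspace \<Rightarrow> bit \<Rightarrow> 'x set \<Rightarrow> ('x set \<Rightarrow> 's \<Rightarrow> 's) set" where
  "tangent_sections X d U = {D.
     (\<forall>W. openin (sp_top X) W \<and> W \<subseteq> U \<longrightarrow> superderiv X d W (D W)) \<and>
     (\<forall>W. \<not> (openin (sp_top X) W \<and> W \<subseteq> U) \<longrightarrow> D W = 0) \<and>
     (\<forall>V W. openin (sp_top X) V \<and> openin (sp_top X) W \<and> V \<subseteq> W \<and> W \<subseteq> U \<longrightarrow>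
        (\<forall>f\<in>sp_all X W. sp_res X V (D W f) = D V (sp_res X V f)))}"

definition tangent_sheaf :: "('x, 'k, 's::ab_group_add) superspace \<Rightarrow> bit \<Rightarrow> ('x, 'k, 'x set \<Rightarrow> 's \<Rightarrow> 's) vsheaf" where
  "tangent_sheaf X d = \<lparr>
     base = sp_top X,
     sect = tangent_sections X d,
     rest = (\<lambda>V D W. if W \<subseteq> V then D W else 0),
     scal = (\<lambda>c D W f. sp_scale X c (D W f)) \<rparr>"

text \<open>A super vector space is given by its even part (at \<open>0\<close>) and its odd part (at \<open>1\<close>).\<close>

definition H1_tangent :: "('x, 'k, 's::ab_group_add) superspace
    \<Rightarrow> bit \<Rightarrow> ('k, ('x set set \<times> ('x set \<Rightarrow> 'x set \<Rightarrow> 'x set \<Rightarrow> 's \<Rightarrow> 's)) set) module" where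
  "H1_tangent X = (\<lambda>d. sheaf_H1 (tangent_sheaf X d))"

definition has_superdimension :: "(bit \<Rightarrow> ('k, 'v) module) \<Rightarrow> nat \<Rightarrow> nat \<Rightarrow> bool" where
  "has_superdimension M a b \<longleftrightarrow> has_dimension (M 0) a \<and> has_dimension (M 1) b"

definition rigid :: "('x, 'k, 's::ab_group_add) superspace \<Rightarrow> bool" where
  "rigid X \<longleftrightarrow> (\<forall>d. carrier (H1_tangent X d) = {zero (H1_tangent X d)})"


section \<open>The projective line as Proj\<close>

text \<open>\<open>k[u,v]\<close> is \<open>'k poly poly\<close>: \<open>coeff (coeff p i) j\<close> is the coefficient of \<open>u\<^sup>j v\<^sup>i\<close>.\<close>

definition homog :: "nat \<Rightarrow> 'k::field poly poly \<Rightarrow> bool" where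
  "homog d p \<longleftrightarrow> (\<forall>i j. coeff (coeff p i) j \<noteq> 0 \<longrightarrow> i + j = d)"

definition hom_comp :: "nat \<Rightarrow> 'k::field poly poly \<Rightarrow> 'k poly poly" where
  "hom_comp d p = (\<Sum>i\<le>d. monom (monom (coeff (coeff p i) (d - i)) (d - i)) i)"

definition var_u :: "'k::field poly poly" where "var_u = [:[:0, 1:]:]"
definition var_v :: "'k::field poly poly" where "var_v = [:0, 1:]"

type_synonym 'k pt = "'k poly poly set"

definition homog_prime :: "'k::field pt \<Rightarrow> bool" where
  "homog_prime P \<longleftrightarrow>
     0 \<in> P \<and> (\<forall>a\<in>P. \<forall>b\<in>P. a + b \<in> P) \<and> (\<forall>a. \<forall>b\<in>P. a * b \<in> P) \<and>
     (\<forall>a\<in>P. \<forall>d. hom_comp d a \<in> P) \<and>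
     1 \<notin> P \<and> (\<forall>a b. a * b \<in> P \<longrightarrow> a \<in> P \<or> b \<in> P)"

definition proj_points :: "'k::field pt set" where
  "proj_points = {P. homog_prime P \<and> \<not> (var_u \<in> P \<and> var_v \<in> P)}"

text \<open>A homogeneous prime contains \<open>E\<close> iff it contains all homogeneous components of elements of \<open>E\<close>,
  so \<open>E\<close> may be arbitrary.\<close>

definition zariski_open :: "'k::field pt set \<Rightarrow> bool" where
  "zariski_open U \<longleftrightarrow> (\<exists>E. U = {P \<in> proj_points. \<not> E \<subseteq> P})"

definition zariski :: "'k::field pt topology" where
  "zariski = topology zariski_open"

lemma istopology_zariski_open: "istopology (zariski_open :: 'k::field pt set \<Rightarrow> bool)"
  unfolding istopology_def
proof (intro conjI allI impI)
  fix S T :: "'k pt set"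
  assume "zariski_open S" "zariski_open T"
  then obtain E F where E: "S = {P \<in> proj_points. \<not> E \<subseteq> P}" and F: "T = {P \<in> proj_points. \<not> F \<subseteq> P}"
    unfolding zariski_open_def by blast
  have "\<not> {e * f | e f. e \<in> E \<and> f \<in> F} \<subseteq> P \<longleftrightarrow> \<not> E \<subseteq> P \<and> \<not> F \<subseteq> P" if "P \<in> proj_points" for P
  proof
    assume "\<not> {e * f | e f. e \<in> E \<and> f \<in> F} \<subseteq> P"
    then obtain e f where "e \<in> E" "f \<in> F" "e * f \<notin> P" by blast
    moreover have "e * f \<in> P" if "e \<in> P \<or> f \<in> P"
      using that \<open>P \<in> proj_points\<close> unfolding proj_points_def homog_prime_def
      by (metis (no_types, lifting) mem_Collect_eq mult.commute)
    ultimately show "\<not> E \<subseteq> P \<and> \<not> F \<subseteq> P" by blast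
  next
    assume "\<not> E \<subseteq> P \<and> \<not> F \<subseteq> P"
    then obtain e f where ef: "e \<in> E" "f \<in> F" "e \<notin> P" "f \<notin> P" by blast
    then have "e * f \<notin> P" using that unfolding proj_points_def homog_prime_def by blast
    with ef show "\<not> {e * f | e f. e \<in> E \<and> f \<in> F} \<subseteq> P" by blast
  qed
  then have "S \<inter> T = {P \<in> proj_points. \<not> {e * f | e f. e \<in> E \<and> f \<in> F} \<subseteq> P}"
    unfolding E F by blast
  then show "zariski_open (S \<inter> T)" unfolding zariski_open_def by blast
next
  fix K :: "'k pt set set"
  assume "\<forall>U\<in>K. zariski_open U"
  then obtain E where E: "\<And>U. U \<in> K \<Longrightarrow> U = {P \<in> proj_points. \<not> E U \<subseteq> P}"
    unfolding zariski_open_def by metis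
  have "\<Union>K = {P \<in> proj_points. \<not> (\<Union>U\<in>K. E U) \<subseteq> P}"
    using E by blast
  then show "zariski_open (\<Union>K)" unfolding zariski_open_def by blast
qed

lemma openin_zariski [simp]: "openin zariski = zariski_open"
  by (simp add: zariski_def topology_inverse' istopology_zariski_open)

lemma topspace_zariski: "topspace zariski = (proj_points :: 'k::field pt set)"
proof -
  have "(proj_points :: 'k pt set) = {P \<in> proj_points. \<not> {1} \<subseteq> P}"
    by (auto simp: proj_points_def homog_prime_def)
  then have "zariski_open (proj_points :: 'k pt set)"
    unfolding zariski_open_def by blast
  then show ?thesis
    by (auto simp: topspace_def zariski_open_def)
qed

text \<open>
  Sections of \<open>\<O>(n)\<close> over \<open>U\<close>: functions to the homogeneous localisations that are locally given by
  one homogeneous fraction of degree \<open>n\<close>. As \<open>k[u,v]\<close> is a domain, all localisations are taken inside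
  its fraction field. Sections are \<open>0\<close> outside \<open>U\<close>.
\<close>

definition twist_sections :: "int \<Rightarrow> 'k::field pt set \<Rightarrow> ('k pt \<Rightarrow> 'k poly poly fract) set" where
  "twist_sections n U = {s.
     (\<forall>P\<in>U. \<exists>V a b d e. zariski_open V \<and> P \<in> V \<and> V \<subseteq> U \<and>
        homog d a \<and> homog e b \<and> int d - int e = n \<and> (\<forall>Q\<in>V. b \<notin> Q \<and> s Q = Fract a b)) \<and>
     (\<forall>P. P \<notin> U \<longrightarrow> s P = 0)}"


section \<open>The weighted projective superspace\<close>

text \<open>
  A local section \<open>f + h\<theta>\<close> is the function with values \<open>(f, h)\<close>; here \<open>\<theta>\<^sup>2 = 0\<close> and, since \<open>\<theta>\<close> has
  degree \<open>m\<close>, the coefficient \<open>h\<close> has degree \<open>-m\<close>, so that the odd part is \<open>\<Pi>\<O>(-m)\<close>.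
\<close>

type_synonym 'k ssec = "'k pt \<Rightarrow> 'k poly poly fract \<times> 'k poly poly fract"

definition WP :: "int \<Rightarrow> ('k::field pt, 'k, 'k ssec) superspace" where
  "WP m = \<lparr>
     sp_top = zariski,
     sp_sec = (\<lambda>p U. if p = 0 then {\<lambda>P. (f P, 0) | f. f \<in> twist_sections 0 U}
                     else {\<lambda>P. (0, h P) | h. h \<in> twist_sections (- m) U}),
     sp_res = (\<lambda>V s P. if P \<in> V then s P else 0),
     sp_mult = (\<lambda>s t P. (fst (s P) * fst (t P), fst (s P) * snd (t P) + snd (s P) * fst (t P))),
     sp_scale = (\<lambda>c s P. (Fract [:[:c:]:] 1 * fst (s P), Fract [:[:c:]:] 1 * snd (s P))) \<rparr>"

end

theory Submission
  imports Defs "HOL-Computational_Algebra.Polynomial_Factorial"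
begin

text \<open>
  Put \<open>L = \<O>(-m)\<close>. An even derivation of \<open>\<O> \<oplus> \<Pi>L\<close> is a first-order operator on \<open>L\<close> with scalar symbol, so the
  even part of the tangent sheaf is an extension of \<open>\<O>(2)\<close> by \<open>\<O>\<close> (the Atiyah algebroid of \<open>L\<close>) and has
  no first cohomology. An odd derivation is a derivation \<open>\<O> \<rightarrow> L\<close> together with an \<open>\<O>\<close>-linear map
  \<open>L \<rightarrow> \<O>\<close>, so the odd part is \<open>\<O>(2-m) \<oplus> \<O>(m)\<close>, and the two summands contribute \<open>m-3\<close> and \<open>-m-1\<close>
  when these numbers are positive.

  All these sheaves are cut out of a constant sheaf \<open>G\<close> by a local condition \<open>V P\<close> at every point \<open>P\<close>. Every
  cocycle becomes a coboundary in \<open>G\<close>, and by partial fractions the resulting cochain can be corrected to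
  satisfy the local conditions at all points but one, \<open>z\<close>. What remains is an element of \<open>G\<close> modulo \<open>V z\<close>
  and the elements that are regular on the complement of \<open>z\<close>; for \<open>\<O>(n)\<close> this quotient has the basis
  \<open>u\<^sup>n (u/v)\<^sup>i\<close> with \<open>1 \<le> i \<le> -n-1\<close>.
\<close>

section \<open>Cohomology of subsheaves of a constant sheaf\<close>

text \<open>Two obstacles shape the proof. The cohomology is a colimit over all open covers, so a
  cocycle lives on an arbitrary cover, possibly infinite or with empty members. It is therefore
  split in \<open>G\<close> directly: irreducibility of the line makes the splitting possible, and
  cofiniteness of nonempty open sets leaves finitely many poles to correct. A two-member cover
  serves only to realise a given element of \<open>G\<close> by a cocycle. Also, a tangent section
  is a compatible family of derivations over all smaller open sets. The generic point
  \<open>{0}\<close> lies in every nonempty open set, so functions and derivations are determined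
  there; \<open>G\<close> consists of the derivations at \<open>{0}\<close>, written as pairs of
  homogeneous fractions. Differentiation is by \<open>v\<close> with \<open>u\<close> constant, and
  Euler's relation carries regularity over to the point \<open>u = 0\<close>. The even extension is
  in general not a direct sum, so its condition at \<open>u = 0\<close> is a sheared product; the
  shear \<open>m * g / (u * v)\<close> comes from replacing the generator \<open>u^(-m)\<close> of
  \<open>L\<close> by \<open>v^(-m)\<close>.\<close>

locale curve_sheaf = vector_space smul
  for smul :: "'k::field \<Rightarrow> 'v::ab_group_add \<Rightarrow> 'v" +
  fixes F :: "('x, 'k, 's::ab_group_add) vsheaf"
    and \<iota> :: "'x set \<Rightarrow> 'v \<Rightarrow> 's"
    and G :: "'v set"
    and V :: "'x \<Rightarrow> 'v set"
    and A :: "'x set"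
    and z :: 'x
  assumes subspace_G: "subspace G"
    and subspace_V: "P \<in> insert z A \<Longrightarrow> subspace (V P)"
    and V_subset: "P \<in> insert z A \<Longrightarrow> V P \<subseteq> G"
    and topspace_F: "topspace (base F) = insert z A"
    and z_notin: "z \<notin> A"
    and open_A: "openin (base F) A"
    and sect_F: "openin (base F) U \<Longrightarrow> sect F U = \<iota> U ` {x \<in> G. \<forall>P\<in>U. x \<in> V P}"
    and inj_\<iota>: "openin (base F) U \<Longrightarrow> U \<noteq> {} \<Longrightarrow> inj_on (\<iota> U) {x \<in> G. \<forall>P\<in>U. x \<in> V P}"
    and \<iota>_add: "\<iota> U (x + y) = \<iota> U x + \<iota> U y"
    and \<iota>_rest: "U' \<subseteq> U \<Longrightarrow> rest F U' (\<iota> U x) = \<iota> U' x"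
    and \<iota>_scal: "scal F c (\<iota> U x) = \<iota> U (smul c x)"
    and \<iota>_empty: "\<iota> {} x = 0"
    and open_Int_nonempty: "openin (base F) U \<Longrightarrow> openin (base F) U' \<Longrightarrow> U \<noteq> {} \<Longrightarrow> U' \<noteq> {} \<Longrightarrow> U \<inter> U' \<noteq> {}"
    and open_cofinite: "openin (base F) U \<Longrightarrow> U \<noteq> {} \<Longrightarrow> finite (A - U)"
    and polar_part: "P \<in> A \<Longrightarrow> x \<in> G \<Longrightarrow> \<exists>s\<in>G. s - x \<in> V P \<and> (\<forall>Q\<in>A - {P}. s \<in> V Q)"
begin

section \<open>Cocycles and their residues at \<open>z\<close>\<close>

definition N :: "'v set" where
  "N = {a + b | a b. a \<in> G \<and> (\<forall>P\<in>A. a \<in> V P) \<and> b \<in> V z}"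

text \<open>The cochain \<open>h\<close> splits \<open>g\<close> in \<open>G\<close> and is required
  to be regular on all of \<open>A\<close>. At \<open>z\<close> it is recorded only modulo
  \<open>V z\<close>, where one \<open>x\<close> must serve every member containing
  \<open>z\<close>; this \<open>x\<close> is the single obstruction left.\<close>

definition splitting :: "'x set set \<Rightarrow> ('x set \<Rightarrow> 'x set \<Rightarrow> 's) \<Rightarrow> 'v \<Rightarrow> ('x set \<Rightarrow> 'v) \<Rightarrow> bool" where
  "splitting \<U> g x h \<longleftrightarrow>
     (\<forall>U\<in>\<U>. h U \<in> G \<and> (\<forall>P\<in>U \<inter> A. h U \<in> V P) \<and> (z \<in> U \<longrightarrow> h U - x \<in> V z)) \<and>
     (\<forall>U\<in>\<U>. \<forall>W\<in>\<U>. g U W = \<iota> (U \<inter> W) (h W - h U))"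

text \<open>Cochains are total functions; the vanishing outside the cover mirrors the convention of
  \<open>cech_cocycles\<close>, under which agreement on the cover means equality.\<close>

definition represents :: "'x set set \<Rightarrow> ('x set \<Rightarrow> 'x set \<Rightarrow> 's) \<Rightarrow> 'v \<Rightarrow> bool" where
  "represents \<U> g x \<longleftrightarrow> open_cover F \<U> \<and> (\<forall>U W. U \<notin> \<U> \<or> W \<notin> \<U> \<longrightarrow> g U W = 0) \<and> (\<exists>h. splitting \<U> g x h)"

definition coh_class :: "'v \<Rightarrow> ('x set set \<times> ('x set \<Rightarrow> 'x set \<Rightarrow> 's)) set" where
  "coh_class x = {(\<U>, g). represents \<U> g x}"

lemma mem_coh_class [simp]: "(\<U>, g) \<in> coh_class x \<longleftrightarrow> represents \<U> g x"
  by (simp add: coh_class_def)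

lemma \<iota>_0 [simp]: "\<iota> U 0 = 0"
  using \<iota>_add[of U 0 0] by simp

lemma \<iota>_diff: "\<iota> U (x - y) = \<iota> U x - \<iota> U y"
  using \<iota>_add[of U "x - y" y] by (simp add: algebra_simps)

lemma G_mem [simp]: "0 \<in> G" "x \<in> G \<Longrightarrow> y \<in> G \<Longrightarrow> x + y \<in> G" "x \<in> G \<Longrightarrow> y \<in> G \<Longrightarrow> x - y \<in> G"
  "x \<in> G \<Longrightarrow> smul c x \<in> G"
  using subspace_G by (auto intro: subspace_0 subspace_add subspace_diff subspace_scale)

lemma
  assumes "P \<in> insert z A"
  shows V_0: "0 \<in> V P"
    and V_add: "x \<in> V P \<Longrightarrow> y \<in> V P \<Longrightarrow> x + y \<in> V P"
    and V_diff: "x \<in> V P \<Longrightarrow> y \<in> V P \<Longrightarrow> x - y \<in> V P"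
    and V_scale: "x \<in> V P \<Longrightarrow> smul c x \<in> V P"
    and V_imp_G: "x \<in> V P \<Longrightarrow> x \<in> G"
  using subspace_V[OF assms] V_subset[OF assms]
  by (auto intro: subspace_0 subspace_add subspace_diff subspace_scale)

lemma open_subset: "openin (base F) U \<Longrightarrow> U \<subseteq> insert z A"
  using openin_subset topspace_F by blast

lemma open_coverD: "open_cover F \<U> \<Longrightarrow> U \<in> \<U> \<Longrightarrow> openin (base F) U"
  and open_cover_Union: "open_cover F \<U> \<Longrightarrow> \<Union>\<U> = insert z A"
  by (auto simp: open_cover_def topspace_F)

lemma subspace_N: "subspace N"
proof (rule subspaceI)
  show "0 \<in> N"
    unfolding N_def by (force simp: V_0 V_add V_diff V_scale V_imp_G intro!: exI[of _ 0])
  fix x y assume "x \<in> N" "y \<in> N"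
  then obtain a b a' b' where "x = a + b" "y = a' + b'" "a \<in> G" "a' \<in> G"
     "\<forall>P\<in>A. a \<in> V P" "\<forall>P\<in>A. a' \<in> V P" "b \<in> V z" "b' \<in> V z"
    unfolding N_def by blast
  then show "x + y \<in> N"
    unfolding N_def by (intro CollectI exI[of _ "a + a'"] exI[of _ "b + b'"]) (auto simp: V_0 V_add V_diff V_scale V_imp_G)
next
  fix c x assume "x \<in> N"
  then obtain a b where "x = a + b" "a \<in> G" "\<forall>P\<in>A. a \<in> V P" "b \<in> V z"
    unfolding N_def by blast
  then show "smul c x \<in> N"
    unfolding N_def
    by (intro CollectI exI[of _ "smul c a"] exI[of _ "smul c b"]) (auto simp: V_0 V_add V_diff V_scale V_imp_G scale_right_distrib)
qed

text \<open>At points of \<open>A\<close> both terms are regular; at \<open>z\<close> the common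
  residue \<open>x\<close> cancels. Hence a splitting automatically yields sections on the
  overlaps.\<close>

lemma splitting_diff_mem:
  assumes "splitting \<U> g x h" "open_cover F \<U>" "U \<in> \<U>" "W \<in> \<U>"
  shows "h W - h U \<in> {y \<in> G. \<forall>P\<in>U \<inter> W. y \<in> V P}"
proof -
  have "h W - h U \<in> V P" if "P \<in> U" "P \<in> W" for P
  proof (cases "P = z")
    case True
    have "(h W - x) - (h U - x) \<in> V z"
      by (rule V_diff) (use assms that True in \<open>auto simp: splitting_def\<close>)
    then show ?thesis using True by simp
  next
    case False
    then have "P \<in> A"
      using that assms open_subset open_coverD by blast
    show ?thesis
      by (rule V_diff) (use assms that \<open>P \<in> A\<close> in \<open>auto simp: splitting_def\<close>)
  qed
  then show ?thesis
    using assms by (auto simp: splitting_def)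
qed

lemma represents_imp_cech_pair:
  assumes "represents \<U> g x"
  shows "(\<U>, g) \<in> cech_pairs F"
proof -
  obtain h where h: "splitting \<U> g x h" and cov: "open_cover F \<U>"
    and out: "\<forall>U W. U \<notin> \<U> \<or> W \<notin> \<U> \<longrightarrow> g U W = 0"
    using assms by (auto simp: represents_def)
  have g: "g U W = \<iota> (U \<inter> W) (h W - h U)" if "U \<in> \<U>" "W \<in> \<U>" for U W
    using h that by (auto simp: splitting_def)
  have "g U W \<in> sect F (U \<inter> W)" if "U \<in> \<U>" "W \<in> \<U>" for U W
    using that g splitting_diff_mem[OF h cov that]
    by (subst sect_F) (auto intro: open_coverD[OF cov])
  moreover have "rest F (U \<inter> W \<inter> Y) (g W Y) - rest F (U \<inter> W \<inter> Y) (g U Y) + rest F (U \<inter> W \<inter> Y) (g U W) = 0"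
    if "U \<in> \<U>" "W \<in> \<U>" "Y \<in> \<U>" for U W Y
  proof -
    have "U \<inter> W \<inter> Y \<subseteq> W \<inter> Y" "U \<inter> W \<inter> Y \<subseteq> U \<inter> Y" "U \<inter> W \<inter> Y \<subseteq> U \<inter> W" by auto
    then show ?thesis
      using that by (simp add: g \<iota>_rest flip: \<iota>_diff \<iota>_add)
  qed
  ultimately show ?thesis
    using cov out by (auto simp: cech_pairs_def cech_cocycles_def)
qed

text \<open>Irreducibility makes the cocycle a coboundary in \<open>G\<close>: the row of a fixed
  nonempty member \<open>U0\<close> is a splitting cochain. Within \<open>A\<close> it violates the
  local conditions only at the finitely many points outside \<open>U0\<close>, and subtracting the
  sum of the polar parts there repairs all of them at once.\<close>

lemma represents_exists:
  assumes "(\<U>, g) \<in> cech_pairs F"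
  shows "\<exists>x\<in>G. represents \<U> g x"
proof -
  have cov: "open_cover F \<U>" and sec: "\<And>U W. U \<in> \<U> \<Longrightarrow> W \<in> \<U> \<Longrightarrow> g U W \<in> sect F (U \<inter> W)"
    and out: "\<And>U W. U \<notin> \<U> \<or> W \<notin> \<U> \<Longrightarrow> g U W = 0"
    and coc: "\<And>U W Y. U \<in> \<U> \<Longrightarrow> W \<in> \<U> \<Longrightarrow> Y \<in> \<U> \<Longrightarrow>
      rest F (U \<inter> W \<inter> Y) (g W Y) - rest F (U \<inter> W \<inter> Y) (g U Y) + rest F (U \<inter> W \<inter> Y) (g U W) = 0"
    using assms by (auto simp: cech_pairs_def cech_cocycles_def)
  have "\<exists>y. y \<in> {y \<in> G. \<forall>P\<in>U \<inter> W. y \<in> V P} \<and> g U W = \<iota> (U \<inter> W) y"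
    if "U \<in> \<U>" "W \<in> \<U>" for U W
    using sec[OF that] sect_F[of "U \<inter> W"] open_coverD[OF cov] that by auto
  note ex = this
  define \<gamma> where "\<gamma> U W = (SOME y. y \<in> {y \<in> G. \<forall>P\<in>U \<inter> W. y \<in> V P} \<and> g U W = \<iota> (U \<inter> W) y)" for U W
  have \<gamma>: "\<gamma> U W \<in> {y \<in> G. \<forall>P\<in>U \<inter> W. y \<in> V P}" and g: "g U W = \<iota> (U \<inter> W) (\<gamma> U W)"
    if "U \<in> \<U>" "W \<in> \<U>" for U W
    using someI_ex[OF ex[OF that]] unfolding \<gamma>_def by blast+
  \<comment> \<open>Empty members are excluded: over the empty set \<open>\<iota>\<close> is zero,
    and the section says nothing about \<open>\<gamma>\<close>. Otherwise the triple overlap is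
    nonempty and the identity can be checked there.\<close>
  have \<gamma>_coc: "\<gamma> W Y - \<gamma> U Y + \<gamma> U W = 0"
    if "U \<in> \<U>" "W \<in> \<U>" "Y \<in> \<U>" "U \<noteq> {}" "W \<noteq> {}" "Y \<noteq> {}" for U W Y
  proof -
    let ?T = "U \<inter> W \<inter> Y"
    have sub: "?T \<subseteq> W \<inter> Y" "?T \<subseteq> U \<inter> Y" "?T \<subseteq> U \<inter> W" by auto
    have op: "openin (base F) ?T" "?T \<noteq> {}"
      using open_Int_nonempty[of "U \<inter> W" Y] open_Int_nonempty[of U W] that open_coverD[OF cov] by auto
    have "\<iota> ?T (\<gamma> W Y - \<gamma> U Y + \<gamma> U W) = \<iota> ?T 0"
      using coc[OF that(1-3)] sub that by (simp add: g \<iota>_rest \<iota>_diff \<iota>_add)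
    moreover have "\<gamma> W Y - \<gamma> U Y + \<gamma> U W \<in> {y \<in> G. \<forall>P\<in>?T. y \<in> V P}"
    proof -
      have "\<gamma> W Y - \<gamma> U Y + \<gamma> U W \<in> V P" if "P \<in> ?T" for P
      proof -
        have "P \<in> insert z A" using that op open_subset by blast
        show ?thesis
          by (rule V_add[OF _ V_diff]) (use \<open>P \<in> insert z A\<close> \<gamma>[of W Y] \<gamma>[of U Y] \<gamma>[of U W] that \<open>U \<in> \<U>\<close> \<open>W \<in> \<U>\<close> \<open>Y \<in> \<U>\<close> in auto)
      qed
      then show ?thesis using \<gamma>[of W Y] \<gamma>[of U Y] \<gamma>[of U W] that by auto
    qed
    moreover have "0 \<in> {y \<in> G. \<forall>P\<in>?T. y \<in> V P}"
      using op open_subset by (auto intro!: V_0)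
    ultimately show ?thesis
      using inj_\<iota>[OF op] by (meson inj_onD)
  qed
  have "\<forall>P\<in>insert z A. \<exists>U. U \<in> \<U> \<and> P \<in> U"
    using open_cover_Union[OF cov] by blast
  from bchoice[OF this] obtain C where C: "\<And>P. P \<in> insert z A \<Longrightarrow> C P \<in> \<U> \<and> P \<in> C P"
    by blast
  \<comment> \<open>Any nonempty member would do as base; one containing \<open>z\<close> is
    certainly nonempty.\<close>
  define U0 where "U0 = C z"
  have U0: "U0 \<in> \<U>" "U0 \<noteq> {}" using C U0_def by auto
  define h0 where "h0 U = (if U = {} then 0 else \<gamma> U0 U)" for U
  have h0_G: "h0 U \<in> G" if "U \<in> \<U>" for U
    using \<gamma>[of U0 U] U0 that by (auto simp: h0_def)
  have \<gamma>_h0: "\<gamma> U W = h0 W - h0 U" if "U \<in> \<U>" "W \<in> \<U>" "U \<noteq> {}" "W \<noteq> {}" for U W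
    using \<gamma>_coc[of U0 U W] that U0 by (simp add: h0_def algebra_simps)
  have h0_V: "h0 W - h0 U \<in> V P" if "U \<in> \<U>" "W \<in> \<U>" "P \<in> U" "P \<in> W" for U W P
  proof -
    have "U \<noteq> {}" "W \<noteq> {}" using that by auto
    then have "\<gamma> U W = h0 W - h0 U" using \<gamma>_h0 that by blast
    moreover have "\<gamma> U W \<in> V P" using \<gamma>[OF that(1,2)] that by blast
    ultimately show ?thesis by simp
  qed
  have h0_U0: "h0 U0 = 0"
    using \<gamma>_coc[of U0 U0 U0] U0 by (simp add: h0_def)
  have fin: "finite (A - U0)"
    using open_cofinite open_coverD[OF cov] U0 by blast
  have "\<forall>P\<in>A. \<exists>s. s \<in> G \<and> s - h0 (C P) \<in> V P \<and> (\<forall>Q\<in>A - {P}. s \<in> V Q)"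
    using polar_part h0_G C by blast
  from bchoice[OF this] obtain s where s: "\<And>P. P \<in> A \<Longrightarrow> s P \<in> G \<and> s P - h0 (C P) \<in> V P \<and> (\<forall>Q\<in>A - {P}. s P \<in> V Q)"
    by blast
  \<comment> \<open>At a point of \<open>A\<close> inside \<open>U0\<close> every summand is
    regular; at a point outside, only the summand belonging to that point may be irregular, and it
    carries the pole of \<open>h0\<close>.\<close>
  define t where "t = sum s (A - U0)"
  have t_G: "t \<in> G"
    unfolding t_def using s by (intro subspace_sum[OF subspace_G]) auto
  have t: "h0 (C P) - t \<in> V P" if P: "P \<in> A" for P
  proof (cases "P \<in> U0")
    case True
    then have "h0 (C P) \<in> V P" using h0_V[of U0 "C P" P] U0 h0_U0 C P by auto
    moreover have "t \<in> V P"
      unfolding t_def using s P True by (intro subspace_sum[OF subspace_V]) auto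
    ultimately show ?thesis using P V_diff by blast
  next
    case False
    have "t = s P + sum s (A - U0 - {P})"
      unfolding t_def using fin P False by (intro sum.remove) auto
    moreover have "sum s (A - U0 - {P}) \<in> V P"
      using s P by (intro subspace_sum[OF subspace_V]) auto
    moreover have "s P - h0 (C P) \<in> V P" using s P by auto
    ultimately have "t - h0 (C P) \<in> V P"
      using V_add[of P "s P - h0 (C P)" "sum s (A - U0 - {P})"] P by (simp add: algebra_simps)
    then show ?thesis
      using V_diff[of P 0 "t - h0 (C P)"] P V_0[of P] by auto
  qed
  define h where "h U = h0 U - t" for U
  \<comment> \<open>All \<open>h U\<close> with \<open>z\<close> in \<open>U\<close> agree modulo
    \<open>V z\<close>, so any one of them, here the one at \<open>C z\<close>, serves as the
    residue.\<close>
  have "splitting \<U> g (h (C z)) h"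
    unfolding splitting_def
  proof (intro conjI ballI impI)
    fix U assume U: "U \<in> \<U>"
    show "h U \<in> G" using h0_G[OF U] t_G by (simp add: h_def)
    show "h U \<in> V P" if P: "P \<in> U \<inter> A" for P
    proof -
      have "(h0 U - h0 (C P)) + (h0 (C P) - t) \<in> V P"
        by (rule V_add[OF _ h0_V]) (use P U C t in auto)
      then show ?thesis by (simp add: h_def)
    qed
    show "h U - h (C z) \<in> V z" if "z \<in> U"
      using h0_V[of "C z" U z] C that U by (auto simp: h_def)
    fix W assume W: "W \<in> \<U>"
    show "g U W = \<iota> (U \<inter> W) (h W - h U)"
      using g[OF U W] \<gamma>_h0[OF U W] by (cases "U = {} \<or> W = {}") (auto simp: \<iota>_empty h_def)
  qed
  moreover have "h (C z) \<in> G" using h0_G C t_G by (simp add: h_def)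
  ultimately show ?thesis
    using cov out unfolding represents_def by blast
qed

text \<open>Composing the splitting cochain with the refinement map keeps the residue, so refining a
  cover never changes \<open>x\<close>.\<close>

lemma represents_pull:
  assumes "represents \<U> g x" "open_cover F \<W>" "refinement \<W> \<U> \<tau>"
  shows "represents \<W> (cech_pull F \<W> \<tau> g) x"
proof -
  obtain h where h: "splitting \<U> g x h" using assms by (auto simp: represents_def)
  have ref: "\<And>W. W \<in> \<W> \<Longrightarrow> \<tau> W \<in> \<U> \<and> W \<subseteq> \<tau> W"
    using assms by (auto simp: refinement_def)
  have "splitting \<W> (cech_pull F \<W> \<tau> g) x (h \<circ> \<tau>)"
    unfolding splitting_def
  proof (intro conjI ballI impI)
    fix U assume U: "U \<in> \<W>"
    show "(h \<circ> \<tau>) U \<in> G" "\<And>P. P \<in> U \<inter> A \<Longrightarrow> (h \<circ> \<tau>) U \<in> V P" "z \<in> U \<Longrightarrow> (h \<circ> \<tau>) U - x \<in> V z"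
      using h ref[OF U] by (auto simp: splitting_def)
    fix W assume W: "W \<in> \<W>"
    have "U \<inter> W \<subseteq> \<tau> U \<inter> \<tau> W" using ref U W by blast
    moreover have "g (\<tau> U) (\<tau> W) = \<iota> (\<tau> U \<inter> \<tau> W) (h (\<tau> W) - h (\<tau> U))"
      using h ref[OF U] ref[OF W] by (auto simp: splitting_def)
    ultimately show "cech_pull F \<W> \<tau> g U W = \<iota> (U \<inter> W) ((h \<circ> \<tau>) W - (h \<circ> \<tau>) U)"
      using U W by (simp add: cech_pull_def \<iota>_rest)
  qed
  then show ?thesis
    using assms by (auto simp: represents_def cech_pull_def)
qed

lemma represents_add:
  assumes "represents \<U> g x" "represents \<U> g' x'"
  shows "represents \<U> (g + g') (x + x')"
proof -
  obtain h h' where h: "splitting \<U> g x h" "splitting \<U> g' x' h'"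
    using assms by (auto simp: represents_def)
  have "splitting \<U> (g + g') (x + x') (\<lambda>U. h U + h' U)"
    unfolding splitting_def
  proof (intro conjI ballI impI)
    fix U assume U: "U \<in> \<U>"
    show "h U + h' U \<in> G"
      using h U by (auto simp: splitting_def)
    show "h U + h' U \<in> V P" if "P \<in> U \<inter> A" for P
      by (rule V_add) (use h U that in \<open>auto simp: splitting_def\<close>)
    show "h U + h' U - (x + x') \<in> V z" if "z \<in> U"
    proof -
      have "(h U - x) + (h' U - x') \<in> V z"
        by (rule V_add) (use h U that in \<open>auto simp: splitting_def\<close>)
      then show ?thesis by (simp add: algebra_simps)
    qed
    fix W assume W: "W \<in> \<U>"
    show "(g + g') U W = \<iota> (U \<inter> W) (h W + h' W - (h U + h' U))"
      using h U W by (auto simp: splitting_def \<iota>_diff \<iota>_add)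
  qed
  then show ?thesis
    using assms by (auto simp: represents_def)
qed

lemma represents_scal:
  assumes "represents \<U> g x"
  shows "represents \<U> (\<lambda>U W. scal F c (g U W)) (smul c x)"
proof -
  obtain h where h: "splitting \<U> g x h"
    using assms by (auto simp: represents_def)
  have "splitting \<U> (\<lambda>U W. scal F c (g U W)) (smul c x) (\<lambda>U. smul c (h U))"
    unfolding splitting_def
  proof (intro conjI ballI impI)
    fix U assume U: "U \<in> \<U>"
    show "smul c (h U) \<in> G"
      using h U by (auto simp: splitting_def)
    show "smul c (h U) \<in> V P" if "P \<in> U \<inter> A" for P
      by (rule V_scale) (use h U that in \<open>auto simp: splitting_def\<close>)
    show "smul c (h U) - smul c x \<in> V z" if "z \<in> U"
      using h U that V_scale[of z "h U - x" c] by (auto simp: splitting_def scale_right_diff_distrib)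
    fix W assume W: "W \<in> \<U>"
    show "scal F c (g U W) = \<iota> (U \<inter> W) (smul c (h W) - smul c (h U))"
      using h U W by (auto simp: splitting_def \<iota>_scal scale_right_diff_distrib)
  qed
  moreover have "scal F c 0 = 0"
    using \<iota>_scal[of c "{}" 0] by simp
  ultimately show ?thesis
    using assms by (auto simp: represents_def)
qed

text \<open>A difference \<open>a + b\<close> in \<open>N\<close> is absorbed in two ways:
  \<open>a\<close>, regular on \<open>A\<close>, is subtracted from every \<open>h U\<close> and
  cancels in all differences, while \<open>b\<close> disappears modulo \<open>V z\<close>.\<close>

lemma represents_cong:
  assumes "represents \<U> g x" "x - y \<in> N"
  shows "represents \<U> g y"
proof -
  obtain h where h: "splitting \<U> g x h"
    using assms by (auto simp: represents_def)
  obtain a b where ab: "x - y = a + b" "a \<in> G" "\<forall>P\<in>A. a \<in> V P" "b \<in> V z"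
    using assms(2) by (auto simp: N_def)
  have "splitting \<U> g y (\<lambda>U. h U - a)"
    unfolding splitting_def
  proof (intro conjI ballI impI)
    fix U assume U: "U \<in> \<U>"
    show "h U - a \<in> G"
      using h U ab by (auto simp: splitting_def)
    show "h U - a \<in> V P" if "P \<in> U \<inter> A" for P
      by (rule V_diff) (use h U that ab in \<open>auto simp: splitting_def\<close>)
    show "h U - a - y \<in> V z" if "z \<in> U"
    proof -
      have "(h U - x) + b \<in> V z"
        by (rule V_add) (use h U that ab in \<open>auto simp: splitting_def\<close>)
      moreover have "b = x - y - a" using ab(1) by simp
      ultimately show ?thesis by (simp add: algebra_simps)
    qed
    fix W assume W: "W \<in> \<U>"
    show "g U W = \<iota> (U \<inter> W) (h W - a - (h U - a))"
      using h U W by (auto simp: splitting_def)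
  qed
  then show ?thesis
    using assms by (auto simp: represents_def)
qed

section \<open>Equivalence of cocycles on different covers\<close>

lemma common_refinement:
  assumes "open_cover F \<U>" "open_cover F \<V>"
  obtains \<W> \<tau> \<sigma> where "open_cover F \<W>" "refinement \<W> \<U> \<tau>" "refinement \<W> \<V> \<sigma>"
proof -
  define \<W> where "\<W> = {U \<inter> W | U W. U \<in> \<U> \<and> W \<in> \<V>}"
  have "\<Union>\<W> = \<Union>\<U> \<inter> \<Union>\<V>" unfolding \<W>_def by blast
  then have "open_cover F \<W>"
    using assms by (auto simp: open_cover_def \<W>_def)
  moreover have "\<forall>T\<in>\<W>. \<exists>U. U \<in> \<U> \<and> T \<subseteq> U" "\<forall>T\<in>\<W>. \<exists>U. U \<in> \<V> \<and> T \<subseteq> U"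
    by (auto simp: \<W>_def)
  then have "\<exists>\<tau>. refinement \<W> \<U> \<tau>" "\<exists>\<sigma>. refinement \<W> \<V> \<sigma>"
    unfolding refinement_def by metis+
  ultimately show ?thesis using that by blast
qed

text \<open>If the pulled-back cocycles differ by the coboundary of a cochain \<open>l\<close>, then
  \<open>h - h' - l\<close> takes one value on all nonempty members; this value is regular on
  \<open>A\<close> and equals \<open>x - y\<close> modulo \<open>V z\<close>. Conversely, for equal
  residues \<open>h - h'\<close> is itself a cochain of sections.\<close>

lemma cech_rel_iff:
  assumes g: "represents \<U> g x" and g': "represents \<V> g' y"
  shows "((\<U>, g), (\<V>, g')) \<in> cech_rel F \<longleftrightarrow> x - y \<in> N"
proof
  assume "x - y \<in> N"
  \<comment> \<open>With the residue \<open>y\<close> on both sides it cancels in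
    \<open>h - h'\<close> at \<open>z\<close>.\<close>
  then have g: "represents \<U> g y" using g represents_cong by blast
  obtain \<W> \<tau> \<sigma> where W: "open_cover F \<W>" "refinement \<W> \<U> \<tau>" "refinement \<W> \<V> \<sigma>"
    using common_refinement g g' by (metis represents_def)
  obtain h h' where h: "splitting \<W> (cech_pull F \<W> \<tau> g) y h" "splitting \<W> (cech_pull F \<W> \<sigma> g') y h'"
    using represents_pull[OF g W(1,2)] represents_pull[OF g' W(1,3)] by (auto simp: represents_def)
  have "h U - h' U \<in> V P" if "U \<in> \<W>" "P \<in> U" for U P
  proof (cases "P = z")
    case True
    have "(h U - y) - (h' U - y) \<in> V z"
      by (rule V_diff) (use h that True in \<open>auto simp: splitting_def\<close>)
    then show ?thesis using True by simp
  next
    case False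
    then have "P \<in> A"
      using that W open_subset open_coverD by blast
    show ?thesis
      by (rule V_diff) (use h that \<open>P \<in> A\<close> in \<open>auto simp: splitting_def\<close>)
  qed
  moreover have "h U - h' U \<in> G" if "U \<in> \<W>" for U
    using h that by (auto simp: splitting_def)
  ultimately have "\<forall>U\<in>\<W>. \<iota> U (h U - h' U) \<in> sect F U"
    using open_coverD[OF W(1)] by (auto simp: sect_F)
  moreover have "cech_pull F \<W> \<tau> g - cech_pull F \<W> \<sigma> g' = cech_delta F \<W> (\<lambda>U. \<iota> U (h U - h' U))"
  proof (intro ext)
    fix U W
    show "(cech_pull F \<W> \<tau> g - cech_pull F \<W> \<sigma> g') U W = cech_delta F \<W> (\<lambda>U. \<iota> U (h U - h' U)) U W"
    proof (cases "U \<in> \<W> \<and> W \<in> \<W>")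
      case True
      then have "cech_pull F \<W> \<tau> g U W = \<iota> (U \<inter> W) (h W - h U)"
        "cech_pull F \<W> \<sigma> g' U W = \<iota> (U \<inter> W) (h' W - h' U)"
        using h by (auto simp: splitting_def)
      then show ?thesis
        using True by (simp add: cech_delta_def \<iota>_rest algebra_simps flip: \<iota>_diff)
    qed (auto simp: cech_delta_def cech_pull_def)
  qed
  ultimately have "cech_pull F \<W> \<tau> g - cech_pull F \<W> \<sigma> g' \<in> cech_coboundaries F \<W>"
    unfolding cech_coboundaries_def by blast
  then show "((\<U>, g), (\<V>, g')) \<in> cech_rel F"
    using W represents_imp_cech_pair[OF g] represents_imp_cech_pair[OF g']
    unfolding cech_rel_def by blast
next
  assume "((\<U>, g), (\<V>, g')) \<in> cech_rel F"
  then obtain \<W> \<tau> \<sigma> k where W: "open_cover F \<W>" "refinement \<W> \<U> \<tau>" "refinement \<W> \<V> \<sigma>"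
    and k: "\<forall>U\<in>\<W>. k U \<in> sect F U"
    and eq: "cech_pull F \<W> \<tau> g - cech_pull F \<W> \<sigma> g' = cech_delta F \<W> k"
    unfolding cech_rel_def cech_coboundaries_def by blast
  obtain h h' where h: "splitting \<W> (cech_pull F \<W> \<tau> g) x h" and h': "splitting \<W> (cech_pull F \<W> \<sigma> g') y h'"
    using represents_pull[OF g W(1,2)] represents_pull[OF g' W(1,3)] by (auto simp: represents_def)
  have "\<forall>U\<in>\<W>. \<exists>l. l \<in> {y \<in> G. \<forall>P\<in>U. y \<in> V P} \<and> k U = \<iota> U l"
    using k open_coverD[OF W(1)] by (auto simp: sect_F)
  from bchoice[OF this] obtain l where l: "\<And>U. U \<in> \<W> \<Longrightarrow> l U \<in> {y \<in> G. \<forall>P\<in>U. y \<in> V P}" "\<And>U. U \<in> \<W> \<Longrightarrow> k U = \<iota> U (l U)"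
    by blast
  define e where "e U = h U - h' U - l U" for U
  have e_const: "e U = e W'" if "U \<in> \<W>" "W' \<in> \<W>" "U \<noteq> {}" "W' \<noteq> {}" for U W'
  proof -
    let ?T = "U \<inter> W'"
    have op: "openin (base F) ?T" "?T \<noteq> {}"
      using open_Int_nonempty[of U W'] that open_coverD[OF W(1)] by auto
    have "cech_pull F \<W> \<tau> g U W' = \<iota> ?T (h W' - h U)" "cech_pull F \<W> \<sigma> g' U W' = \<iota> ?T (h' W' - h' U)"
      using h h' that by (auto simp: splitting_def)
    then have "\<iota> ?T (h W' - h U) - \<iota> ?T (h' W' - h' U) = \<iota> ?T (l W' - l U)"
      using fun_cong[OF fun_cong[OF eq, of U], of W'] that
      by (simp add: cech_delta_def l \<iota>_rest \<iota>_diff)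
    then have "\<iota> ?T (h W' - h U - (h' W' - h' U)) = \<iota> ?T (l W' - l U)"
      by (simp add: \<iota>_diff)
    moreover have "h W' - h U - (h' W' - h' U) \<in> {y \<in> G. \<forall>P\<in>?T. y \<in> V P}"
      using splitting_diff_mem[OF h W(1) that(1,2)] splitting_diff_mem[OF h' W(1) that(1,2)]
        open_subset[OF op(1)] V_diff by (auto simp: subset_iff)
    moreover have "l W' - l U \<in> {y \<in> G. \<forall>P\<in>?T. y \<in> V P}"
      using l(1)[OF that(1)] l(1)[OF that(2)] open_subset[OF op(1)] V_diff
      by (auto simp: subset_iff)
    ultimately have "h W' - h U - (h' W' - h' U) = l W' - l U"
      using inj_\<iota>[OF op] by (meson inj_onD)
    then show ?thesis by (simp add: e_def algebra_simps)
  qed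
  obtain Z where Z: "Z \<in> \<W>" "z \<in> Z"
    using open_cover_Union[OF W(1)] by blast
  have "e Z \<in> V P" if P: "P \<in> A" for P
  proof -
    obtain U where U: "U \<in> \<W>" "P \<in> U"
      using open_cover_Union[OF W(1)] P by blast
    have "e U \<in> V P"
      unfolding e_def by (rule V_diff[OF _ V_diff]) (use h h' l P U in \<open>auto simp: splitting_def\<close>)
    moreover have "e Z = e U" using Z U by (intro e_const) auto
    ultimately show ?thesis by simp
  qed
  moreover have "e Z \<in> G"
    using h h' l(1)[OF Z(1)] Z by (auto simp: e_def splitting_def)
  moreover have "(h' Z - y) + l Z - (h Z - x) \<in> V z"
    by (rule V_diff[OF _ V_add]) (use h h' l(1)[OF Z(1)] Z in \<open>auto simp: splitting_def\<close>)
  moreover have "x - y = e Z + ((h' Z - y) + l Z - (h Z - x))"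
    by (simp add: e_def algebra_simps)
  ultimately show "x - y \<in> N"
    unfolding N_def by blast
qed

text \<open>Every pair has a residue, and a related pair has one congruent to \<open>x\<close>
  modulo \<open>N\<close>; \<open>represents_cong\<close> absorbs the congruence, so the class
  consists of all pairs with residue \<open>x\<close>.\<close>

lemma cech_rel_Image:
  assumes "represents \<U> g x" "x \<in> G"
  shows "cech_rel F `` {(\<U>, g)} = coh_class x"
proof -
  have "(\<V>, g') \<in> cech_rel F `` {(\<U>, g)} \<longleftrightarrow> (\<V>, g') \<in> coh_class x" for \<V> g'
  proof
    assume L: "(\<V>, g') \<in> cech_rel F `` {(\<U>, g)}"
    then have "(\<V>, g') \<in> cech_pairs F" by (auto simp: cech_rel_def)
    then obtain y where y: "represents \<V> g' y" using represents_exists by blast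
    then have "x - y \<in> N" using L cech_rel_iff[OF assms(1) y] by auto
    then have "y - x \<in> N" using subspace_neg[OF subspace_N, of "x - y"] by simp
    then show "(\<V>, g') \<in> coh_class x" using y represents_cong by (auto simp: coh_class_def)
  next
    assume "(\<V>, g') \<in> coh_class x"
    then show "(\<V>, g') \<in> cech_rel F `` {(\<U>, g)}"
      using cech_rel_iff[OF assms(1), of \<V> g' x] subspace_0[OF subspace_N] by (auto simp: coh_class_def)
  qed
  then show ?thesis by auto
qed

text \<open>The cochain with value \<open>x\<close> on \<open>W\<close> and \<open>0\<close> on
  \<open>A\<close> has a coboundary regular on the overlap. Covers are indexed by their members, so
  \<open>W\<close> and \<open>A\<close> must differ, which \<open>z\<close> guarantees.\<close>

lemma represents_two_opens:
  assumes W: "openin (base F) W" "z \<in> W" and x: "x \<in> G" "\<forall>P\<in>A \<inter> W. x \<in> V P"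
  shows "\<exists>\<U> g. represents \<U> g x"
proof -
  define h where "h U = (if U = W then x else 0)" for U
  define g where "g U U' = (if U \<in> {A, W} \<and> U' \<in> {A, W} then \<iota> (U \<inter> U') (h U' - h U) else 0)" for U U'
  have cov: "open_cover F {A, W}"
    using W open_A openin_subset topspace_F by (fastforce simp: open_cover_def)
  have "W \<noteq> A" using W z_notin by auto
  then have "splitting {A, W} g x h"
    using x z_notin unfolding splitting_def g_def h_def by (auto simp: V_0)
  then have "represents {A, W} g x"
    using cov by (auto simp: represents_def g_def)
  then show ?thesis by blast
qed

end

section \<open>From a basis of \<open>G\<close> modulo \<open>N\<close> to the dimension of the
  cohomology\<close>

locale curve_sheaf_basis = curve_sheaf +
  fixes e :: "'i \<Rightarrow> 'b" and I :: "'i set" and W :: "'c set"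
  assumes W: "openin (base F) W" "z \<in> W"
    and e_G: "i \<in> I \<Longrightarrow> e i \<in> G" and e_V: "i \<in> I \<Longrightarrow> P \<in> A \<inter> W \<Longrightarrow> e i \<in> V P"
    and finite_I: "finite I"
    and spanning: "x \<in> G \<Longrightarrow> \<exists>c. x - (\<Sum>i\<in>I. smul (c i) (e i)) \<in> N"
    and independent: "(\<Sum>i\<in>I. smul (c i) (e i)) \<in> N \<Longrightarrow> i \<in> I \<Longrightarrow> c i = 0"
begin

text \<open>An element of \<open>G\<close> may have poles on the overlap of \<open>A\<close> and
  \<open>W\<close>, so the cover by these two sets need not realise it directly. A congruent
  combination of the \<open>e i\<close>, which are regular on that overlap, can be realised
  there.\<close>

lemma coh_class_nonempty:
  assumes "x \<in> G"
  shows "\<exists>\<U> g. represents \<U> g x"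
proof -
  obtain c where c: "x - (\<Sum>i\<in>I. smul (c i) (e i)) \<in> N"
    using spanning assms by blast
  have "(\<Sum>i\<in>I. smul (c i) (e i)) \<in> G"
    using e_G by (intro subspace_sum[OF subspace_G]) auto
  moreover have "(\<Sum>i\<in>I. smul (c i) (e i)) \<in> V P" if "P \<in> A \<inter> W" for P
    using e_V that by (intro subspace_sum[OF subspace_V] V_scale) auto
  ultimately obtain \<U> g where "represents \<U> g (\<Sum>i\<in>I. smul (c i) (e i))"
    using represents_two_opens[OF W] by blast
  moreover have "(\<Sum>i\<in>I. smul (c i) (e i)) - x \<in> N"
    using subspace_neg[OF subspace_N c] by simp
  ultimately show ?thesis using represents_cong by blast
qed

lemma coh_class_eq_iff:
  assumes "x \<in> G" "y \<in> G"
  shows "coh_class x = coh_class y \<longleftrightarrow> x - y \<in> N"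
proof -
  obtain \<U> g where g: "represents \<U> g x" using coh_class_nonempty assms by blast
  obtain \<V> g' where g': "represents \<V> g' y" using coh_class_nonempty assms by blast
  have "x - y \<in> N \<Longrightarrow> y - x \<in> N"
    using subspace_neg[OF subspace_N, of "x - y"] by simp
  then show ?thesis
    using g g' cech_rel_iff[OF g] cech_rel_Image[OF g assms(1)] cech_rel_Image[OF g' assms(2)]
      represents_cong unfolding coh_class_def by blast
qed

lemma carrier_H1: "carrier (sheaf_H1 F) = coh_class ` G"
proof -
  have "cech_pairs F // cech_rel F = coh_class ` G"
  proof (intro equalityI subsetI)
    fix C assume "C \<in> cech_pairs F // cech_rel F"
    then obtain \<U> g where "(\<U>, g) \<in> cech_pairs F" "C = cech_rel F `` {(\<U>, g)}"
      by (auto elim: quotientE)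
    then show "C \<in> coh_class ` G"
      using represents_exists cech_rel_Image by blast
  next
    fix C assume "C \<in> coh_class ` G"
    then obtain x where x: "x \<in> G" "C = coh_class x" by blast
    then obtain \<U> g where g: "represents \<U> g x" using coh_class_nonempty by blast
    then show "C \<in> cech_pairs F // cech_rel F"
      using quotientI[OF represents_imp_cech_pair[OF g], of "cech_rel F"] cech_rel_Image[OF g x(1)] x(2) by simp
  qed
  then show ?thesis by (simp add: sheaf_H1_def)
qed

lemma zero_H1: "\<zero>\<^bsub>sheaf_H1 F\<^esub> = coh_class 0"
proof -
  have "open_cover F {topspace (base F)}" by (simp add: open_cover_def)
  moreover have "splitting {topspace (base F)} 0 0 (\<lambda>_. 0)"
    by (auto simp: splitting_def V_0)
  ultimately have "represents {topspace (base F)} 0 0"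
    unfolding represents_def by (auto intro!: exI[of _ "\<lambda>_. 0"])
  then show ?thesis by (simp add: sheaf_H1_def cech_rel_Image)
qed

text \<open>The sum is a union over all choices of representatives and refinements. All choices give
  the same class, and a common refinement shows that a choice exists, so the union is that
  class.\<close>

lemma add_H1:
  assumes "x \<in> G" "y \<in> G"
  shows "coh_class x \<oplus>\<^bsub>sheaf_H1 F\<^esub> coh_class y = coh_class (x + y)"
proof -
  let ?S = "{cech_rel F `` {(\<W>, cech_pull F \<W> \<tau> g + cech_pull F \<W> \<sigma> h)} | \<U> g \<V> h \<W> \<tau> \<sigma>.
       (\<U>, g) \<in> coh_class x \<and> (\<V>, h) \<in> coh_class y \<and> open_cover F \<W> \<and> refinement \<W> \<U> \<tau> \<and> refinement \<W> \<V> \<sigma>}"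
  have 1: "cech_rel F `` {(\<W>, cech_pull F \<W> \<tau> g + cech_pull F \<W> \<sigma> h)} = coh_class (x + y)"
    if "represents \<U> g x" "represents \<V> h y" "open_cover F \<W>" "refinement \<W> \<U> \<tau>" "refinement \<W> \<V> \<sigma>"
    for \<U> g \<V> h \<W> \<tau> \<sigma>
    using that assms by (intro cech_rel_Image represents_add represents_pull) auto
  obtain \<U> g \<V> h where gh: "represents \<U> g x" "represents \<V> h y"
    using assms coh_class_nonempty by metis
  then obtain \<W> \<tau> \<sigma> where "open_cover F \<W>" "refinement \<W> \<U> \<tau>" "refinement \<W> \<V> \<sigma>"
    using common_refinement by (metis represents_def)
  then have "coh_class (x + y) \<in> ?S"
    using gh 1[OF gh, of \<W> \<tau> \<sigma>] unfolding mem_coh_class by blast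
  moreover have "?S \<subseteq> {coh_class (x + y)}"
    unfolding mem_coh_class using 1 by blast
  ultimately have "?S = {coh_class (x + y)}" by (intro equalityI) (simp_all only: insert_subset empty_subsetI simp_thms)
  then have "\<Union>?S = coh_class (x + y)" by simp
  then show ?thesis by (simp add: sheaf_H1_def)
qed

lemma smult_H1:
  assumes "x \<in> G"
  shows "c \<odot>\<^bsub>sheaf_H1 F\<^esub> coh_class x = coh_class (smul c x)"
proof -
  let ?S = "{cech_rel F `` {(\<U>, \<lambda>U V. scal F c (g U V))} | \<U> g. (\<U>, g) \<in> coh_class x}"
  have 1: "cech_rel F `` {(\<U>, \<lambda>U V. scal F c (g U V))} = coh_class (smul c x)" if "represents \<U> g x" for \<U> g
    using that assms by (intro cech_rel_Image represents_scal) auto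
  obtain \<U> g where g: "represents \<U> g x" using assms coh_class_nonempty by metis
  then have "coh_class (smul c x) \<in> ?S"
    using 1[OF g] unfolding mem_coh_class by blast
  moreover have "?S \<subseteq> {coh_class (smul c x)}"
    unfolding mem_coh_class using 1 by blast
  ultimately have "?S = {coh_class (smul c x)}" by (intro equalityI) (simp_all only: insert_subset empty_subsetI simp_thms)
  then have "\<Union>?S = coh_class (smul c x)" by simp
  then show ?thesis by (simp add: sheaf_H1_def)
qed

lemma abelian_monoid_H1: "abelian_monoid (sheaf_H1 F)"
proof (rule abelian_monoidI)
qed (auto simp: carrier_H1 zero_H1 add_H1 add_ac)

lemma finsum_H1:
  assumes "finite J" "\<And>j. j \<in> J \<Longrightarrow> f j \<in> G"
  shows "finsum (sheaf_H1 F) (\<lambda>j. coh_class (f j)) J = coh_class (\<Sum>j\<in>J. f j)"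
proof -
  interpret abelian_monoid "sheaf_H1 F" by (rule abelian_monoid_H1)
  show ?thesis
    using assms
  proof (induction J rule: finite_induct)
    case empty
    then show ?case by (simp add: zero_H1)
  next
    case (insert j J)
    moreover have "(\<Sum>j\<in>J. f j) \<in> G"
      using insert.prems by (intro subspace_sum[OF subspace_G]) auto
    ultimately show ?case
      by (simp add: finsum_insert carrier_H1 add_H1 Pi_def)
  qed
qed

lemma coh_class_e_inj: "inj_on (coh_class \<circ> e) I"
proof (rule inj_onI, rule ccontr)
  fix i j assume ij: "i \<in> I" "j \<in> I" "(coh_class \<circ> e) i = (coh_class \<circ> e) j" "i \<noteq> j"
  then have "e i - e j \<in> N" using coh_class_eq_iff e_G by auto
  moreover have "(\<Sum>l\<in>I. smul (of_bool (l = i) - of_bool (l = j)) (e l)) = e i - e j"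
  proof -
    have "smul (of_bool (l = i) - of_bool (l = j)) (e l) = (if l = i then e i else 0) - (if l = j then e j else 0)" for l
      using ij by auto
    then show ?thesis using finite_I ij by (simp add: sum_subtractf)
  qed
  ultimately have "of_bool (i = i) - of_bool (i = j) = (0 :: 'a)"
    using independent[of "\<lambda>l. of_bool (l = i) - of_bool (l = j)" i] ij by simp
  then show False using ij by simp
qed

text \<open>Coefficients in \<open>has_dimension\<close> are functions on the set of classes,
  whereas \<open>spanning\<close> and \<open>independent\<close> speak of the index set; injectivity
  of the map from indices to classes translates between them.\<close>

theorem has_dimension_H1: "has_dimension (sheaf_H1 F) (card I)"
  unfolding has_dimension_def
proof (intro exI[of _ "(coh_class \<circ> e) ` I"] conjI ballI)
  let ?B = "(coh_class \<circ> e) ` I"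
  interpret abelian_monoid "sheaf_H1 F" by (rule abelian_monoid_H1)
  show "?B \<subseteq> carrier (sheaf_H1 F)" using e_G by (auto simp: carrier_H1)
  show "finite ?B" using finite_I by simp
  show "card ?B = card I" using card_image[OF coh_class_e_inj] .
  have comb: "finsum (sheaf_H1 F) (\<lambda>b. c b \<odot>\<^bsub>sheaf_H1 F\<^esub> b) ?B = coh_class (\<Sum>i\<in>I. smul (c (coh_class (e i))) (e i))" for c
  proof -
    have "finsum (sheaf_H1 F) (\<lambda>b. c b \<odot>\<^bsub>sheaf_H1 F\<^esub> b) ?B
      = finsum (sheaf_H1 F) (\<lambda>i. c ((coh_class \<circ> e) i) \<odot>\<^bsub>sheaf_H1 F\<^esub> (coh_class \<circ> e) i) I"
      by (rule add.finprod_reindex) (use e_G coh_class_e_inj in \<open>auto simp: smult_H1 carrier_H1\<close>)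
    also have "\<dots> = finsum (sheaf_H1 F) (\<lambda>i. coh_class (smul (c (coh_class (e i))) (e i))) I"
      using e_G by (intro add.finprod_cong') (auto simp: smult_H1 carrier_H1)
    finally show ?thesis
      using finsum_H1[OF finite_I, of "\<lambda>i. smul (c (coh_class (e i))) (e i)"] e_G by simp
  qed
  have sum_G: "(\<Sum>i\<in>I. smul (c i) (e i)) \<in> G" for c
    using e_G by (intro subspace_sum[OF subspace_G]) auto
  fix X assume "X \<in> carrier (sheaf_H1 F)"
  then obtain x where x: "x \<in> G" "X = coh_class x" by (auto simp: carrier_H1)
  obtain c where c: "x - (\<Sum>i\<in>I. smul (c i) (e i)) \<in> N" using spanning x by blast
  \<comment> \<open>Restricting to the basis fixes the values elsewhere, as the uniqueness of an
    extensional coefficient function demands.\<close>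
  define d where "d = restrict (\<lambda>b. c (the_inv_into I (coh_class \<circ> e) b)) ?B"
  have d: "d (coh_class (e i)) = c i" if "i \<in> I" for i
    using that the_inv_into_f_f[OF coh_class_e_inj that] by (auto simp: d_def)
  show "\<exists>!c. c \<in> extensional ?B \<and> X = finsum (sheaf_H1 F) (\<lambda>b. c b \<odot>\<^bsub>sheaf_H1 F\<^esub> b) ?B"
  proof (rule ex1I[of _ d])
    have "(\<Sum>i\<in>I. smul (d (coh_class (e i))) (e i)) = (\<Sum>i\<in>I. smul (c i) (e i))"
      using d by (intro sum.cong) auto
    then have "X = finsum (sheaf_H1 F) (\<lambda>b. d b \<odot>\<^bsub>sheaf_H1 F\<^esub> b) ?B"
      using coh_class_eq_iff[OF x(1) sum_G] c x(2) comb[of d] by simp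
    moreover have "d \<in> extensional ?B" unfolding d_def by (rule restrict_extensional)
    ultimately show "d \<in> extensional ?B \<and> X = finsum (sheaf_H1 F) (\<lambda>b. d b \<odot>\<^bsub>sheaf_H1 F\<^esub> b) ?B"
      by blast
    fix d' assume d': "d' \<in> extensional ?B \<and> X = finsum (sheaf_H1 F) (\<lambda>b. d' b \<odot>\<^bsub>sheaf_H1 F\<^esub> b) ?B"
    then have "x - (\<Sum>i\<in>I. smul (d' (coh_class (e i))) (e i)) \<in> N"
      using coh_class_eq_iff[OF x(1) sum_G[of "\<lambda>i. d' (coh_class (e i))"]] x comb by simp
    from subspace_diff[OF subspace_N c this]
    have "(\<Sum>i\<in>I. smul (d' (coh_class (e i)) - c i) (e i)) \<in> N"
      by (simp add: scale_left_diff_distrib sum_subtractf)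
    then have eq: "d' (coh_class (e i)) = c i" if "i \<in> I" for i
      using independent[of "\<lambda>i. d' (coh_class (e i)) - c i" i] that by simp
    show "d' = d"
      using d' eq d by (intro extensionalityI[of _ ?B]) (auto simp: d_def)
  qed
qed

lemma carrier_H1_nontrivial:
  assumes "I \<noteq> {}"
  shows "carrier (sheaf_H1 F) \<noteq> {\<zero>\<^bsub>sheaf_H1 F\<^esub>}"
proof
  assume "carrier (sheaf_H1 F) = {\<zero>\<^bsub>sheaf_H1 F\<^esub>}"
  moreover obtain i where i: "i \<in> I" using assms by blast
  ultimately have "coh_class (e i) = coh_class 0"
    using e_G[OF i] by (auto simp: carrier_H1 zero_H1)
  then have "e i \<in> N" using coh_class_eq_iff[OF e_G[OF i], of 0] by simp
  moreover have "(\<Sum>l\<in>I. smul (of_bool (l = i)) (e l)) = e i"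
  proof -
    have "smul (of_bool (l = i)) (e l) = (if l = i then e i else 0)" for l by auto
    then show ?thesis using finite_I i by simp
  qed
  ultimately show False
    using independent[of "\<lambda>l. of_bool (l = i)" i] i by simp
qed

end

section \<open>Homogeneous fractions regular at a point\<close>

lemma homog_0 [simp]: "homog d 0"
  by (simp add: homog_def)

lemma homog_add: "homog d a \<Longrightarrow> homog d b \<Longrightarrow> homog d (a + b)"
  unfolding homog_def by (metis add.right_neutral coeff_add)

lemma homog_mult:
  assumes "homog d a" "homog e b"
  shows "homog (d + e) (a * b)"
  unfolding homog_def
proof (intro allI impI)
  fix i j assume "coeff (coeff (a * b) i) j \<noteq> 0"
  then have "(\<Sum>k\<le>i. \<Sum>l\<le>j. coeff (coeff a k) l * coeff (coeff b (i - k)) (j - l)) \<noteq> 0"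
    by (simp add: coeff_mult coeff_sum)
  then obtain k l where "k \<le> i" "l \<le> j" "coeff (coeff a k) l * coeff (coeff b (i - k)) (j - l) \<noteq> 0"
    by (metis (no_types, lifting) atMost_iff sum.neutral)
  then have "k + l = d" "i - k + (j - l) = e" "k \<le> i" "l \<le> j"
    using assms by (auto simp: homog_def)
  then show "i + j = d + e" by linarith
qed

lemma homog_const: "homog 0 [:[:c:]:]"
  by (auto simp: homog_def coeff_pCons split: nat.splits)

lemma homog_1: "homog 0 1"
  using homog_const[of 1] by (simp add: one_pCons)

lemma homog_var_u: "homog 1 var_u"
  by (auto simp: homog_def var_u_def coeff_pCons split: nat.splits)

lemma homog_var_v: "homog 1 var_v"
  by (auto simp: homog_def var_v_def coeff_pCons one_pCons split: nat.splits)

text \<open>The degree \<open>n\<close> part of the homogeneous localisation at \<open>P\<close>,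
  that is, the stalk of O(n), inside the fraction field; for \<open>P = {0}\<close> it consists of
  all homogeneous fractions of degree \<open>n\<close>.\<close>

definition reg :: "int \<Rightarrow> 'k::field pt \<Rightarrow> 'k poly poly fract set" where
  "reg n P = {x. \<exists>a b d e. homog d a \<and> homog e b \<and> int d - int e = n \<and> b \<notin> P \<and> x = to_fract a / to_fract b}"

lemma regI: "homog d a \<Longrightarrow> homog e b \<Longrightarrow> int d - int e = n \<Longrightarrow> b \<notin> P \<Longrightarrow> to_fract a / to_fract b \<in> reg n P"
  by (auto simp: reg_def)

lemma regE:
  assumes "x \<in> reg n P"
  obtains a b d e where "homog d a" "homog e b" "int d - int e = n" "b \<notin> P" "x = to_fract a / to_fract b"
  using assms by (auto simp: reg_def)

lemma proj_pointD:
  assumes "P \<in> proj_points"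
  shows proj_point_0: "0 \<in> P"
    and proj_point_add: "a \<in> P \<Longrightarrow> b \<in> P \<Longrightarrow> a + b \<in> P"
    and proj_point_mult: "b \<in> P \<Longrightarrow> a * b \<in> P"
    and proj_point_hom_comp: "a \<in> P \<Longrightarrow> hom_comp d a \<in> P"
    and proj_point_1: "1 \<notin> P"
    and proj_point_prime: "a * b \<in> P \<Longrightarrow> a \<in> P \<or> b \<in> P"
    and proj_point_irrelevant: "var_u \<notin> P \<or> var_v \<notin> P"
  using assms unfolding proj_points_def homog_prime_def by simp_all

lemma proj_point_mult': "P \<in> proj_points \<Longrightarrow> a \<in> P \<Longrightarrow> a * b \<in> P"
  using proj_point_mult[of P a b] by (simp add: mult.commute)

lemma proj_point_uminus: "P \<in> proj_points \<Longrightarrow> a \<in> P \<Longrightarrow> - a \<in> P"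
  using proj_point_mult[of P a "- 1"] by simp

lemma proj_point_diff: "P \<in> proj_points \<Longrightarrow> a \<in> P \<Longrightarrow> b \<in> P \<Longrightarrow> a - b \<in> P"
  using proj_point_add[of P a "- b"] proj_point_uminus[of P b] by simp

lemma proj_point_power: "P \<in> proj_points \<Longrightarrow> a ^ n \<in> P \<Longrightarrow> a \<in> P"
  by (induction n) (auto dest: proj_point_prime proj_point_1)

lemma proj_point_const:
  assumes "P \<in> proj_points" "[:[:c:]:] \<in> P"
  shows "c = 0"
proof (rule ccontr)
  assume "c \<noteq> 0"
  then have "[:[:inverse c:]:] * [:[:c:]:] = 1" by (simp add: one_pCons)
  then show False using proj_point_mult[OF assms, of "[:[:inverse c:]:]"] proj_point_1[OF assms(1)] by simp
qed

section \<open>Constants and coordinates in the fraction field\<close>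

definition cst :: "'k::field \<Rightarrow> 'k poly poly fract" where "cst c = to_fract [:[:c:]:]"
definition uu :: "'k::field poly poly fract" where "uu = to_fract var_u"
definition vv :: "'k::field poly poly fract" where "vv = to_fract var_v"

lemma uu_nz [simp]: "uu \<noteq> 0" and vv_nz [simp]: "vv \<noteq> 0"
  by (auto simp: uu_def vv_def var_u_def var_v_def)

lemma to_fract_power: "to_fract (a ^ n) = to_fract a ^ n"
  by (induction n) auto

lemma to_fract_sum: "to_fract (\<Sum>i\<in>S. f i) = (\<Sum>i\<in>S. to_fract (f i))"
  by (induction S rule: infinite_finite_induct) auto

lemma cst_0 [simp]: "cst 0 = 0" and cst_1 [simp]: "cst 1 = 1"
  by (auto simp: cst_def simp flip: one_pCons)

lemma cst_add: "cst (a + b) = cst a + cst b"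
  unfolding cst_def by (simp flip: to_fract_add)

lemma cst_mult: "cst (a * b) = cst a * cst b"
  unfolding cst_def by (simp flip: to_fract_mult)

lemma cst_uminus: "cst (- a) = - cst a"
  unfolding cst_def by (simp flip: to_fract_uminus)

lemma cst_eq_0_iff [simp]: "cst c = 0 \<longleftrightarrow> c = 0"
  by (simp add: cst_def)

lemma cst_of_nat: "cst (of_nat n) = of_nat n"
  by (induction n) (auto simp: cst_add)

lemma cst_of_int: "cst (of_int n) = of_int n"
  by (cases n rule: int_cases2) (auto simp: cst_uminus cst_of_nat)

lemma homog_power: "homog d a \<Longrightarrow> homog (n * d) (a ^ n)"
  by (induction n) (auto simp: homog_1 homog_mult)

section \<open>Operations on the stalks of the twisting sheaves\<close>

context
  fixes P :: "'k::field pt"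
  assumes P: "P \<in> proj_points"
begin

lemma reg_nz: "x \<in> reg n P \<Longrightarrow> \<exists>a b d e. homog d a \<and> homog e b \<and> int d - int e = n \<and> b \<notin> P \<and> b \<noteq> 0 \<and> x = to_fract a / to_fract b"
  using proj_point_0[OF P] by (auto simp: reg_def)

text \<open>For negative \<open>n\<close> even \<open>0\<close> must be written with a denominator
  of positive degree outside \<open>P\<close>; a power of whichever of \<open>u\<close>,
  \<open>v\<close> is not in \<open>P\<close> provides it.\<close>

lemma reg_0 [simp]: "0 \<in> reg n P"
proof -
  obtain w where w: "homog 1 w" "w \<notin> P"
    using proj_point_irrelevant[OF P] homog_var_u homog_var_v by blast
  have "w ^ nat (- n) \<notin> P" using w proj_point_power[OF P] by blast
  moreover have "homog (nat (- n)) (w ^ nat (- n))" using homog_power[OF w(1), of "nat (- n)"] by simp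
  ultimately have "to_fract 0 / to_fract (w ^ nat (- n)) \<in> reg n P"
    by (intro regI[of "nat n" _ "nat (- n)"]) auto
  then show ?thesis by simp
qed

lemma reg_add:
  assumes "x \<in> reg n P" "y \<in> reg n P"
  shows "x + y \<in> reg n P"
proof -
  obtain a b d e where x: "homog d a" "homog e b" "int d - int e = n" "b \<notin> P" "b \<noteq> 0" "x = to_fract a / to_fract b"
    using reg_nz[OF assms(1)] by blast
  obtain a' b' d' e' where y: "homog d' a'" "homog e' b'" "int d' - int e' = n" "b' \<notin> P" "b' \<noteq> 0" "y = to_fract a' / to_fract b'"
    using reg_nz[OF assms(2)] by blast
  have "d' + e = d + e'" using x y by simp
  then have "homog (d + e') (a * b' + a' * b)"
    using homog_mult[OF x(1) y(2)] homog_mult[OF y(1) x(2)] homog_add by metis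
  moreover have "b * b' \<notin> P" using x y proj_point_prime[OF P] by blast
  moreover have "x + y = to_fract (a * b' + a' * b) / to_fract (b * b')"
    using x y by (simp add: add_frac_eq)
  ultimately show ?thesis
    using x y homog_mult[OF x(2) y(2)] by (auto simp del: to_fract_add to_fract_mult intro!: regI)
qed

lemma reg_mult:
  assumes "x \<in> reg n P" "y \<in> reg n' P"
  shows "x * y \<in> reg (n + n') P"
proof -
  obtain a b d e where x: "homog d a" "homog e b" "int d - int e = n" "b \<notin> P" "b \<noteq> 0" "x = to_fract a / to_fract b"
    using reg_nz[OF assms(1)] by blast
  obtain a' b' d' e' where y: "homog d' a'" "homog e' b'" "int d' - int e' = n'" "b' \<notin> P" "b' \<noteq> 0" "y = to_fract a' / to_fract b'"
    using reg_nz[OF assms(2)] by blast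
  have "b * b' \<notin> P" using x y proj_point_prime[OF P] by blast
  moreover have "x * y = to_fract (a * a') / to_fract (b * b')"
    using x y by simp
  ultimately show ?thesis
    using x y homog_mult[OF x(2) y(2)] homog_mult[OF x(1) y(1)]
    by (auto simp del: to_fract_mult intro!: regI)
qed

lemma reg_cst [simp]: "cst c \<in> reg 0 P"
  using proj_point_1[OF P] regI[OF homog_const homog_1, of 0 P c] by (simp add: cst_def)

lemma reg_of_int [simp]: "of_int c \<in> reg 0 P"
  using reg_cst[of "of_int c"] by (simp add: cst_of_int)

lemma reg_cst_mult: "x \<in> reg n P \<Longrightarrow> cst c * x \<in> reg n P"
  using reg_mult[OF reg_cst, of x n c] by simp

lemma reg_uminus: "x \<in> reg n P \<Longrightarrow> - x \<in> reg n P"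
  using reg_cst_mult[of x n "- 1"] by (simp add: cst_uminus)

lemma reg_diff: "x \<in> reg n P \<Longrightarrow> y \<in> reg n P \<Longrightarrow> x - y \<in> reg n P"
  using reg_add[of x n "- y"] reg_uminus[of y n] by simp

lemma reg_1 [simp]: "1 \<in> reg 0 P"
  using reg_cst[of 1] by simp

lemma reg_powi:
  assumes "homog 1 w" "w \<notin> P \<or> n \<ge> 0"
  shows "to_fract w powi n \<in> reg n P"
proof (cases "n \<ge> 0")
  case True
  then show ?thesis
    using regI[OF homog_power[OF assms(1), of "nat n"] homog_1, of n P] proj_point_1[OF P]
    by (simp add: power_int_def to_fract_power)
next
  case False
  then have "w ^ nat (- n) \<notin> P" using assms proj_point_power[OF P] by auto
  then show ?thesis
    using regI[OF homog_1 homog_power[OF assms(1), of "nat (- n)"], of n P] False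
    by (simp add: power_int_def to_fract_power field_simps)
qed

lemma reg_uu_powi: "var_u \<notin> P \<or> n \<ge> 0 \<Longrightarrow> uu powi n \<in> reg n P"
  and reg_vv_powi: "var_v \<notin> P \<or> n \<ge> 0 \<Longrightarrow> vv powi n \<in> reg n P"
  unfolding uu_def vv_def by (intro reg_powi homog_var_u homog_var_v; assumption)+

lemma reg_subset_generic: "reg n P \<subseteq> reg n {0}"
  using proj_point_0[OF P] by (fastforce simp: reg_def)

end

section \<open>Points of the projective line\<close>

text \<open>Homogenisation, dehomogenisation at \<open>u = 1\<close>, and substitution of \<open>v/u\<close>.\<close>

definition hz :: "nat \<Rightarrow> 'k::field poly \<Rightarrow> 'k poly poly" where
  "hz N Q = (\<Sum>i\<le>N. monom (monom (coeff Q i) (N - i)) i)"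

definition dh :: "nat \<Rightarrow> 'k::field poly poly \<Rightarrow> 'k poly" where
  "dh N q = (\<Sum>i\<le>N. monom (coeff (coeff q i) (N - i)) i)"

definition ev :: "'k::field poly \<Rightarrow> 'k poly poly fract" where
  "ev A = poly (map_poly cst A) (vv / uu)"

text \<open>\<open>pt a\<close> is the kernel of the substitution \<open>v = a u\<close>, the point
  \<open>[1 : a]\<close>, and \<open>pt_inf\<close> that of \<open>u = 0\<close>, the point
  \<open>[0 : 1]\<close>. Kernels of ring homomorphisms to domains are prime.\<close>

definition pt :: "'k::field \<Rightarrow> 'k pt" where "pt a = {p. poly p [:0, a:] = 0}"
definition pt_inf :: "'k::field pt" where "pt_inf = {p. \<forall>i. coeff (coeff p i) 0 = 0}"

lemma coeff_hz: "coeff (coeff (hz N Q) i) j = (if i \<le> N \<and> j = N - i then coeff Q i else 0)"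
proof -
  have "coeff (coeff (hz N Q) i) j = (\<Sum>k\<le>N. if k = i then (if j = N - i then coeff Q i else 0) else 0)"
    by (auto simp: hz_def coeff_sum coeff_monom intro!: sum.cong)
  also have "\<dots> = (if i \<le> N \<and> j = N - i then coeff Q i else 0)" by simp
  finally show ?thesis .
qed

lemma coeff_dh: "coeff (dh N q) i = (if i \<le> N then coeff (coeff q i) (N - i) else 0)"
proof -
  have "coeff (dh N q) i = (\<Sum>k\<le>N. if k = i then coeff (coeff q i) (N - i) else 0)"
    by (auto simp: dh_def coeff_sum coeff_monom intro!: sum.cong)
  then show ?thesis by simp
qed

lemma homog_hz: "homog N (hz N Q)"
  by (auto simp: homog_def coeff_hz split: if_splits)

lemma degree_dh: "degree (dh N q) \<le> N"
  by (rule degree_le) (auto simp: coeff_dh)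

lemma hz_dh: "homog N q \<Longrightarrow> hz N (dh N q) = q"
  by (intro poly_eqI) (fastforce simp: coeff_hz coeff_dh homog_def)

lemma hom_comp_eq_hz: "hom_comp d p = hz d (dh d p)"
  by (simp add: hom_comp_def hz_def coeff_dh)

lemma hz_eq_0_iff: "degree Q \<le> N \<Longrightarrow> hz N Q = 0 \<longleftrightarrow> Q = 0"
proof
  assume Q: "degree Q \<le> N" "hz N Q = 0"
  have "coeff Q i = 0" for i
    using coeff_hz[of N Q i "N - i"] Q coeff_eq_0[of Q i] by (cases "i \<le> N") auto
  then show "Q = 0" by (simp add: poly_eqI)
qed (simp add: hz_def)

lemma dh_nz: "q \<noteq> 0 \<Longrightarrow> \<exists>d. dh d q \<noteq> 0"
proof -
  assume "q \<noteq> 0"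
  then obtain i j where "coeff (coeff q i) j \<noteq> 0"
    by (metis leading_coeff_0_iff)
  then have "coeff (dh (i + j) q) i \<noteq> 0" by (simp add: coeff_dh)
  then show ?thesis by (intro exI[of _ "i + j"]) auto
qed

lemma ev_pCons: "ev (pCons a A) = cst a + vv / uu * ev A"
  by (simp add: ev_def map_poly_pCons)

lemma ev_0 [simp]: "ev 0 = 0"
  by (simp add: ev_def)

lemma ev_add: "ev (A + B) = ev A + ev B"
  by (induction A B rule: poly_induct2)
    (auto simp: ev_pCons cst_add cst_mult algebra_simps)

lemma ev_smult: "ev (Polynomial.smult c A) = cst c * ev A"
  by (induction A)
    (auto simp: ev_pCons cst_add cst_mult algebra_simps)

lemma ev_mult: "ev (A * B) = ev A * ev B"
  by (induction A)
    (auto simp: ev_pCons ev_add ev_smult cst_add cst_mult algebra_simps)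

lemma ev_const [simp]: "ev [:c:] = cst c"
  by (simp add: ev_pCons)

lemma ev_1 [simp]: "ev 1 = 1"
  using ev_const[of 1] by (simp add: one_pCons)

lemma ev_uminus: "ev (- A) = - ev A"
  using ev_add[of A "- A"] by (simp add: eq_neg_iff_add_eq_0 add.commute)

lemma ev_diff: "ev (A - B) = ev A - ev B"
  using ev_add[of A "- B"] by (simp add: ev_uminus)

lemma ev_power: "ev (A ^ n) = ev A ^ n"
  by (induction n) (auto simp: ev_mult)

lemma ev_X: "ev [:0, 1:] = vv / uu"
  by (simp add: ev_pCons)

lemma ev_altdef:
  assumes "degree A \<le> N"
  shows "ev A = (\<Sum>i\<le>N. cst (coeff A i) * (vv / uu) ^ i)"
proof -
  have "degree (map_poly cst A) \<le> N" using assms map_poly_degree_leq le_trans by blast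
  then have "(\<Sum>i\<le>N. coeff (map_poly cst A) i * (vv / uu) ^ i) = poly (map_poly cst A) (vv / uu)"
    unfolding poly_altdef by (intro sum.mono_neutral_right) (auto simp: coeff_eq_0)
  then show ?thesis by (simp add: ev_def coeff_map_poly)
qed

lemma monom_monom: "monom (monom c j) i = [:[:c:]:] * var_u ^ j * var_v ^ i"
proof -
  have "var_v ^ i = monom (1 :: 'a poly) i" unfolding var_v_def by (simp add: monom_altdef)
  moreover have "[:[:c:]:] * var_u ^ j = [:monom c j:]"
  proof (induction j)
    case (Suc j)
    have "[:[:c:]:] * var_u ^ Suc j = [:monom c j:] * var_u" by (simp add: Suc[symmetric] mult_ac)
    then show ?case by (simp add: var_u_def monom_Suc)
  qed (simp add: monom_0)
  ultimately show ?thesis by (simp add: smult_monom)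
qed

lemma to_fract_monom_monom: "to_fract (monom (monom c j) i) = cst c * uu ^ j * vv ^ i"
  by (simp only: monom_monom to_fract_mult to_fract_power cst_def uu_def vv_def)

lemma to_fract_hz: "degree Q \<le> N \<Longrightarrow> to_fract (hz N Q) = uu ^ N * ev Q"
proof -
  assume Q: "degree Q \<le> N"
  have "to_fract (hz N Q) = (\<Sum>i\<le>N. cst (coeff Q i) * uu ^ (N - i) * vv ^ i)"
    by (simp only: hz_def to_fract_sum to_fract_monom_monom)
  also have "\<dots> = (\<Sum>i\<le>N. uu ^ N * (cst (coeff Q i) * (vv / uu) ^ i))"
  proof (intro sum.cong refl)
    fix i assume "i \<in> {..N}"
    then show "cst (coeff Q i) * uu ^ (N - i) * vv ^ i = uu ^ N * (cst (coeff Q i) * (vv / uu) ^ i)"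
      by (simp add: power_divide power_diff)
  qed
  also have "\<dots> = uu ^ N * ev Q" by (simp only: ev_altdef[OF Q] sum_distrib_left)
  finally show ?thesis .
qed

text \<open>\<open>v/u\<close> is transcendental over the constants: multiplying \<open>ev A\<close>
  by a power of \<open>u\<close> gives the homogenisation of \<open>A\<close>, which has the same
  coefficients.\<close>

lemma ev_eq_0_iff [simp]: "ev A = 0 \<longleftrightarrow> A = 0"
proof
  assume "ev A = 0"
  then have "to_fract (hz (degree A) A) = 0" by (simp add: to_fract_hz)
  then show "A = 0" by (simp add: hz_eq_0_iff)
qed simp

lemma ev_inj: "ev A = ev B \<Longrightarrow> A = B"
  using ev_eq_0_iff[of "A - B"] by (simp add: ev_diff)

lemma to_fract_hz_hz:
  assumes "degree A \<le> d" "degree B \<le> e"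
  shows "to_fract (hz d A) / to_fract (hz e B) = uu powi (int d - int e) * (ev A / ev B)"
  using assms
  by (simp add: to_fract_hz power_int_diff)

lemma hz_mult:
  assumes "degree A \<le> d" "degree B \<le> e"
  shows "hz (d + e) (A * B) = hz d A * hz e B"
proof -
  have "degree (A * B) \<le> d + e" using assms degree_mult_le[of A B] by linarith
  then have "to_fract (hz (d + e) (A * B)) = to_fract (hz d A) * to_fract (hz e B)"
    using assms by (simp only: to_fract_hz ev_mult power_add mult_ac)
  then show ?thesis by (metis to_fract_mult to_fract_eq_iff)
qed

lemma poly_hz:
  assumes "degree Q \<le> N"
  shows "poly (hz N Q) [:0, a:] = monom (poly Q a) N"
proof -
  have "poly (monom (monom (coeff Q i) (N - i)) i) [:0, a:] = monom (coeff Q i * a ^ i) N" if "i \<le> N" for i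
  proof -
    have "[:0, a:] ^ i = monom (a ^ i) i"
      by (induction i) (auto simp: monom_0 monom_Suc one_pCons smult_monom mult_ac)
    then show ?thesis using that by (simp add: poly_monom mult_monom)
  qed
  then have "poly (hz N Q) [:0, a:] = (\<Sum>i\<le>N. monom (coeff Q i * a ^ i) N)"
    by (simp add: hz_def poly_sum)
  also have "\<dots> = monom (\<Sum>i\<le>N. coeff Q i * a ^ i) N"
    by (intro poly_eqI) (simp add: coeff_sum coeff_monom)
  also have "(\<Sum>i\<le>N. coeff Q i * a ^ i) = poly Q a"
    unfolding poly_altdef using assms by (intro sum.mono_neutral_right) (auto simp: coeff_eq_0)
  finally show ?thesis .
qed

lemma hz_in_pt: "degree Q \<le> N \<Longrightarrow> hz N Q \<in> pt a \<longleftrightarrow> poly Q a = 0"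
  by (simp add: pt_def poly_hz monom_eq_0_iff)

lemma hz_in_pt_inf: "hz N Q \<in> pt_inf \<longleftrightarrow> coeff Q N = 0"
  by (auto simp: pt_inf_def coeff_hz)

text \<open>The coefficient of \<open>u^d\<close> in \<open>p(u, a u)\<close> is the value at
  \<open>a\<close> of the dehomogenised degree \<open>d\<close> part of \<open>p\<close>; this is
  what makes \<open>pt a\<close> a homogeneous ideal.\<close>

lemma pt_iff: "p \<in> pt a \<longleftrightarrow> (\<forall>d. poly (dh d p) a = 0)"
proof -
  have "coeff (poly p [:0, a:]) d = poly (dh d p) a" for d
  proof -
    let ?M = "max d (degree p)"
    have pw: "[:0, a:] ^ i = monom (a ^ i) i" for i
      by (induction i) (auto simp: monom_0 monom_Suc one_pCons smult_monom mult_ac)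
    have "poly p [:0, a:] = (\<Sum>i\<le>?M. coeff p i * monom (a ^ i) i)"
      unfolding poly_altdef pw by (intro sum.mono_neutral_left) (auto simp: coeff_eq_0)
    then have "coeff (poly p [:0, a:]) d = (\<Sum>i\<le>?M. if i \<le> d then a ^ i * coeff (coeff p i) (d - i) else 0)"
      by (auto simp: coeff_sum mult.commute[of _ "monom _ _"] coeff_monom_mult intro!: sum.cong)
    also have "\<dots> = (\<Sum>i\<le>d. a ^ i * coeff (coeff p i) (d - i))"
      by (intro sum.mono_neutral_cong_right) auto
    also have "\<dots> = (\<Sum>i\<le>d. coeff (dh d p) i * a ^ i)"
      by (intro sum.cong) (auto simp: coeff_dh)
    also have "\<dots> = poly (dh d p) a"
      unfolding poly_altdef using degree_dh[of d p] by (intro sum.mono_neutral_right) (auto simp: coeff_eq_0)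
    finally show ?thesis .
  qed
  then show ?thesis by (auto simp: pt_def poly_eq_iff)
qed

section \<open>Classification of the points\<close>

lemma pt_proj_point: "pt a \<in> proj_points"
proof -
  have "hom_comp d p \<in> pt a" if "p \<in> pt a" for d p
    using that by (simp add: pt_iff[of p] hom_comp_eq_hz hz_in_pt degree_dh)
  moreover have "var_u \<notin> pt a" by (simp add: pt_def var_u_def)
  ultimately show ?thesis
    by (auto simp: proj_points_def homog_prime_def pt_def)
qed

lemma pt_inf_iff: "p \<in> pt_inf \<longleftrightarrow> map_poly (\<lambda>c. poly c 0) p = 0"
  by (auto simp: pt_inf_def poly_eq_iff coeff_map_poly poly_0_coeff_0)

lemma pt_inf_proj_point: "pt_inf \<in> proj_points"
proof -
  \<comment> \<open>Setting \<open>u = 0\<close> is a ring homomorphism onto polynomials in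
    \<open>v\<close>, so primality becomes the domain property there.\<close>
  define \<phi> :: "'a poly poly \<Rightarrow> 'a poly" where "\<phi> = map_poly (\<lambda>c. poly c 0)"
  have add: "\<phi> (p + q) = \<phi> p + \<phi> q" for p q
    by (intro poly_eqI) (simp add: \<phi>_def coeff_map_poly)
  have mult: "\<phi> (p * q) = \<phi> p * \<phi> q" for p q
    by (intro poly_eqI) (simp add: \<phi>_def coeff_map_poly coeff_mult poly_sum)
  have 1: "\<phi> 1 = 1" by (simp add: \<phi>_def map_poly_1)
  have mem: "p \<in> pt_inf \<longleftrightarrow> \<phi> p = 0" for p by (simp add: pt_inf_iff \<phi>_def)
  have "hom_comp d p \<in> pt_inf" if "p \<in> pt_inf" for d p
    using that by (simp add: hom_comp_eq_hz hz_in_pt_inf coeff_dh) (simp add: pt_inf_def)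
  moreover have "var_v \<notin> pt_inf"
    by (auto simp: pt_inf_def var_v_def coeff_pCons one_pCons intro!: exI[of _ 1])
  moreover have "0 \<in> (pt_inf :: 'a pt)" by (simp add: pt_inf_def)
  ultimately show ?thesis
    by (auto simp: proj_points_def homog_prime_def) (auto simp: mem add mult 1)
qed

lemma generic_proj_point: "{0} \<in> proj_points"
  by (auto simp: proj_points_def homog_prime_def hom_comp_def var_u_def)

lemma var_u_pt: "var_u \<notin> pt a" and var_u_pt_inf: "var_u \<in> pt_inf" and var_u_generic: "var_u \<notin> {0}"
  by (auto simp: pt_def pt_inf_def var_u_def coeff_pCons split: nat.splits)

lemma var_v_pt_inf: "var_v \<notin> pt_inf"
  by (auto simp: pt_inf_def var_v_def coeff_pCons one_pCons intro!: exI[of _ 1])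

text \<open>Over an algebraically closed field a form splits into linear forms
  \<open>v - a u\<close>, a power of \<open>u\<close> and a constant; a prime without
  \<open>u\<close> that contains the form contains one of the linear factors.\<close>

lemma linear_form_in_point:
  fixes P :: "'k::alg_closed_field pt"
  assumes P: "P \<in> proj_points" "var_u \<notin> P"
  shows "Q \<noteq> 0 \<Longrightarrow> degree Q \<le> N \<Longrightarrow> hz N Q \<in> P \<Longrightarrow> \<exists>a. hz 1 [:- a, 1:] \<in> P"
proof (induction "degree Q" arbitrary: Q N)
  case 0
  then obtain c where c: "Q = [:c:]" by (metis degree_eq_zeroE)
  have "hz N Q = (\<Sum>i\<le>N. if i = 0 then monom (monom c N) 0 else 0)"
    unfolding hz_def by (intro sum.cong) (auto simp: c coeff_pCons split: nat.splits)
  then have "hz N Q = [:[:c:]:] * var_u ^ N"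
    by (simp add: monom_monom)
  then have "[:[:c:]:] \<in> P"
    using 0 P proj_point_prime[OF P(1)] proj_point_power[OF P(1)] by metis
  then show ?case using proj_point_const[OF P(1)] c 0 by auto
next
  case (Suc n)
  then obtain a where "poly Q a = 0" using alg_closed_imp_poly_has_root[of Q] by auto
  then obtain Q' where Q': "Q = [:- a, 1:] * Q'" by (auto simp: poly_eq_0_iff_dvd)
  then have nz: "Q' \<noteq> 0" using Suc by auto
  then have deg: "degree Q = Suc (degree Q')" using Q' degree_mult_eq[of "[:- a, 1:]" Q'] by (simp del: mult_pCons_left)
  then have "hz (1 + (N - 1)) ([:- a, 1:] * Q') = hz 1 [:- a, 1:] * hz (N - 1) Q'"
    using Suc by (intro hz_mult) auto
  moreover have "1 + (N - 1) = N" using Suc deg by simp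
  ultimately have "hz 1 [:- a, 1:] \<in> P \<or> hz (N - 1) Q' \<in> P"
    using Suc Q' proj_point_prime[OF P(1)] by metis
  then show ?case using Suc.hyps(1)[of Q' "N - 1"] Suc.hyps(2) Suc.prems nz deg by auto
qed

text \<open>A linear form \<open>v - a u\<close> in \<open>P\<close> lets division replace any
  \<open>p\<close> modulo \<open>P\<close> by a polynomial in \<open>u\<close> alone. As
  \<open>P\<close> is homogeneous and contains neither \<open>u\<close> nor a nonzero constant, that
  remainder lies in \<open>P\<close> only if it is \<open>0\<close>, which is membership in
  \<open>pt a\<close>.\<close>

lemma affine_point_cases:
  fixes P :: "'k::alg_closed_field pt"
  assumes P: "P \<in> proj_points" "var_u \<notin> P"
  shows "P = {0} \<or> (\<exists>a. P = pt a)"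
proof (cases "P = {0}")
  case False
  then obtain p where p: "p \<in> P" "p \<noteq> 0" using proj_point_0[OF P(1)] by blast
  then obtain d where "dh d p \<noteq> 0" using dh_nz by blast
  moreover have "hz d (dh d p) \<in> P" using proj_point_hom_comp[OF P(1) p(1)] by (simp add: hom_comp_eq_hz)
  ultimately obtain a where a: "hz 1 [:- a, 1:] \<in> P"
    using linear_form_in_point[OF P] degree_dh by blast
  have lin: "hz 1 [:- a, 1:] = [:- [:0, a:], 1:]"
    by (simp add: hz_def monom_altdef one_pCons)
  have const: "q = 0" if q: "[:q:] \<in> P" for q
  proof (rule poly_eqI)
    fix j
    have "hom_comp j [:q:] = (\<Sum>i\<le>j. if i = 0 then monom (monom (coeff q j) j) 0 else 0)"
      unfolding hom_comp_def by (intro sum.cong) (auto simp: coeff_pCons split: nat.splits)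
    then have "hom_comp j [:q:] = [:[:coeff q j:]:] * var_u ^ j"
      by (simp add: monom_monom)
    then have "[:[:coeff q j:]:] \<in> P"
      using proj_point_hom_comp[OF P(1) q, of j] P proj_point_prime[OF P(1)] proj_point_power[OF P(1)] by metis
    then show "coeff q j = coeff 0 j" using proj_point_const[OF P(1)] by simp
  qed
  have "p \<in> P \<longleftrightarrow> p \<in> pt a" for p
  proof -
    have dec: "p = [:- [:0, a:], 1:] * synthetic_div p [:0, a:] + [:poly p [:0, a:]:]"
      by (simp only: synthetic_div_correct')
    have w: "[:- [:0, a:], 1:] * synthetic_div p [:0, a:] \<in> P"
      using a lin proj_point_mult'[OF P(1)] by metis
    have "p \<in> P \<longleftrightarrow> [:poly p [:0, a:]:] \<in> P"
      using dec w proj_point_add[OF P(1)] proj_point_diff[OF P(1)] by (metis add_diff_cancel_left')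
    also have "\<dots> \<longleftrightarrow> poly p [:0, a:] = 0"
      using const proj_point_0[OF P(1)] by auto
    finally show ?thesis by (simp add: pt_def)
  qed
  then show ?thesis by blast
qed simp

text \<open>Here \<open>P\<close> contains \<open>u\<close> and hence not \<open>v\<close>. Modulo
  \<open>u\<close>, the degree \<open>d\<close> part of an element of \<open>P\<close> is a constant
  times \<open>v^d\<close>, so the constant must vanish.\<close>

lemma infinite_point_eq:
  assumes P: "P \<in> proj_points" "var_u \<in> P"
  shows "P = pt_inf"
proof -
  have v: "var_v \<notin> P" using proj_point_irrelevant[OF P(1)] P by blast
  have mon: "monom (monom c j) i \<in> P" if "j > 0" for c i j
  proof -
    have "monom (monom c j) i = ([:[:c:]:] * var_u ^ (j - 1) * var_v ^ i) * var_u"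
      using that by (cases j) (auto simp: monom_monom mult_ac)
    then show ?thesis using proj_point_mult[OF P(1) P(2)] by metis
  qed
  have sum: "sum f S \<in> P" if "\<And>i. i \<in> S \<Longrightarrow> f i \<in> P" for f :: "nat \<Rightarrow> _" and S
    using that by (induction S rule: infinite_finite_induct) (auto intro: proj_point_0[OF P(1)] proj_point_add[OF P(1)])
  show ?thesis
  proof (intro equalityI subsetI)
    fix p assume p: "p \<in> P"
    have "coeff (coeff p d) 0 = 0" for d
    proof -
      let ?t = "monom (monom (coeff (coeff p d) 0) 0) d"
      let ?r = "\<Sum>i<d. monom (monom (coeff (coeff p i) (d - i)) (d - i)) i"
      have "hom_comp d p = ?t + ?r"
        unfolding hom_comp_def by (simp add: lessThan_Suc_atMost[symmetric])
      then have t: "?t = hom_comp d p - ?r" by simp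
      have "?r \<in> P" by (intro sum mon) auto
      then have "?t \<in> P"
        unfolding t by (intro proj_point_diff proj_point_hom_comp P p)
      then have "[:[:coeff (coeff p d) 0:]:] * var_v ^ d \<in> P" by (simp add: monom_monom)
      then show ?thesis
        using v proj_point_prime[OF P(1)] proj_point_power[OF P(1)] proj_point_const[OF P(1)] by metis
    qed
    then show "p \<in> pt_inf" by (simp add: pt_inf_def)
  next
    fix p :: "'a poly poly" assume p: "p \<in> pt_inf"
    have "monom (coeff p i) i \<in> P" for i
    proof -
      let ?q = "coeff p i"
      have "(\<Sum>j\<le>degree ?q. monom (monom (coeff ?q j) j) i) = monom (\<Sum>j\<le>degree ?q. monom (coeff ?q j) j) i"
        by (intro poly_eqI) (simp add: coeff_sum)
      then have "monom ?q i = (\<Sum>j\<le>degree ?q. monom (monom (coeff ?q j) j) i)"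
        by (simp only: poly_as_sum_of_monoms)
      moreover have "monom (monom (coeff (coeff p i) j) j) i \<in> P" for j
        using p mon[of j] proj_point_0[OF P(1)] by (cases "j = 0") (auto simp: pt_inf_def)
      ultimately show ?thesis using sum by simp
    qed
    then have "(\<Sum>i\<le>degree p. monom (coeff p i) i) \<in> P" by (intro sum) auto
    then show "p \<in> P" by (simp only: poly_as_sum_of_monoms)
  qed
qed

section \<open>Homogeneous fractions on the projective line\<close>

lemma to_fract_homog: "homog d a \<Longrightarrow> to_fract a = uu ^ d * ev (dh d a)"
  using to_fract_hz[OF degree_dh, of d a] by (simp add: hz_dh)

section \<open>The stalks in the affine coordinate \<open>v/u\<close>\<close>

lemma reg_dehomogenize:
  assumes "x \<in> reg n P"
  obtains a b d e where "homog d a" "homog e b" "int d - int e = n" "b \<notin> P"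
    "x = uu powi n * (ev (dh d a) / ev (dh e b))"
proof -
  obtain a b d e where x: "homog d a" "homog e b" "int d - int e = n" "b \<notin> P" "x = to_fract a / to_fract b"
    using assms by (rule regE)
  have "x = uu powi (int d - int e) * (ev (dh d a) / ev (dh e b))"
    using x(5) by (simp add: to_fract_homog[OF x(1)] to_fract_homog[OF x(2)] power_int_diff)
  then show ?thesis using that x(1-4) by simp
qed

lemma reg_homogenize:
  assumes "\<And>e. e \<ge> degree B \<Longrightarrow> hz e B \<notin> P"
  shows "uu powi n * (ev A / ev B) \<in> reg n P"
proof -
  \<comment> \<open>Large enough that the numerator degree \<open>e + n\<close> is nonnegative and
    at least \<open>degree A\<close>.\<close>
  define e where "e = degree B + degree A + nat \<bar>n\<bar>"
  define d where "d = nat (int e + n)"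
  have d: "degree A \<le> d" "int d - int e = n" and e: "degree B \<le> e"
    by (auto simp: d_def e_def)
  show ?thesis
    using regI[OF homog_hz homog_hz, of d e n B P A] assms e to_fract_hz_hz[OF d(1) e] d(2) by simp
qed

lemma reg_pt_iff: "x \<in> reg n (pt a) \<longleftrightarrow> (\<exists>A B. poly B a \<noteq> 0 \<and> x = uu powi n * (ev A / ev B))"
proof
  assume "x \<in> reg n (pt a)"
  then obtain p q d e where x: "homog d p" "homog e q" "q \<notin> pt a"
    "x = uu powi n * (ev (dh d p) / ev (dh e q))"
    by (rule reg_dehomogenize)
  then have "poly (dh e q) a \<noteq> 0" using hz_in_pt[OF degree_dh, of e q a] by (simp add: hz_dh)
  then show "\<exists>A B. poly B a \<noteq> 0 \<and> x = uu powi n * (ev A / ev B)" using x(4) by blast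
next
  assume "\<exists>A B. poly B a \<noteq> 0 \<and> x = uu powi n * (ev A / ev B)"
  then obtain A B where AB: "poly B a \<noteq> 0" "x = uu powi n * (ev A / ev B)" by blast
  show "x \<in> reg n (pt a)"
    unfolding AB(2) using AB(1) by (intro reg_homogenize) (simp add: hz_in_pt)
qed

lemma reg_generic_iff: "x \<in> reg n {0} \<longleftrightarrow> (\<exists>A B. B \<noteq> 0 \<and> x = uu powi n * (ev A / ev B))"
proof
  assume "x \<in> reg n {0}"
  then obtain p q d e where x: "homog d p" "homog e q" "q \<notin> {0}"
    "x = uu powi n * (ev (dh d p) / ev (dh e q))"
    by (rule reg_dehomogenize)
  then have "dh e q \<noteq> 0" using hz_eq_0_iff[OF degree_dh, of e q] by (simp add: hz_dh)
  then show "\<exists>A B. B \<noteq> 0 \<and> x = uu powi n * (ev A / ev B)" using x(4) by blast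
next
  assume "\<exists>A B. B \<noteq> 0 \<and> x = uu powi n * (ev A / ev B)"
  then obtain A B where AB: "B \<noteq> 0" "x = uu powi n * (ev A / ev B)" by blast
  show "x \<in> reg n {0}"
    unfolding AB(2) using AB(1) by (intro reg_homogenize) (simp add: hz_eq_0_iff)
qed

text \<open>Measured against the generator \<open>v^n\<close> at infinity, \<open>u^n\<close>
  vanishes to order \<open>n\<close> and \<open>ev A / ev B\<close> to order
  \<open>degree B - degree A\<close>; regularity is nonnegativity of the sum.\<close>

lemma reg_inf_iff:
  "x \<in> reg n pt_inf \<longleftrightarrow> (\<exists>A B. B \<noteq> 0 \<and> (A = 0 \<or> int (degree A) \<le> int (degree B) + n) \<and> x = uu powi n * (ev A / ev B))"
proof
  assume "x \<in> reg n pt_inf"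
  then obtain p q d e where x: "homog d p" "homog e q" "int d - int e = n" "q \<notin> pt_inf"
    "x = uu powi n * (ev (dh d p) / ev (dh e q))"
    by (rule reg_dehomogenize)
  have "coeff (dh e q) e \<noteq> 0"
    using x hz_in_pt_inf[of e "dh e q"] by (simp add: hz_dh)
  then have "dh e q \<noteq> 0" "e \<le> degree (dh e q)" by (auto intro: le_degree)
  moreover have "int (degree (dh d p)) \<le> int d" using degree_dh[of d p] by simp
  ultimately have "dh e q \<noteq> 0" "int (degree (dh d p)) \<le> int (degree (dh e q)) + n"
    using x(3) by linarith+
  then show "\<exists>A B. B \<noteq> 0 \<and> (A = 0 \<or> int (degree A) \<le> int (degree B) + n) \<and> x = uu powi n * (ev A / ev B)"
    using x(5) by blast
next
  assume "\<exists>A B. B \<noteq> 0 \<and> (A = 0 \<or> int (degree A) \<le> int (degree B) + n) \<and> x = uu powi n * (ev A / ev B)"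
  then obtain A B where AB: "B \<noteq> 0" "A = 0 \<or> int (degree A) \<le> int (degree B) + n" "x = uu powi n * (ev A / ev B)"
    by blast
  show "x \<in> reg n pt_inf"
  proof (cases "A = 0")
    case True
    then show ?thesis using AB reg_0[OF pt_inf_proj_point] by simp
  next
    case False
    define d where "d = nat (int (degree B) + n)"
    have d: "degree A \<le> d" "int d - int (degree B) = n"
      using AB False by (auto simp: d_def)
    have "hz (degree B) B \<notin> pt_inf" using AB by (simp add: hz_in_pt_inf)
    then show ?thesis
      using regI[OF homog_hz homog_hz, of d "degree B" n B pt_inf A] to_fract_hz_hz[OF d(1) order.refl] d(2) AB by simp
  qed
qed

lemma reg_ev_affine:
  fixes P :: "'k::field pt"
  assumes "P \<in> proj_points" "var_u \<notin> P"
  shows "uu powi n * ev Q \<in> reg n P"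
proof -
  have "hz e 1 \<notin> P" for e
  proof -
    have "to_fract (hz e 1 :: 'k poly poly) = to_fract (var_u ^ e)"
      by (simp add: to_fract_hz to_fract_power uu_def)
    then show ?thesis using assms proj_point_power[of P var_u e] by auto
  qed
  then show ?thesis using reg_homogenize[of 1 P n Q] by simp
qed

text \<open>Partial fractions by induction on the pole order at \<open>a\<close>: the term
  \<open>c / (X - a)^(j+1)\<close> with \<open>c = A(a) / C(a)\<close> removes the leading pole and
  is regular at every other \<open>pt b\<close>.\<close>

lemma polar_part_pt_aux:
  assumes "poly C a \<noteq> 0" "x = uu powi n * (ev A / (ev [:- a, 1:] ^ j * ev C))"
  shows "\<exists>s\<in>reg n {0}. s - x \<in> reg n (pt a) \<and> (\<forall>b. b \<noteq> a \<longrightarrow> s \<in> reg n (pt b))"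
  using assms
proof (induction j arbitrary: x A)
  case 0
  then have "x \<in> reg n (pt a)" by (auto simp: reg_pt_iff)
  then show ?case
    using reg_uminus[OF pt_proj_point] reg_0[OF pt_proj_point] reg_0[OF generic_proj_point]
    by (intro bexI[of _ 0]) auto
next
  case (Suc j)
  let ?L = "[:- a, 1:]"
  define c where "c = poly A a / poly C a"
  \<comment> \<open>The choice of \<open>c\<close> makes this numerator vanish at \<open>a\<close>,
    so one factor of the denominator cancels.\<close>
  have "poly (A - Polynomial.smult c C) a = 0" using Suc.prems by (simp add: c_def)
  then obtain A' where A': "A - Polynomial.smult c C = ?L * A'"
    by (metis dvdE poly_eq_0_iff_dvd)
  define t where "t = uu powi n * (ev [:c:] / ev (?L ^ Suc j))"
  have nz: "ev ?L \<noteq> 0" "ev C \<noteq> 0" using Suc.prems by auto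
  have "ev A = cst c * ev C + ev ?L * ev A'"
    using A' ev_smult[of c C] ev_mult[of ?L A'] ev_diff[of A "Polynomial.smult c C"] by simp
  then have "x - t = uu powi n * (ev A' / (ev ?L ^ j * ev C))"
    using nz unfolding Suc.prems(2) t_def ev_power ev_const by (simp add: field_simps)
  from Suc.IH[OF Suc.prems(1) this] obtain s where s: "s \<in> reg n {0}" "s - (x - t) \<in> reg n (pt a)"
    "\<forall>b. b \<noteq> a \<longrightarrow> s \<in> reg n (pt b)"
    by blast
  have "t \<in> reg n {0}" unfolding t_def reg_generic_iff
    by (rule exI[of _ "[:c:]"], rule exI[of _ "?L ^ Suc j"]) (simp del: power_Suc)
  moreover have "t \<in> reg n (pt b)" if "b \<noteq> a" for b
    unfolding t_def reg_pt_iff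
    by (rule exI[of _ "[:c:]"], rule exI[of _ "?L ^ Suc j"]) (use that in \<open>simp del: power_Suc\<close>)
  ultimately show ?case
    using s by (intro bexI[of _ "s + t"])
      (auto simp: algebra_simps intro: reg_add[OF generic_proj_point] reg_add[OF pt_proj_point])
qed

lemma polar_part_pt:
  assumes "x \<in> reg n {0}"
  shows "\<exists>s\<in>reg n {0}. s - x \<in> reg n (pt a) \<and> (\<forall>b. b \<noteq> a \<longrightarrow> s \<in> reg n (pt b))"
proof -
  obtain A B where B: "B \<noteq> 0" and x: "x = uu powi n * (ev A / ev B)"
    using assms by (auto simp: reg_generic_iff)
  obtain C where C: "B = [:- a, 1:] ^ order a B * C" "\<not> [:- a, 1:] dvd C"
    using order_decomp[OF B] by blast
  then have "ev B = ev [:- a, 1:] ^ order a B * ev C"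
    by (metis ev_mult ev_power)
  then show ?thesis
    using polar_part_pt_aux[of C a x n A "order a B"] C x by (simp add: poly_eq_0_iff_dvd)
qed

text \<open>Regularity at \<open>pt a\<close> forces each root \<open>a\<close> of a denominator to
  be a root of the numerator, so roots are cancelled one at a time. Algebraic closedness ends the
  descent at a constant denominator.\<close>

lemma reg_all_affine_polynomial:
  fixes x :: "'k::alg_closed_field poly poly fract"
  assumes "\<And>a. x \<in> reg n (pt a)"
  shows "\<exists>Q. x = uu powi n * ev Q"
proof -
  have *: "B \<noteq> 0 \<Longrightarrow> ev B * x = uu powi n * ev A \<Longrightarrow> \<exists>Q. x = uu powi n * ev Q" for A B
  proof (induction "degree B" arbitrary: A B)
    case 0
    then obtain c where c: "B = [:c:]" "c \<noteq> 0" by (metis degree_eq_zeroE pCons_0_0)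
    then have "x = cst (1 / c) * (ev B * x)"
      by (simp flip: mult.assoc cst_mult)
    then have "x = uu powi n * ev (Polynomial.smult (1 / c) A)"
      using 0 by (simp add: ev_smult)
    then show ?case by blast
  next
    case (Suc m)
    then obtain a where "poly B a = 0" using alg_closed_imp_poly_has_root[of B] by auto
    then obtain B' where B': "B = [:- a, 1:] * B'" by (auto simp: poly_eq_0_iff_dvd)
    then have nz: "B' \<noteq> 0" using Suc.prems by auto
    have deg: "degree B = Suc (degree B')"
      using B' nz degree_mult_eq[of "[:- a, 1:]" B'] by (simp del: mult_pCons_left)
    obtain C D where x: "poly D a \<noteq> 0" "x = uu powi n * (ev C / ev D)"
      using assms[of a] by (auto simp: reg_pt_iff)
    then have "ev D \<noteq> 0" by auto
    then have "ev B * ev C = ev A * ev D"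
      using Suc.prems(2) x(2) by (simp add: field_simps)
    then have "B * C = A * D" by (intro ev_inj) (simp add: ev_mult)
    then have "poly A a * poly D a = 0" using \<open>poly B a = 0\<close> by (metis mult_zero_left poly_mult)
    then have "poly A a = 0" using x by simp
    then obtain A' where A': "A = [:- a, 1:] * A'" by (auto simp: poly_eq_0_iff_dvd)
    have "ev [:- a, 1:] * (ev B' * x) = ev [:- a, 1:] * (uu powi n * ev A')"
      using Suc.prems(2) unfolding A' B' ev_mult by (simp only: ac_simps)
    then have "ev B' * x = uu powi n * ev A'" by simp
    then show ?case using Suc.hyps(1)[of B' A'] Suc.hyps(2) deg nz by simp
  qed
  obtain A B where AB: "poly B 0 \<noteq> 0" "x = uu powi n * (ev A / ev B)"
    using assms[of 0] by (auto simp: reg_pt_iff)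
  then have "B \<noteq> 0" by auto
  then show ?thesis using AB(2) by (intro *[of B A]) auto
qed

section \<open>Laurent monomials and the cohomology of the twisting sheaves\<close>

definition laurent :: "int \<Rightarrow> nat \<Rightarrow> 'k::field poly poly fract" where
  "laurent n i = uu powi n * (uu / vv) ^ i"

lemma degree_less_of_coeff:
  assumes "degree p \<le> D" "coeff p D = 0" "p \<noteq> 0"
  shows "degree p < D"
  using assms by (metis le_neq_implies_less leading_coeff_0_iff)

text \<open>Expansion at infinity in powers of \<open>u/v\<close>: each step multiplies the
  numerator by \<open>X\<close> and subtracts the multiple of \<open>B\<close> that removes the
  coefficient in degree \<open>degree B\<close>. The numerator stays below the degree of
  \<open>B\<close> while the denominator gains a factor \<open>X\<close>.\<close>

lemma proper_fraction_expansion: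
  assumes "B \<noteq> 0" "r = 0 \<or> degree r < degree B"
  shows "\<exists>c r'. (r' = 0 \<or> degree r' < degree B) \<and>
    ev r / ev B = (\<Sum>i=1..N. cst (c i) * (uu / vv) ^ i) + ev r' / (ev [:0, 1:] ^ N * ev B)"
proof (induction N)
  case 0
  then show ?case using assms by (intro exI[of _ "\<lambda>_. 0"] exI[of _ r]) auto
next
  case (Suc N)
  then obtain c r' where r': "r' = 0 \<or> degree r' < degree B"
    and eq: "ev r / ev B = (\<Sum>i=1..N. cst (c i) * (uu / vv) ^ i) + ev r' / (ev [:0, 1:] ^ N * ev B)"
    by blast
  define k where "k = coeff (pCons 0 r') (degree B) / coeff B (degree B)"
  define r'' where "r'' = pCons 0 r' - Polynomial.smult k B"
  have "degree r'' \<le> degree B"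
    unfolding r''_def using r' by (intro degree_diff_le) (auto simp: degree_pCons_eq_if)
  moreover have "coeff r'' (degree B) = 0"
    using assms by (simp add: r''_def k_def)
  ultimately have r'': "r'' = 0 \<or> degree r'' < degree B"
    using degree_less_of_coeff by blast
  have nz: "ev B \<noteq> 0" using assms by simp
  have "ev [:0, 1:] * ev r' = cst k * ev B + ev r''"
    by (simp add: r''_def ev_diff ev_smult ev_pCons)
  moreover have "ev r' / (ev [:0, 1:] ^ N * ev B) = (ev [:0, 1:] * ev r') / (ev [:0, 1:] ^ Suc N * ev B)"
    by (simp add: mult.assoc)
  ultimately have "ev r' / (ev [:0, 1:] ^ N * ev B) = (cst k * ev B + ev r'') / (ev [:0, 1:] ^ Suc N * ev B)"
    by simp
  also have "\<dots> = cst k * (uu / vv) ^ Suc N + ev r'' / (ev [:0, 1:] ^ Suc N * ev B)"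
    using nz by (simp add: ev_X field_simps)
  finally have "ev r / ev B = (\<Sum>i=1..Suc N. cst ((c(Suc N := k)) i) * (uu / vv) ^ i) + ev r'' / (ev [:0, 1:] ^ Suc N * ev B)"
    using eq by simp
  then show ?case using r'' by blast
qed

text \<open>The polynomial part of \<open>A / B\<close> is regular on the affine chart. Of the
  proper part, the first \<open>-n-1\<close> terms of the expansion at infinity are kept; the rest
  has order at least \<open>-n\<close> there, so its product with \<open>u^n\<close> is regular. For
  \<open>n \<ge> -1\<close> the sum is empty.\<close>

lemma laurent_spanning:
  fixes x :: "'k::field poly poly fract"
  assumes "x \<in> reg n {0}"
  shows "\<exists>c y w. x = (\<Sum>i=1..nat (- n - 1). cst (c i) * laurent n i) + y + w \<and>
    (\<forall>P\<in>proj_points. var_u \<notin> P \<longrightarrow> y \<in> reg n P) \<and> w \<in> reg n pt_inf"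
proof -
  let ?N = "nat (- n - 1)"
  obtain A B where B: "B \<noteq> 0" and x: "x = uu powi n * (ev A / ev B)"
    using assms by (auto simp: reg_generic_iff)
  have "A mod B = 0 \<or> degree (A mod B) < degree B" using degree_mod_less[OF B] .
  from proper_fraction_expansion[OF B this, of ?N] obtain c r where
    r: "r = 0 \<or> degree r < degree B"
    and eq: "ev (A mod B) / ev B = (\<Sum>i=1..?N. cst (c i) * (uu / vv) ^ i) + ev r / (ev [:0, 1:] ^ ?N * ev B)"
    by blast
  define w where "w = uu powi n * (ev r / ev ([:0, 1:] ^ ?N * B))"
  have "ev A = ev (A div B) * ev B + ev (A mod B)"
    by (metis div_mult_mod_eq ev_add ev_mult)
  then have "ev A / ev B = ev (A div B) + ev (A mod B) / ev B"
    using B by (simp add: add_divide_distrib)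
  then have "x = uu powi n * ((\<Sum>i=1..?N. cst (c i) * (uu / vv) ^ i) + ev (A div B) + ev r / (ev [:0, 1:] ^ ?N * ev B))"
    unfolding x eq by (simp add: algebra_simps)
  also have "\<dots> = (\<Sum>i=1..?N. cst (c i) * laurent n i) + uu powi n * ev (A div B) + w"
    by (simp only: w_def ev_mult ev_power distrib_left sum_distrib_left laurent_def mult.left_commute)
  finally have "x = (\<Sum>i=1..?N. cst (c i) * laurent n i) + uu powi n * ev (A div B) + w" .
  moreover have "w \<in> reg n pt_inf"
  proof -
    have "degree ([:0, 1:] ^ ?N * B) = ?N + degree B"
      using B by (simp add: degree_mult_eq degree_power_eq)
    then have "r = 0 \<or> int (degree r) \<le> int (degree ([:0, 1:] ^ ?N * B)) + n"
      using r by auto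
    moreover have "[:0, 1:] ^ ?N * B \<noteq> 0" using B by simp
    ultimately show ?thesis unfolding w_def reg_inf_iff by blast
  qed
  ultimately show ?thesis using reg_ev_affine by blast
qed

text \<open>Multiplying by \<open>X^N B\<close> with \<open>N = -n-1\<close> gives
  \<open>(C - X^N Q) B = X^N A\<close>, where \<open>C\<close> collects the \<open>c i\<close>. The
  degree bound on \<open>A\<close> leaves no room for a nonzero left factor, so
  \<open>C = X^N Q\<close>; but \<open>C\<close> has coefficients only below \<open>N\<close>, so
  they all vanish.\<close>

lemma laurent_independent:
  fixes y :: "'k::alg_closed_field poly poly fract"
  assumes eq: "(\<Sum>i=1..nat (- n - 1). cst (c i) * laurent n i) = y + w"
    and y: "\<And>a. y \<in> reg n (pt a)" and w: "w \<in> reg n pt_inf"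
    and i: "i \<in> {1..nat (- n - 1)}"
  shows "c i = 0"
proof -
  let ?N = "nat (- n - 1)"
  let ?X = "[:0, 1:] :: 'k poly"
  obtain Q where Q: "y = uu powi n * ev Q" using reg_all_affine_polynomial[OF y] by blast
  obtain A B where B: "B \<noteq> 0" and A: "A = 0 \<or> int (degree A) \<le> int (degree B) + n"
    and w: "w = uu powi n * (ev A / ev B)"
    using w by (auto simp: reg_inf_iff)
  define C where "C = (\<Sum>i=1..?N. Polynomial.smult (c i) (?X ^ (?N - i)))"
  have ev_sum: "ev (\<Sum>i\<in>S. f i) = (\<Sum>i\<in>S. ev (f i))" for f :: "nat \<Rightarrow> 'k poly" and S
    by (induction S rule: infinite_finite_induct) (auto simp: ev_add)
  have "ev C = (\<Sum>i=1..?N. ev ?X ^ ?N * (cst (c i) * (uu / vv) ^ i))"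
    unfolding C_def ev_sum
  proof (intro sum.cong refl)
    fix i assume "i \<in> {1..?N}"
    then have "(vv / uu :: 'k poly poly fract) ^ (?N - i) = (vv / uu) ^ ?N * (uu / vv) ^ i"
      by (simp add: power_diff power_divide)
    then show "ev (Polynomial.smult (c i) (?X ^ (?N - i))) = ev ?X ^ ?N * (cst (c i) * (uu / vv) ^ i)"
      by (simp only: ev_smult ev_power ev_X ac_simps)
  qed
  also have "\<dots> = ev ?X ^ ?N * (\<Sum>i=1..?N. cst (c i) * (uu / vv) ^ i)"
    by (simp only: sum_distrib_left)
  finally have evC: "ev C = ev ?X ^ ?N * (\<Sum>i=1..?N. cst (c i) * (uu / vv) ^ i)" .
  have "uu powi n * (\<Sum>i=1..?N. cst (c i) * (uu / vv) ^ i) = uu powi n * (ev Q + ev A / ev B)"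
    using eq unfolding Q w by (simp only: sum_distrib_left laurent_def mult.left_commute distrib_left)
  then have "(\<Sum>i=1..?N. cst (c i) * (uu / vv) ^ i) = ev Q + ev A / ev B" by simp
  then have "ev C * ev B = ev ?X ^ ?N * ((ev Q + ev A / ev B) * ev B)"
    unfolding evC by (simp only: mult.assoc)
  also have "(ev Q + ev A / ev B) * ev B = ev Q * ev B + ev A"
    using B by (simp add: distrib_right)
  finally have "ev C * ev B = ev ?X ^ ?N * (ev Q * ev B + ev A)" .
  then have "ev ((C - ?X ^ ?N * Q) * B) = ev (?X ^ ?N * A)"
    by (simp add: ev_mult ev_diff ev_power algebra_simps)
  then have E: "(C - ?X ^ ?N * Q) * B = ?X ^ ?N * A" by (rule ev_inj)
  have mon: "?X ^ j = monom 1 j" for j by (simp add: monom_altdef)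
  have "C - ?X ^ ?N * Q = 0"
  proof (rule ccontr)
    assume nz: "C - ?X ^ ?N * Q \<noteq> 0"
    then have "A \<noteq> 0" using E B by auto
    have "degree (C - ?X ^ ?N * Q) + degree B = ?N + degree A"
      using arg_cong[OF E, of degree] nz B \<open>A \<noteq> 0\<close> by (simp add: degree_mult_eq degree_power_eq)
    then show False using A \<open>A \<noteq> 0\<close> i by auto
  qed
  then have "C = ?X ^ ?N * Q" by simp
  moreover have "?N - i < ?N" using i by auto
  ultimately have "coeff C (?N - i) = 0" by (simp add: mon coeff_monom_mult)
  moreover have "coeff C (?N - i) = (\<Sum>l=1..?N. if l = i then c l else 0)"
    unfolding C_def coeff_sum using i by (intro sum.cong) (auto simp: mon)
  ultimately show ?thesis using i by simp
qed

section \<open>The Zariski topology on the projective line\<close>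

lemma zariski_openD: "zariski_open U \<Longrightarrow> U \<subseteq> proj_points"
  by (auto simp: zariski_open_def)

lemma zariski_open_basic: "zariski_open {P \<in> proj_points. b \<notin> P}"
  unfolding zariski_open_def by (intro exI[of _ "{b}"]) auto

lemma zariski_open_Int: "zariski_open U \<Longrightarrow> zariski_open V \<Longrightarrow> zariski_open (U \<inter> V)"
  using openin_Int[of zariski U V] by simp

lemma zariski_open_generic: "zariski_open U \<Longrightarrow> U \<noteq> {} \<Longrightarrow> {0} \<in> U"
  using generic_proj_point by (auto simp: zariski_open_def proj_points_def homog_prime_def)

lemma zariski_open_proj_points: "zariski_open proj_points"
  using openin_topspace[of zariski] by (simp add: topspace_zariski)

text \<open>A fraction with denominator \<open>b\<close> stays valid on the basic open set of points
  not containing \<open>b\<close>.\<close>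

lemma zariski_open_reg:
  assumes "zariski_open U"
  shows "zariski_open {P \<in> U. x \<in> reg n P}"
proof -
  have "\<exists>T. zariski_open T \<and> P \<in> T \<and> T \<subseteq> {P \<in> U. x \<in> reg n P}" if P: "P \<in> U" "x \<in> reg n P" for P
  proof -
    obtain a b d e where x: "homog d a" "homog e b" "int d - int e = n" "b \<notin> P" "x = to_fract a / to_fract b"
      using P(2) by (rule regE)
    have "U \<inter> {Q \<in> proj_points. b \<notin> Q} \<subseteq> {P \<in> U. x \<in> reg n P}"
      using x by (auto intro: regI)
    then show ?thesis
      using P x zariski_openD[OF assms] zariski_open_Int[OF assms zariski_open_basic[of b]] by blast
  qed
  then have "openin zariski {P \<in> U. x \<in> reg n P}"
    by (subst openin_subopen) auto
  then show ?thesis by simp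
qed

text \<open>A missing point contains some fixed nonzero \<open>e\<close>; on the affine chart it is
  therefore \<open>pt a\<close> for a root \<open>a\<close> of a nonzero dehomogenised component of
  \<open>e\<close>.\<close>

lemma zariski_open_cofinite:
  fixes U :: "'k::alg_closed_field pt set"
  assumes "zariski_open U" "U \<noteq> {}"
  shows "finite ({P \<in> proj_points. var_u \<notin> P} - U)"
proof -
  obtain E where U: "U = {P \<in> proj_points. \<not> E \<subseteq> P}" using assms by (auto simp: zariski_open_def)
  obtain P e where "P \<in> proj_points" "e \<in> E" "e \<notin> P" using assms U by blast
  then have e: "e \<in> E" "e \<noteq> 0" using proj_point_0 by auto
  obtain d where d: "dh d e \<noteq> 0" using dh_nz[OF e(2)] by blast
  have "{P \<in> proj_points. var_u \<notin> P} - U \<subseteq> pt ` {a. poly (dh d e) a = 0}"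
  proof
    fix P assume P: "P \<in> {P \<in> proj_points. var_u \<notin> P} - U"
    then have "e \<in> P" using U e by blast
    then have "P \<noteq> {0}" using e by blast
    then obtain a where a: "P = pt a" using affine_point_cases[of P] P by blast
    then show "P \<in> pt ` {a. poly (dh d e) a = 0}" using \<open>e \<in> P\<close> pt_iff by blast
  qed
  then show ?thesis using poly_roots_finite[OF d] finite_surj by blast
qed

section \<open>Differentiation with respect to \<open>v\<close>\<close>

text \<open>The partial derivative by \<open>v\<close> with \<open>u\<close> constant, extended by
  the quotient rule in the form \<open>(a' - x b') / b\<close>. Many fractions represent
  \<open>x\<close>, hence the choice operator.\<close>

definition vder :: "'k::field poly poly fract \<Rightarrow> 'k poly poly fract" where
  "vder x = (SOME y. \<exists>a b. b \<noteq> 0 \<and> x = to_fract a / to_fract b \<and>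
     y = (to_fract (pderiv a) - x * to_fract (pderiv b)) / to_fract b)"

lemma fract_exhaust: obtains a b where "b \<noteq> 0" "x = to_fract a / to_fract b"
  by (cases x) (auto simp: Fract_conv_to_fract)

text \<open>Two representations satisfy a cross-multiplied polynomial identity; differentiating it
  shows that their quotient rules agree.\<close>

lemma vder_fract:
  assumes "b \<noteq> 0" "x = to_fract a / to_fract b"
  shows "vder x = (to_fract (pderiv a) - x * to_fract (pderiv b)) / to_fract b"
  unfolding vder_def
proof (rule some_equality)
  fix y assume "\<exists>a b. b \<noteq> 0 \<and> x = to_fract a / to_fract b \<and>
     y = (to_fract (pderiv a) - x * to_fract (pderiv b)) / to_fract b"
  then obtain a' b' where y: "b' \<noteq> 0" "x = to_fract a' / to_fract b'"
    "y = (to_fract (pderiv a') - x * to_fract (pderiv b')) / to_fract b'"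
    by blast
  have a: "to_fract a = x * to_fract b" by (subst assms(2)) (use assms(1) in simp)
  have a': "to_fract a' = x * to_fract b'" by (subst y(2)) (use y(1) in simp)
  from a a'
  have "to_fract (a * b') = to_fract (a' * b)" by simp
  then have "pderiv (a * b') = pderiv (a' * b)" by (simp only: to_fract_eq_iff)
  then have "to_fract (a * pderiv b' + b' * pderiv a) = to_fract (a' * pderiv b + b * pderiv a')"
    by (simp only: pderiv_mult)
  then have "(to_fract (pderiv a') - x * to_fract (pderiv b')) * to_fract b = (to_fract (pderiv a) - x * to_fract (pderiv b)) * to_fract b'"
    using a a' by (simp add: algebra_simps)
  then show "y = (to_fract (pderiv a) - x * to_fract (pderiv b)) / to_fract b"
    using y(1,3) assms(1) by (simp add: frac_eq_eq)
qed (use assms in blast)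

lemma vder_to_fract: "vder (to_fract a) = to_fract (pderiv a)"
  using vder_fract[of 1 "to_fract a" a] by simp

lemma vder_simps [simp]: "vder 0 = 0" "vder 1 = 0" "vder (cst c) = 0" "vder uu = 0" "vder vv = 1"
proof -
  show "vder 0 = 0" "vder 1 = 0" using vder_to_fract[of 0] vder_to_fract[of 1] by auto
  show "vder (cst c) = 0" "vder uu = 0" "vder vv = 1"
    by (auto simp: cst_def uu_def vv_def vder_to_fract var_u_def var_v_def pderiv_pCons simp flip: one_pCons)
qed

lemma vder_mult: "vder (x * y) = x * vder y + y * vder x"
proof -
  obtain a b where x: "b \<noteq> 0" "x = to_fract a / to_fract b" by (rule fract_exhaust)
  obtain c d where y: "d \<noteq> 0" "y = to_fract c / to_fract d" by (rule fract_exhaust)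
  have *: "to_fract a = x * to_fract b" "to_fract c = y * to_fract d" using x y by auto
  have "vder (x * y) = (to_fract (pderiv (a * c)) - x * y * to_fract (pderiv (b * d))) / to_fract (b * d)"
    using x y by (intro vder_fract) auto
  also have "\<dots> = x * vder y + y * vder x"
    unfolding vder_fract[OF x] vder_fract[OF y] pderiv_mult to_fract_add to_fract_mult *
    using x(1) y(1) by (simp add: divide_simps) (simp add: algebra_simps)
  finally show ?thesis .
qed

lemma vder_add: "vder (x + y) = vder x + vder y"
proof -
  obtain a b where x: "b \<noteq> 0" "x = to_fract a / to_fract b" by (rule fract_exhaust)
  obtain c d where y: "d \<noteq> 0" "y = to_fract c / to_fract d" by (rule fract_exhaust)
  have *: "to_fract a = x * to_fract b" "to_fract c = y * to_fract d" using x y by auto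
  have "vder (x + y) = (to_fract (pderiv (a * d + c * b)) - (x + y) * to_fract (pderiv (b * d))) / to_fract (b * d)"
    using x y by (intro vder_fract) (auto simp: add_frac_eq)
  also have "\<dots> = vder x + vder y"
    unfolding vder_fract[OF x] vder_fract[OF y] pderiv_add pderiv_mult to_fract_add to_fract_mult *
    using x(1) y(1) by (simp add: divide_simps) (simp add: algebra_simps)
  finally show ?thesis .
qed

lemma vder_inverse: "x \<noteq> 0 \<Longrightarrow> vder (inverse x) = - vder x / x\<^sup>2"
  using vder_mult[of x "inverse x"] by (simp add: field_simps power2_eq_square add_eq_0_iff)

lemma vder_power: "vder (x ^ n) = of_nat n * x ^ (n - 1) * vder x"
proof (induction n)
  case (Suc n)
  then show ?case by (cases n) (auto simp: vder_mult algebra_simps)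
qed simp

lemma vder_powi: "x \<noteq> 0 \<Longrightarrow> vder (x powi n) = of_int n * x powi (n - 1) * vder x"
proof (cases n rule: int_cases2)
  case (nonneg k)
  then have "vder (x powi n) = of_nat k * x ^ (k - 1) * vder x" by (simp add: vder_power)
  moreover have "of_nat k * x ^ (k - 1) = of_int n * x powi (n - 1)" using nonneg by (cases k) auto
  ultimately show ?thesis by simp
next
  case (nonpos k)
  assume x: "x \<noteq> 0"
  show ?thesis
  proof (cases k)
    case (Suc l)
    have "n = - int (Suc l)" "n - 1 = - int (Suc (Suc l))" using nonpos Suc by auto
    then have n: "x powi n = inverse (x ^ Suc l)" "x powi (n - 1) = inverse (x ^ Suc (Suc l))"
      by (simp_all only: power_int_minus power_int_of_nat)
    have "vder (x powi n) = - (of_nat (Suc l) * x ^ l * vder x) / (x ^ Suc l)\<^sup>2"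
      using x vder_inverse[of "x ^ Suc l"] vder_power[of x "Suc l"] unfolding n by simp
    also have "\<dots> = of_int n * x powi (n - 1) * vder x"
    proof -
      have "of_int n = - (of_nat (Suc l) :: 'a poly poly fract)" using \<open>n = - int (Suc l)\<close> by simp
      then show ?thesis
        unfolding n(2) using x by (simp add: field_simps power2_eq_square del: of_nat_Suc)
    qed
    finally show ?thesis .
  qed (use nonpos in simp)
qed

section \<open>Homogeneity and Euler's relation\<close>

lemma coeff_coeff_pderiv: "coeff (coeff (pderiv a) i) j = of_nat (Suc i) * coeff (coeff a (Suc i)) j"
  by (simp add: coeff_pderiv of_nat_poly del: of_nat_Suc)

lemma homog_pderiv: "homog d a \<Longrightarrow> homog (d - 1) (pderiv a)"
  by (fastforce simp: homog_def coeff_coeff_pderiv)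

lemma pderiv_homog_0: "homog 0 a \<Longrightarrow> pderiv a = 0"
  by (intro poly_eqI) (force simp: homog_def coeff_coeff_pderiv)

lemma homog_pderiv_u: "homog d a \<Longrightarrow> homog (d - 1) (map_poly pderiv a)"
  by (fastforce simp: homog_def coeff_map_poly coeff_pderiv)

lemma pderiv_u_homog_0: "homog 0 a \<Longrightarrow> map_poly pderiv a = 0"
  by (intro poly_eqI) (auto simp: homog_def coeff_map_poly coeff_pderiv)

text \<open>Each monomial \<open>u^j v^i\<close> is an eigenvector of both operators. Here
  \<open>map_poly pderiv\<close> differentiates the inner polynomials and so is the partial
  derivative by \<open>u\<close>.\<close>

lemma euler_homog:
  assumes "homog d a"
  shows "var_v * pderiv a = of_nat d * a - var_u * map_poly pderiv a"
proof (intro poly_eqI)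
  fix i j
  have v: "coeff (coeff (var_v * pderiv a) i) j = of_nat i * coeff (coeff a i) j"
    by (cases i) (auto simp: var_v_def coeff_coeff_pderiv)
  have u: "coeff (coeff (var_u * map_poly pderiv a) i) j = of_nat j * coeff (coeff a i) j"
    by (cases j) (auto simp: var_u_def coeff_pderiv coeff_map_poly)
  have d: "coeff (coeff (of_nat d * a) i) j = of_nat d * coeff (coeff a i) j"
    by (simp add: of_nat_poly)
  show "coeff (coeff (var_v * pderiv a) i) j = coeff (coeff (of_nat d * a - var_u * map_poly pderiv a) i) j"
  proof (cases "coeff (coeff a i) j = 0")
    case False
    then have "d = i + j" using assms by (auto simp: homog_def)
    then show ?thesis unfolding coeff_diff u v d by (simp add: distrib_right)
  qed (simp add: u v d)
qed

context
  fixes P :: "'k::field pt"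
  assumes P: "P \<in> proj_points"
begin

lemma reg_to_fract: "homog d a \<Longrightarrow> to_fract a \<in> reg (int d) P"
  using regI[OF _ homog_1, of d a "int d" P] proj_point_1[OF P] by simp

lemma reg_inverse_to_fract: "homog d a \<Longrightarrow> a \<notin> P \<Longrightarrow> inverse (to_fract a) \<in> reg (- int d) P"
  using regI[OF homog_1, of d a "- int d" P] by (simp add: field_simps)

lemma reg_pderiv: "homog d a \<Longrightarrow> to_fract (pderiv a) \<in> reg (int d - 1) P"
  using reg_to_fract[OF homog_pderiv, of d a] pderiv_homog_0[of a] reg_0[OF P] by (cases "d = 0") auto

lemma reg_pderiv_u: "homog d a \<Longrightarrow> to_fract (map_poly pderiv a) \<in> reg (int d - 1) P"
  using reg_to_fract[OF homog_pderiv_u, of d a] pderiv_u_homog_0[of a] reg_0[OF P] by (cases "d = 0") auto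

text \<open>Stated for arbitrary \<open>a'\<close> and \<open>b'\<close> so that it serves both
  partial derivatives.\<close>

lemma reg_quotient_rule:
  assumes "x \<in> reg n P" "int d - int e = n" "homog e b" "b \<notin> P"
    and "a' \<in> reg (int d - 1) P" "b' \<in> reg (int e - 1) P"
  shows "(a' - x * b') / to_fract b \<in> reg (n - 1) P"
proof -
  have "x * b' \<in> reg (int d - 1) P"
    using reg_mult[OF P assms(1,6)] assms(2) by (simp add: algebra_simps)
  then have "a' - x * b' \<in> reg (int d - 1) P" using assms reg_diff[OF P] by blast
  from reg_mult[OF P this reg_inverse_to_fract[OF assms(3,4)]] show ?thesis
    using assms(2) by (simp add: field_simps)
qed

lemma reg_vder:
  assumes "x \<in> reg n P"
  shows "vder x \<in> reg (n - 1) P"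
proof -
  obtain a b d e where x: "homog d a" "homog e b" "int d - int e = n" "b \<notin> P" "x = to_fract a / to_fract b"
    using assms by (rule regE)
  have b: "b \<noteq> 0" using x proj_point_0[OF P] by auto
  show ?thesis
    unfolding vder_fract[OF b x(5)]
    by (rule reg_quotient_rule[OF assms x(3) x(2) x(4) reg_pderiv[OF x(1)] reg_pderiv[OF x(2)]])
qed

text \<open>The witness \<open>w\<close> is the partial derivative of \<open>x\<close> by
  \<open>u\<close>. The relation trades a factor \<open>v\<close> for a factor \<open>u\<close>,
  which controls derivatives where \<open>u\<close> vanishes.\<close>

lemma euler_reg:
  assumes "x \<in> reg n P"
  shows "\<exists>w\<in>reg (n - 1) P. vv * vder x = of_int n * x - uu * w"
proof -
  obtain a b d e where x: "homog d a" "homog e b" "int d - int e = n" "b \<notin> P" "x = to_fract a / to_fract b"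
    using assms by (rule regE)
  have b: "b \<noteq> 0" using x proj_point_0[OF P] by auto
  let ?u = "\<lambda>p. to_fract (map_poly pderiv p) :: 'k poly poly fract"
  have of_nat: "to_fract (of_nat k) = of_nat k" for k
    by (induction k) auto
  have E: "vv * to_fract (pderiv p) = of_nat k * to_fract p - uu * ?u p" if "homog k p" for k p
    using arg_cong[OF euler_homog[OF that], of to_fract] by (simp add: uu_def vv_def of_nat)
  have a: "to_fract a = x * to_fract b" by (subst x(5)) (use b in simp)
  have "vv * (to_fract (pderiv a) - x * to_fract (pderiv b)) = vv * to_fract (pderiv a) - x * (vv * to_fract (pderiv b))"
    by (simp add: algebra_simps)
  also have "\<dots> = of_int n * x * to_fract b - uu * (?u a - x * ?u b)"
    unfolding E[OF x(1)] E[OF x(2)] a x(3)[symmetric] by (simp add: algebra_simps)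
  finally have eq: "vv * (to_fract (pderiv a) - x * to_fract (pderiv b)) = of_int n * x * to_fract b - uu * (?u a - x * ?u b)" .
  have "c * (Y / t) = r - c' * (Z / t)" if "c * Y = r * t - c' * Z" "t \<noteq> 0" for c Y t r c' Z :: "'k poly poly fract"
    using that by (simp add: field_simps)
  from this[OF eq] have "vv * vder x = of_int n * x - uu * ((?u a - x * ?u b) / to_fract b)"
    unfolding vder_fract[OF b x(5)] using b by simp
  moreover have "(?u a - x * ?u b) / to_fract b \<in> reg (n - 1) P"
    by (rule reg_quotient_rule[OF assms x(3) x(2) x(4) reg_pderiv_u[OF x(1)] reg_pderiv_u[OF x(2)]])
  ultimately show ?thesis by blast
qed

end

section \<open>Derivations of the structure sheaf\<close>

type_synonym 'k fpair = "'k poly poly fract \<times> 'k poly poly fract"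

definition sec :: "'k::field pt set \<Rightarrow> 'k fpair \<Rightarrow> 'k ssec" where
  "sec W x = (\<lambda>P. if P \<in> W then x else 0)"

text \<open>The inserted \<open>{0}\<close> matters for \<open>W = {}\<close>: then
  \<open>regs m {}\<close> is the stalk at the generic point instead of the whole type.\<close>

definition regs :: "int \<Rightarrow> 'k::field pt set \<Rightarrow> 'k fpair set" where
  "regs m W = {x. \<forall>P\<in>insert {0} W. fst x \<in> reg 0 P \<and> snd x \<in> reg (- m) P}"

definition psmult :: "'k::field \<Rightarrow> 'k fpair \<Rightarrow> 'k fpair" where
  "psmult c x = (cst c * fst x, cst c * snd x)"

definition pmul :: "'k::field fpair \<Rightarrow> 'k fpair \<Rightarrow> 'k fpair" where
  "pmul x y = (fst x * fst y, fst x * snd y + snd x * fst y)"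

definition has_parity :: "bit \<Rightarrow> 'k::field fpair \<Rightarrow> bool" where
  "has_parity p x \<longleftrightarrow> (if p = 0 then snd x = 0 else fst x = 0)"

lemma sec_add: "sec W x + sec W y = sec W (x + y)"
  and sec_empty [simp]: "sec {} x = 0"
  and sec_0 [simp]: "sec W 0 = 0"
  and sec_generic: "{0} \<in> W \<Longrightarrow> sec W x {0} = x"
  by (auto simp: sec_def fun_eq_iff)

lemma sec_cong_iff: "W \<noteq> {} \<Longrightarrow> sec W x = sec W y \<longleftrightarrow> x = y"
  by (auto simp: sec_def fun_eq_iff)

section \<open>The structure sheaf read off at the generic point\<close>

lemma WP_simps [simp]:
  "sp_top (WP m) = zariski"
  "sp_mult (WP m) (sec W x) (sec W y) = sec W (pmul x y)"
  "sp_scale (WP m) c (sec W x) = sec W (psmult c x)"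
  "sp_scale (WP m) c 0 = 0"
  "V \<subseteq> W \<Longrightarrow> sp_res (WP m) V (sec W x) = sec V x"
  by (auto simp: WP_def sec_def pmul_def psmult_def fun_eq_iff cst_def to_fract_def zero_prod_def)

lemma koszul_sec: "koszul p q (sec W x) = sec W (koszul p q x)"
  by (auto simp: koszul_def sec_def fun_eq_iff)

text \<open>All local fractions of a section agree with its value at \<open>{0}\<close>, a point of
  every nonempty open set; so a section is one fraction that is regular at each point of
  \<open>U\<close>.\<close>

lemma twist_sections_eq:
  assumes U: "zariski_open U"
  shows "twist_sections n U = {\<lambda>P. if P \<in> U then x else 0 | x. \<forall>P\<in>insert {0} U. x \<in> reg n P}"
proof (intro equalityI subsetI)
  fix s assume s: "s \<in> twist_sections n U"
  show "s \<in> {\<lambda>P. if P \<in> U then x else 0 | x. \<forall>P\<in>insert {0} U. x \<in> reg n P}"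
  proof (cases "U = {}")
    case True
    then have "s = (\<lambda>P. if P \<in> U then 0 else 0)"
      using s by (auto simp: twist_sections_def fun_eq_iff)
    then show ?thesis using True reg_0[OF generic_proj_point] by auto
  next
    case False
    have *: "s P = s {0} \<and> s {0} \<in> reg n P" if P: "P \<in> U" for P
    proof -
      obtain V a b d e where V: "zariski_open V" "P \<in> V" and
        ab: "homog d a" "homog e b" "int d - int e = n" "\<forall>Q\<in>V. b \<notin> Q \<and> s Q = Fract a b"
        using s P unfolding twist_sections_def by blast
      have "{0} \<in> V" using zariski_open_generic V by blast
      then have "s {0} = Fract a b" "s P = Fract a b" "b \<notin> P" using ab V by auto
      then show ?thesis using ab by (auto simp: Fract_conv_to_fract intro!: regI)
    qed
    moreover have "s P = 0" if "P \<notin> U" for P using s that by (auto simp: twist_sections_def)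
    ultimately have "s = (\<lambda>P. if P \<in> U then s {0} else 0)" by (auto simp: fun_eq_iff)
    moreover have "\<forall>P\<in>insert {0} U. s {0} \<in> reg n P"
      using * zariski_open_generic[OF U False] by blast
    ultimately show ?thesis by blast
  qed
next
  fix s assume "s \<in> {\<lambda>P. if P \<in> U then x else 0 | x. \<forall>P\<in>insert {0} U. x \<in> reg n P}"
  then obtain x where x: "s = (\<lambda>P. if P \<in> U then x else 0)" "\<forall>P\<in>U. x \<in> reg n P" by blast
  have "\<exists>V a b d e. zariski_open V \<and> P \<in> V \<and> V \<subseteq> U \<and>
        homog d a \<and> homog e b \<and> int d - int e = n \<and> (\<forall>Q\<in>V. b \<notin> Q \<and> s Q = Fract a b)" if P: "P \<in> U" for P
  proof -
    obtain a b d e where ab: "homog d a" "homog e b" "int d - int e = n" "b \<notin> P" "x = to_fract a / to_fract b"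
      using x(2) P by (meson regE)
    have V: "zariski_open (U \<inter> {Q \<in> proj_points. b \<notin> Q})"
      by (intro zariski_open_Int U zariski_open_basic)
    have "P \<in> U \<inter> {Q \<in> proj_points. b \<notin> Q}" using P ab zariski_openD[OF U] by blast
    moreover have "\<forall>Q\<in>U \<inter> {Q \<in> proj_points. b \<notin> Q}. b \<notin> Q \<and> s Q = Fract a b"
      by (auto simp: x ab Fract_conv_to_fract)
    ultimately show ?thesis using V ab(1-3) by blast
  qed
  then show "s \<in> twist_sections n U" by (auto simp: twist_sections_def x(1))
qed

lemma proj_points_insert_generic: "zariski_open U \<Longrightarrow> P \<in> insert {0} U \<Longrightarrow> P \<in> proj_points"
  using zariski_openD generic_proj_point by auto

lemma sp_sec_WP:
  assumes "zariski_open U"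
  shows "sp_sec (WP m) p U = sec U ` {x \<in> regs m U. has_parity p x}"
proof -
  have tw: "twist_sections n U = (\<lambda>x P. if P \<in> U then x else 0) ` {x. \<forall>P\<in>insert {0} U. x \<in> reg n P}" for n
    unfolding twist_sections_eq[OF assms] by blast
  have zero: "0 \<in> reg n P" if "P \<in> insert {0} U" for P n
    using reg_0 proj_points_insert_generic[OF assms that] by blast
  show ?thesis
  proof (cases "p = 0")
    case True
    have "sp_sec (WP m) p U = (\<lambda>f P. (f P, 0)) ` twist_sections 0 U"
      using True by (auto simp: WP_def)
    also have "\<dots> = (\<lambda>f. sec U (f, 0)) ` {f. \<forall>P\<in>insert {0} U. f \<in> reg 0 P}"
      unfolding tw image_image by (intro image_cong refl) (auto simp: sec_def fun_eq_iff zero_prod_def)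
    also have "\<dots> = sec U ` (\<lambda>f. (f, 0)) ` {f. \<forall>P\<in>insert {0} U. f \<in> reg 0 P}"
      by (simp only: image_image)
    also have "(\<lambda>f. (f, 0)) ` {f. \<forall>P\<in>insert {0} U. f \<in> reg 0 P} = {x \<in> regs m U. has_parity p x}"
      unfolding regs_def has_parity_def using True zero by (auto intro!: image_eqI)
    finally show ?thesis .
  next
    case False
    have "sp_sec (WP m) p U = (\<lambda>h P. (0, h P)) ` twist_sections (- m) U"
      using False by (auto simp: WP_def)
    also have "\<dots> = (\<lambda>h. sec U (0, h)) ` {h. \<forall>P\<in>insert {0} U. h \<in> reg (- m) P}"
      unfolding tw image_image by (intro image_cong refl) (auto simp: sec_def fun_eq_iff zero_prod_def)
    also have "\<dots> = sec U ` (\<lambda>h. (0, h)) ` {h. \<forall>P\<in>insert {0} U. h \<in> reg (- m) P}"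
      by (simp only: image_image)
    also have "(\<lambda>h. (0, h)) ` {h. \<forall>P\<in>insert {0} U. h \<in> reg (- m) P} = {x \<in> regs m U. has_parity p x}"
      unfolding regs_def has_parity_def using False zero by (auto intro!: image_eqI)
    finally show ?thesis .
  qed
qed

lemma sp_all_WP:
  assumes "zariski_open U"
  shows "sp_all (WP m) U = sec U ` regs m U"
proof (intro equalityI subsetI)
  fix s assume "s \<in> sp_all (WP m) U"
  then obtain x y where xy: "x \<in> regs m U" "y \<in> regs m U" "s = sec U (x + y)"
    by (auto simp: sp_all_def sp_sec_WP[OF assms] sec_add)
  have "x + y \<in> regs m U"
    using xy proj_points_insert_generic[OF assms] by (auto simp: regs_def reg_add)
  then show "s \<in> sec U ` regs m U" using xy by blast
next
  fix s assume "s \<in> sec U ` regs m U"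
  then obtain x where x: "x \<in> regs m U" "s = sec U x" by blast
  have "(fst x, 0) \<in> regs m U" "(0, snd x) \<in> regs m U"
    using x proj_points_insert_generic[OF assms] by (auto simp: regs_def reg_0)
  moreover have "s = sec U (fst x, 0) + sec U (0, snd x)"
    by (simp add: sec_add x)
  moreover have "has_parity 0 (fst x, 0)" "has_parity 1 (0, snd x)" by (auto simp: has_parity_def)
  ultimately show "s \<in> sp_all (WP m) U"
    unfolding sp_all_def sp_sec_WP[OF assms] by blast
qed

lemma regs_closed:
  assumes "zariski_open U" "x \<in> regs m U"
  shows regs_add: "y \<in> regs m U \<Longrightarrow> x + y \<in> regs m U"
    and regs_psmult: "psmult c x \<in> regs m U"
    and regs_pmul: "y \<in> regs m U \<Longrightarrow> pmul x y \<in> regs m U"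
    and regs_parts: "(fst x, 0) \<in> regs m U" "(0, snd x) \<in> regs m U"
proof -
  note P = proj_points_insert_generic[OF assms(1)]
  show "y \<in> regs m U \<Longrightarrow> x + y \<in> regs m U" "psmult c x \<in> regs m U"
    "(fst x, 0) \<in> regs m U" "(0, snd x) \<in> regs m U"
    using assms(2) P by (auto simp: regs_def psmult_def reg_add reg_cst_mult)
  assume y: "y \<in> regs m U"
  have "fst (pmul x y) \<in> reg 0 P \<and> snd (pmul x y) \<in> reg (- m) P" if "P \<in> insert {0} U" for P
  proof -
    have "fst x \<in> reg 0 P" "snd x \<in> reg (- m) P" "fst y \<in> reg 0 P" "snd y \<in> reg (- m) P"
      using that assms(2) y by (auto simp: regs_def)
    then show ?thesis
      using reg_mult[OF P[OF that], of "fst x" 0 "fst y" 0] reg_mult[OF P[OF that], of "fst x" 0 "snd y" "- m"]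
        reg_mult[OF P[OF that], of "snd x" "- m" "fst y" 0] reg_add[OF P[OF that]]
      by (simp add: pmul_def)
  qed
  then show "pmul x y \<in> regs m U" unfolding regs_def by blast
qed

text \<open>On functions of degree 0 the operator \<open>vder f / uu\<close> is, up to the twist by \<open>\<O>(2)\<close>, the
  derivative in either affine coordinate: by Euler's relation it equals \<open>- f\<^sub>u / v\<close>, so it is regular
  wherever \<open>f\<close> is.\<close>

definition dhat :: "bit \<Rightarrow> 'k::field fpair \<Rightarrow> 'k fpair \<Rightarrow> 'k fpair" where
  "dhat d \<gamma> x = (if d = 0
     then (fst \<gamma> * vder (fst x) / uu, fst \<gamma> * vder (snd x) / uu + snd \<gamma> * snd x)
     else (snd \<gamma> * snd x, fst \<gamma> * vder (fst x) / uu))"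

text \<open>For even \<open>d\<close> the coefficient \<open>snd \<gamma>\<close> is computed in the trivialisation \<open>u\<^sup>-\<^sup>m\<close> of \<open>\<O>(-m)\<close>; where \<open>u\<close>
  vanishes, \<open>v\<^sup>-\<^sup>m\<close> has to be used instead, which shifts it by a multiple of \<open>fst \<gamma>\<close>.\<close>

definition coefs :: "int \<Rightarrow> bit \<Rightarrow> 'k::field pt \<Rightarrow> 'k fpair set" where
  "coefs m d P = (if d = 0
     then {\<gamma>. fst \<gamma> \<in> reg 2 P \<and> (if var_u \<notin> P then snd \<gamma> \<in> reg 0 P
            else snd \<gamma> \<in> reg 0 {0} \<and> snd \<gamma> - of_int m * fst \<gamma> / (uu * vv) \<in> reg 0 P)}
     else reg (2 - m) P \<times> reg m P)"

lemma dhat_add: "dhat d \<gamma> (x + y) = dhat d \<gamma> x + dhat d \<gamma> y"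
  by (simp add: dhat_def vder_add add_divide_distrib distrib_left)

lemma dhat_psmult: "dhat d \<gamma> (psmult c x) = psmult c (dhat d \<gamma> x)"
  by (simp add: dhat_def psmult_def vder_mult algebra_simps)

lemma dhat_add_coef: "dhat d (\<gamma> + \<gamma>') x = dhat d \<gamma> x + dhat d \<gamma>' x"
  by (simp add: dhat_def add_divide_distrib distrib_right)

lemma dhat_psmult_coef: "dhat d (psmult c \<gamma>) x = psmult c (dhat d \<gamma> x)"
  by (simp add: dhat_def psmult_def algebra_simps)

text \<open>For odd \<open>d\<close> and two odd factors the product is zero, and the two terms on
  the right cancel by the Koszul sign.\<close>

lemma dhat_pmul:
  "has_parity p x \<Longrightarrow> dhat d \<gamma> (pmul x y) = pmul (dhat d \<gamma> x) y + koszul d p (pmul x (dhat d \<gamma> y))"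
  by (auto simp: has_parity_def dhat_def pmul_def koszul_def vder_mult vder_add field_simps split: if_splits)

lemma dhat_has_parity: "has_parity p x \<Longrightarrow> has_parity (p + d) (dhat d \<gamma> x)"
  by (cases p; cases d) (auto simp: has_parity_def dhat_def)

lemma reg_vder_over_uu:
  assumes P: "P \<in> proj_points" and f: "f \<in> reg 0 P"
  shows "vder f / uu \<in> reg (- 2) P"
proof (cases "var_u \<in> P")
  case False
  then show ?thesis
    using reg_mult[OF P reg_vder[OF P f] reg_uu_powi[OF P, of "- 1"]] by (simp add: field_simps)
next
  case True
  then have v: "var_v \<notin> P" using proj_point_irrelevant[OF P] by blast
  obtain w where w: "w \<in> reg (- 1) P" "vv * vder f = - uu * w"
    using euler_reg[OF P f] by auto
  then have "vder f / uu = - (w * vv powi (- 1))" by (simp add: field_simps)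
  moreover have "w * vv powi (- 1) \<in> reg (- 2) P"
    using reg_mult[OF P w(1) reg_vv_powi[OF P, of "- 1"]] v by simp
  ultimately show ?thesis using reg_uminus[OF P] by simp
qed

text \<open>The delicate case is even \<open>d\<close> at a point with \<open>u = 0\<close>. For a
  section \<open>h\<close> of degree \<open>-m\<close> Euler's relation reads
  \<open>v h_v = -m h - u w\<close>; inserting it turns \<open>g h_v / u + b h\<close> into
  \<open>(b - m g / (u v)) h - g w / v\<close>, and the bracket is what \<open>coefs\<close>
  requires to be regular.\<close>

lemma dhat_reg:
  assumes P: "P \<in> proj_points" and \<gamma>: "\<gamma> \<in> coefs m d P" and x: "fst x \<in> reg 0 P" "snd x \<in> reg (- m) P"
  shows "fst (dhat d \<gamma> x) \<in> reg 0 P \<and> snd (dhat d \<gamma> x) \<in> reg (- m) P"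
proof (cases "d = 0")
  case False
  then have "fst \<gamma> \<in> reg (2 - m) P" "snd \<gamma> \<in> reg m P" using \<gamma> by (auto simp: coefs_def)
  then show ?thesis
    using False reg_mult[OF P, of "snd \<gamma>" m "snd x" "- m"] x
      reg_mult[OF P, of "fst \<gamma>" "2 - m" "vder (fst x) / uu" "- 2"] reg_vder_over_uu[OF P x(1)]
    by (simp add: dhat_def)
next
  case True
  then have g: "fst \<gamma> \<in> reg 2 P" using \<gamma> by (auto simp: coefs_def)
  have "fst \<gamma> * (vder (fst x) / uu) \<in> reg 0 P"
    using reg_mult[OF P g reg_vder_over_uu[OF P x(1)]] by simp
  moreover have "fst \<gamma> * (vder (snd x) / uu) + snd \<gamma> * snd x \<in> reg (- m) P"
  proof (cases "var_u \<in> P")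
    case False
    then have b: "snd \<gamma> \<in> reg 0 P" using \<gamma> True by (auto simp: coefs_def)
    have "fst \<gamma> * (vder (snd x) * uu powi (- 1)) \<in> reg (2 + (- m - 1 + - 1)) P"
      using False by (intro reg_mult[OF P] g reg_vder[OF P x(2)] reg_uu_powi[OF P]) auto
    then have "fst \<gamma> * (vder (snd x) / uu) \<in> reg (- m) P" by (simp add: field_simps)
    then show ?thesis
      using reg_add[OF P] reg_mult[OF P b x(2)] by simp
  next
    case u: True
    then have v: "var_v \<notin> P" using proj_point_irrelevant[OF P] by blast
    have b: "snd \<gamma> - of_int m * fst \<gamma> / (uu * vv) \<in> reg 0 P" using \<gamma> True u by (auto simp: coefs_def)
    obtain w where w: "w \<in> reg (- m - 1) P" "vv * vder (snd x) = of_int (- m) * snd x - uu * w"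
      using euler_reg[OF P x(2)] by auto
    have eq: "vder (snd x) = (of_int (- m) * snd x - uu * w) / vv"
      using w(2) by (simp add: field_simps)
    have "fst \<gamma> * (vder (snd x) / uu) + snd \<gamma> * snd x
      = (snd \<gamma> - of_int m * fst \<gamma> / (uu * vv)) * snd x - fst \<gamma> * (w * vv powi (- 1))"
      unfolding eq by (simp add: field_simps)
    moreover have "fst \<gamma> * (w * vv powi (- 1)) \<in> reg (2 + (- m - 1 + - 1)) P"
      using v by (intro reg_mult[OF P] g w reg_vv_powi[OF P]) auto
    ultimately show ?thesis
      using reg_diff[OF P] reg_mult[OF P b x(2)] by simp
  qed
  ultimately show ?thesis using True by (simp add: dhat_def)
qed

text \<open>The difference \<open>\<Delta>\<close> to the expected multiple of \<open>vder\<close>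
  is a derivation that kills constants and \<open>v/u\<close>, hence all polynomials in
  \<open>v/u\<close> and then their quotients. The factor \<open>u^2\<close> normalises
  \<open>vder (v/u) / u = 1 / u^2\<close>.\<close>

lemma derivation_degree_0:
  fixes a :: "'k::field poly poly fract \<Rightarrow> 'k poly poly fract"
  assumes add: "\<And>f g. f \<in> reg 0 {0} \<Longrightarrow> g \<in> reg 0 {0} \<Longrightarrow> a (f + g) = a f + a g"
    and mult: "\<And>f g. f \<in> reg 0 {0} \<Longrightarrow> g \<in> reg 0 {0} \<Longrightarrow> a (f * g) = a f * g + f * a g"
    and scale: "\<And>c f. f \<in> reg 0 {0} \<Longrightarrow> a (cst c * f) = cst c * a f"
    and f: "f \<in> reg 0 {0}"
  shows "a f = a (vv / uu) * uu\<^sup>2 * vder f / uu"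
proof -
  note G = generic_proj_point
  define \<Delta> where "\<Delta> f = a f - a (vv / uu) * uu * vder f" for f
  have \<Delta>_add: "\<Delta> (f + g) = \<Delta> f + \<Delta> g" if "f \<in> reg 0 {0}" "g \<in> reg 0 {0}" for f g
    using that by (simp add: \<Delta>_def add vder_add algebra_simps)
  have \<Delta>_mult: "\<Delta> (f * g) = \<Delta> f * g + f * \<Delta> g" if "f \<in> reg 0 {0}" "g \<in> reg 0 {0}" for f g
    using that by (simp add: \<Delta>_def mult vder_mult algebra_simps)
  have "a 1 + a 1 = a 1 + 0" using mult[of 1 1] reg_1[OF G] by (metis add.right_neutral mult_1 mult_1_right)
  then have "a 1 = 0" by (simp only: add_left_cancel)
  then have \<Delta>_cst: "\<Delta> (cst c) = 0" for c
    using scale[of 1 c] reg_1[OF G] by (simp add: \<Delta>_def)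
  have "vder (vv / uu :: 'k poly poly fract) = 1 / uu"
    unfolding divide_inverse by (simp add: vder_mult vder_inverse)
  then have \<Delta>_X: "\<Delta> (vv / uu) = 0" by (simp add: \<Delta>_def)
  have ev: "ev A \<in> reg 0 {0}" for A
    using reg_ev_affine[OF G var_u_generic, of 0 A] by simp
  have X: "vv / uu \<in> reg 0 {0}" using ev[of "[:0, 1:]"] by (simp add: ev_X)
  have \<Delta>_ev: "\<Delta> (ev A) = 0" for A
  proof (induction A)
    case 0
    then show ?case using \<Delta>_cst[of 0] by simp
  next
    case (pCons c A)
    have "vv / uu * ev A \<in> reg 0 {0}" using reg_mult[OF G X ev] by simp
    then have "\<Delta> (ev (pCons c A)) = \<Delta> (vv / uu * ev A)"
      unfolding ev_pCons using \<Delta>_add[OF reg_cst[OF G]] \<Delta>_cst by simp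
    also have "\<dots> = 0" using \<Delta>_mult[OF X ev[of A]] \<Delta>_X pCons by simp
    finally show ?case .
  qed
  obtain A B where AB: "B \<noteq> 0" "f = ev A / ev B"
    using f by (auto simp: reg_generic_iff)
  then have "\<Delta> (f * ev B) = 0" using \<Delta>_ev by simp
  then have "\<Delta> f * ev B = 0" using \<Delta>_mult[OF f ev[of B]] \<Delta>_ev by simp
  then have "\<Delta> f = 0" using AB by simp
  then show ?thesis by (simp add: \<Delta>_def power2_eq_square)
qed

lemma vder_uu_over_vv: "vder (uu / vv) = - uu / vv\<^sup>2"
  unfolding divide_inverse by (simp add: vder_mult vder_inverse) (simp add: field_simps)

text \<open>In the application \<open>g / u^2\<close> and \<open>- g / v^2\<close> are the values of
  a derivation on the coordinates \<open>v/u\<close> and \<open>u/v\<close>, which accounts for the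
  twist by 2.\<close>

lemma coef_regular:
  fixes P :: "'k::field pt"
  assumes P: "P \<in> proj_points"
    and u: "var_u \<notin> P \<Longrightarrow> g / uu\<^sup>2 \<in> reg n P"
    and v: "var_v \<notin> P \<Longrightarrow> g / vv\<^sup>2 \<in> reg n P"
  shows "g \<in> reg (n + 2) P"
proof (cases "var_u \<in> P")
  case False
  have "(uu :: 'k poly poly fract)\<^sup>2 \<in> reg 2 P" using reg_uu_powi[OF P, of 2] by simp
  then have "g / uu\<^sup>2 * uu\<^sup>2 \<in> reg (n + 2) P" by (intro reg_mult[OF P] u False)
  then show ?thesis by simp
next
  case True
  then have v': "var_v \<notin> P" using proj_point_irrelevant[OF P] by blast
  have "vv\<^sup>2 \<in> reg 2 P" using reg_vv_powi[OF P, of 2] by simp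
  then have "g / vv\<^sup>2 * vv\<^sup>2 \<in> reg (n + 2) P" by (intro reg_mult[OF P] v v')
  then show ?thesis by simp
qed

text \<open>Parity splits the derivation into \<open>a\<close> on functions and \<open>e\<close> on
  \<open>L\<close>. The value at \<open>v/u\<close> determines \<open>a\<close>; the Leibniz rule
  for \<open>f * u^(-m)\<close> then determines \<open>e\<close> from its value on the generator
  \<open>u^(-m)\<close>. Regularity of the coefficients is read off from coordinates and generators
  of both charts.\<close>

lemma derivation_classification:
  fixes dh :: "'k::field fpair \<Rightarrow> 'k fpair" and m :: int
  assumes U: "{0} \<in> U" "U \<subseteq> proj_points"
    and regular: "\<And>P x. P \<in> U \<Longrightarrow> fst x \<in> reg 0 P \<Longrightarrow> snd x \<in> reg (- m) P \<Longrightarrow>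
      fst (dh x) \<in> reg 0 P \<and> snd (dh x) \<in> reg (- m) P"
    and add: "\<And>x y. x \<in> regs m {} \<Longrightarrow> y \<in> regs m {} \<Longrightarrow> dh (x + y) = dh x + dh y"
    and scale: "\<And>c x. x \<in> regs m {} \<Longrightarrow> dh (psmult c x) = psmult c (dh x)"
    and mult: "\<And>p q x y. x \<in> regs m {} \<Longrightarrow> y \<in> regs m {} \<Longrightarrow> has_parity p x \<Longrightarrow> has_parity q y \<Longrightarrow>
      dh (pmul x y) = pmul (dh x) y + koszul d p (pmul x (dh y))"
    and parity: "\<And>p x. x \<in> regs m {} \<Longrightarrow> has_parity p x \<Longrightarrow> has_parity (p + d) (dh x)"
  shows "\<exists>\<gamma>. (\<forall>P\<in>U. \<gamma> \<in> coefs m d P) \<and> (\<forall>x\<in>regs m {}. dh x = dhat d \<gamma> x)"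
proof -
  note G = generic_proj_point
  let ?n = "- m"
  define a where "a f = (if d = 0 then fst (dh (f, 0)) else snd (dh (f, 0)))" for f
  define e where "e h = (if d = 0 then snd (dh (0, h)) else fst (dh (0, h)))" for h
  have f_mem: "(f, 0) \<in> regs m {}" if "f \<in> reg 0 {0}" for f
    using that reg_0[OF G] by (simp add: regs_def)
  have h_mem: "(0, h) \<in> regs m {}" if "h \<in> reg ?n {0}" for h
    using that reg_0[OF G] by (simp add: regs_def)
  have d: "d = 0 \<or> d = 1" by (cases d) auto
  have dh_f: "dh (f, 0) = (if d = 0 then (a f, 0) else (0, a f))" if "f \<in> reg 0 {0}" for f
    using parity[OF f_mem[OF that], of 0] d by (cases "dh (f, 0)") (auto simp: a_def has_parity_def)
  have dh_h: "dh (0, h) = (if d = 0 then (0, e h) else (e h, 0))" if "h \<in> reg ?n {0}" for h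
    using parity[OF h_mem[OF that], of 1] d by (cases "dh (0, h)") (auto simp: e_def has_parity_def)
  have a_add: "a (f + g) = a f + a g" if "f \<in> reg 0 {0}" "g \<in> reg 0 {0}" for f g
    using add[OF f_mem f_mem, OF that] by (simp add: a_def)
  have a_scale: "a (cst c * f) = cst c * a f" if "f \<in> reg 0 {0}" for c f
    using scale[OF f_mem[OF that], of c] by (simp add: a_def psmult_def)
  have a_mult: "a (f * g) = a f * g + f * a g" if f: "f \<in> reg 0 {0}" and g: "g \<in> reg 0 {0}" for f g
    using mult[OF f_mem[OF f] f_mem[OF g], of 0 0]
    by (simp add: a_def[of "f * g"] dh_f[OF f] dh_f[OF g] has_parity_def pmul_def koszul_def)
  have e_mult: "e (f * h) = (if d = 0 then a f * h else 0) + f * e h" if f: "f \<in> reg 0 {0}" and h: "h \<in> reg ?n {0}" for f h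
    using mult[OF f_mem[OF f] h_mem[OF h], of 0 1]
    by (simp add: e_def[of "f * h"] dh_f[OF f] dh_h[OF h] has_parity_def pmul_def koszul_def)
  define g where "g = a (vv / uu) * uu\<^sup>2"
  have a: "a f = g * vder f / uu" if "f \<in> reg 0 {0}" for f
    unfolding g_def using a_add a_mult a_scale that by (rule derivation_degree_0)
  have un: "uu powi ?n \<in> reg ?n {0}" using reg_uu_powi[OF G] var_u_generic by blast
  define b where "b = e (uu powi ?n) / uu powi ?n"
  have e: "e h = (if d = 0 then g * vder h / uu else 0) + b * h" if h: "h \<in> reg ?n {0}" for h
  proof -
    define f where "f = h * uu powi m"
    have "f \<in> reg (?n + m) {0}"
      unfolding f_def using var_u_generic by (intro reg_mult[OF G] h reg_uu_powi[OF G]) blast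
    then have f: "f \<in> reg 0 {0}" by simp
    have hf: "h = f * uu powi ?n" by (simp add: f_def power_int_minus)
    have "vder h = vder f * uu powi ?n" unfolding hf by (simp add: vder_mult vder_powi)
    then show ?thesis
      using e_mult[OF f un] a[OF f] by (simp add: hf b_def)
  qed
  have "(g, b) \<in> coefs m d P" if P: "P \<in> U" for P
  proof -
    have P': "P \<in> proj_points" using P U by blast
    have gen: "reg n P \<subseteq> reg n {0}" for n using reg_subset_generic[OF P'] .
    have a_reg: "a f \<in> reg (if d = 0 then 0 else ?n) P" if "f \<in> reg 0 P" for f
      using regular[OF P, of "(f, 0)"] that reg_0[OF P'] by (auto simp: a_def)
    have e_reg: "e h \<in> reg (if d = 0 then ?n else 0) P" if "h \<in> reg ?n P" for h
      using regular[OF P, of "(0, h)"] that reg_0[OF P'] by (auto simp: e_def)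
    have "g \<in> reg ((if d = 0 then 0 else ?n) + 2) P"
    proof (rule coef_regular[OF P'])
      assume u: "var_u \<notin> P"
      have "vv powi 1 * uu powi (- 1) \<in> reg (1 + - 1) P"
        using u by (intro reg_mult[OF P'] reg_uu_powi[OF P'] reg_vv_powi[OF P']) auto
      then have "vv / uu \<in> reg 0 P" by (simp add: field_simps)
      from a_reg[OF this] show "g / uu\<^sup>2 \<in> reg (if d = 0 then 0 else ?n) P" by (simp add: g_def)
    next
      assume v: "var_v \<notin> P"
      have "uu powi 1 * vv powi (- 1) \<in> reg (1 + - 1) P"
        using v by (intro reg_mult[OF P'] reg_uu_powi[OF P'] reg_vv_powi[OF P']) auto
      then have uv: "uu / vv \<in> reg 0 P" by (simp add: field_simps)
      have "a (uu / vv) = - (g / vv\<^sup>2)"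
        using a[of "uu / vv"] uv gen[of 0] by (auto simp: vder_uu_over_vv)
      then show "g / vv\<^sup>2 \<in> reg (if d = 0 then 0 else ?n) P"
        using reg_uminus[OF P' a_reg[OF uv]] by simp
    qed
    moreover have b_u: "b \<in> reg (if d = 0 then 0 else m) P" if u: "var_u \<notin> P"
    proof -
      have "e (uu powi ?n) \<in> reg (if d = 0 then ?n else 0) P" using e_reg reg_uu_powi[OF P'] u by blast
      moreover have "uu powi m \<in> reg m P" using reg_uu_powi[OF P'] u by blast
      ultimately have "e (uu powi ?n) * uu powi m \<in> reg ((if d = 0 then ?n else 0) + m) P"
        by (rule reg_mult[OF P'])
      moreover have "b = e (uu powi ?n) * uu powi m" by (simp add: b_def power_int_minus field_simps)
      ultimately show ?thesis by (auto split: if_splits)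
    qed
    \<comment> \<open>The same reading with the generator \<open>v^(-m)\<close>; in the even case
      its derivative contributes \<open>- m * g / (u * v)\<close>, the shift in
      \<open>coefs\<close>.\<close>
    moreover have b_v: "(if d = 0 then b - of_int m * g / (uu * vv) else b) \<in> reg (if d = 0 then 0 else m) P"
      if v: "var_v \<notin> P"
    proof -
      have vn: "vv powi ?n \<in> reg ?n P" using reg_vv_powi[OF P'] v by blast
      have "e (vv powi ?n) \<in> reg (if d = 0 then ?n else 0) P" using e_reg vn by blast
      moreover have "vv powi m \<in> reg m P" using reg_vv_powi[OF P'] v by blast
      ultimately have "e (vv powi ?n) * vv powi m \<in> reg ((if d = 0 then ?n else 0) + m) P"
        by (rule reg_mult[OF P'])
      moreover have "e (vv powi ?n) = (if d = 0 then - (of_int m * g / (uu * vv)) else 0) * vv powi ?n + b * vv powi ?n"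
        using e[of "vv powi ?n"] vn gen[of ?n]
        by (auto simp: vder_powi power_int_diff mult_ac)
      then have "e (vv powi ?n) * vv powi m = (if d = 0 then b - of_int m * g / (uu * vv) else b)"
        by (simp add: power_int_minus field_simps)
      ultimately show ?thesis by (auto split: if_splits)
    qed
    \<comment> \<open>At \<open>u = 0\<close> the even condition in \<open>coefs\<close> also places
      \<open>b\<close> itself in the generic stalk.\<close>
    moreover have "b \<in> reg 0 {0}" if "d = 0"
    proof -
      have "e (uu powi ?n) \<in> reg ?n {0}"
        using regular[OF U(1), of "(0, uu powi ?n)"] un reg_0[OF G] that by (auto simp: e_def)
      moreover have "uu powi m \<in> reg m {0}" using reg_uu_powi[OF G] var_u_generic by blast
      ultimately have "e (uu powi ?n) * uu powi m \<in> reg (?n + m) {0}" by (rule reg_mult[OF G])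
      moreover have "b = e (uu powi ?n) * uu powi m" by (simp add: b_def power_int_minus field_simps)
      ultimately show ?thesis by simp
    qed
    ultimately show ?thesis
      using proj_point_irrelevant[OF P'] by (auto simp: coefs_def split: if_splits)
  qed
  moreover have "dh x = dhat d (g, b) x" if x: "x \<in> regs m {}" for x
  proof -
    have fh: "fst x \<in> reg 0 {0}" "snd x \<in> reg ?n {0}" using x by (auto simp: regs_def)
    have "dh x = dh (fst x, 0) + dh (0, snd x)"
      using add[OF f_mem[OF fh(1)] h_mem[OF fh(2)]] by simp
    also have "\<dots> = dhat d (g, b) x"
      using d by (auto simp: dh_f fh dh_h dhat_def a e)
    finally show ?thesis .
  qed
  ultimately show ?thesis by blast
qed

section \<open>The tangent sheaf\<close>

text \<open>A section takes one value throughout its nonempty open set, so evaluation at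
  \<open>{0}\<close> recovers its pair of fractions.\<close>

definition vfield :: "int \<Rightarrow> bit \<Rightarrow> 'k::field pt set \<Rightarrow> 'k fpair \<Rightarrow> 'k pt set \<Rightarrow> 'k ssec \<Rightarrow> 'k ssec" where
  "vfield m d U \<gamma> = (\<lambda>W s. if zariski_open W \<and> W \<subseteq> U \<and> s \<in> sp_all (WP m) W then sec W (dhat d \<gamma> (s {0})) else 0)"

lemma vfield_sec:
  assumes "zariski_open W" "W \<subseteq> U" "x \<in> regs m W"
  shows "vfield m d U \<gamma> W (sec W x) = sec W (dhat d \<gamma> x)"
proof (cases "W = {}")
  case False
  then have "sec W x {0} = x" using zariski_open_generic[OF assms(1)] sec_generic by blast
  then show ?thesis using assms by (simp add: vfield_def sp_all_WP)
qed (simp add: vfield_def)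

lemma dhat_regs:
  assumes "zariski_open W" "\<forall>P\<in>insert {0} W. \<gamma> \<in> coefs m d P" "x \<in> regs m W"
  shows "dhat d \<gamma> x \<in> regs m W"
proof -
  have "fst (dhat d \<gamma> x) \<in> reg 0 P \<and> snd (dhat d \<gamma> x) \<in> reg (- m) P" if P: "P \<in> insert {0} W" for P
    using assms P proj_points_insert_generic[OF assms(1) P] by (intro dhat_reg) (auto simp: regs_def)
  then show ?thesis by (simp add: regs_def)
qed

lemma superderiv_WP_iff:
  assumes "zariski_open W"
  shows "superderiv (WP m) d W D \<longleftrightarrow>
     (\<forall>p. \<forall>x\<in>{x \<in> regs m W. has_parity p x}. D (sec W x) \<in> sec W ` {y \<in> regs m W. has_parity (p + d) y}) \<and>
     (\<forall>x\<in>regs m W. \<forall>y\<in>regs m W. D (sec W (x + y)) = D (sec W x) + D (sec W y)) \<and>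
     (\<forall>c. \<forall>x\<in>regs m W. D (sec W (psmult c x)) = sp_scale (WP m) c (D (sec W x))) \<and>
     (\<forall>p q. \<forall>x\<in>{x \<in> regs m W. has_parity p x}. \<forall>y\<in>{x \<in> regs m W. has_parity q x}.
        D (sec W (pmul x y)) = sp_mult (WP m) (D (sec W x)) (sec W y) + koszul d p (sp_mult (WP m) (sec W x) (D (sec W y)))) \<and>
     (\<forall>f. f \<notin> sec W ` regs m W \<longrightarrow> D f = 0)"
  unfolding superderiv_def sp_sec_WP[OF assms] sp_all_WP[OF assms]
  by (simp only: ball_simps(9) sec_add WP_simps)

lemma vfield_in_tangent_sections:
  assumes U: "zariski_open U" and \<gamma>: "\<forall>P\<in>insert {0} U. \<gamma> \<in> coefs m d P"
  shows "vfield m d U \<gamma> \<in> tangent_sections (WP m) d U"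
proof -
  have "superderiv (WP m) d W (vfield m d U \<gamma> W)" if W: "zariski_open W" "W \<subseteq> U" for W
  proof -
    have \<gamma>': "\<forall>P\<in>insert {0} W. \<gamma> \<in> coefs m d P" using \<gamma> W by blast
    note [simp] = vfield_sec[OF W] regs_add[OF W(1)] regs_psmult[OF W(1)] regs_pmul[OF W(1)]
    show ?thesis
      unfolding superderiv_WP_iff[OF W(1)]
    proof (intro conjI allI ballI impI)
      fix p x assume "x \<in> {x \<in> regs m W. has_parity p x}"
      then have x: "x \<in> regs m W" "has_parity p x" by auto
      have "dhat d \<gamma> x \<in> {y \<in> regs m W. has_parity (p + d) y}"
        using dhat_has_parity[OF x(2)] dhat_regs[OF W(1) \<gamma>' x(1)] by blast
      then show "vfield m d U \<gamma> W (sec W x) \<in> sec W ` {y \<in> regs m W. has_parity (p + d) y}"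
        unfolding vfield_sec[OF W x(1)] by (rule imageI)
    next
      fix p q x y assume "x \<in> {x \<in> regs m W. has_parity p x}" "y \<in> {x \<in> regs m W. has_parity q x}"
      then show "vfield m d U \<gamma> W (sec W (pmul x y)) = sp_mult (WP m) (vfield m d U \<gamma> W (sec W x)) (sec W y) +
           koszul d p (sp_mult (WP m) (sec W x) (vfield m d U \<gamma> W (sec W y)))"
        by (simp add: koszul_sec sec_add dhat_pmul[of p])
    next
      fix f assume "f \<notin> sec W ` regs m W"
      then show "vfield m d U \<gamma> W f = 0" by (simp add: vfield_def sp_all_WP[OF W(1)])
    qed (simp_all add: dhat_add dhat_psmult sec_add)
  qed
  moreover have "sp_res (WP m) V (vfield m d U \<gamma> W f) = vfield m d U \<gamma> V (sp_res (WP m) V f)"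
    if op: "zariski_open V" "zariski_open W" "V \<subseteq> W" "W \<subseteq> U" and f: "f \<in> sp_all (WP m) W" for V W f
  proof -
    obtain x where x: "x \<in> regs m W" "f = sec W x" using f op by (auto simp: sp_all_WP)
    moreover have "x \<in> regs m V" using x op by (auto simp: regs_def)
    moreover have "V \<subseteq> U" using op by blast
    ultimately show ?thesis using op by (simp add: vfield_sec)
  qed
  moreover have "vfield m d U \<gamma> W = 0" if "\<not> (zariski_open W \<and> W \<subseteq> U)" for W
    using that by (auto simp: vfield_def fun_eq_iff)
  ultimately show ?thesis unfolding tangent_sections_def by simp
qed

text \<open>The algebra over \<open>U\<close> alone may be too small to determine \<open>D\<close>:
  over the whole line with \<open>m > 0\<close> it is just the constants. So each pair
  \<open>x\<close> of the generic stalk is evaluated on its largest domain \<open>dom x\<close>;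
  compatibility with restriction makes this one operator \<open>dh\<close> on the generic stalk, to
  which the classification applies.\<close>

lemma tangent_section_vfield:
  fixes U :: "'a::field pt set"
  assumes U: "zariski_open U" and D: "D \<in> tangent_sections (WP m) d U"
  shows "\<exists>\<gamma>. (\<forall>P\<in>insert {0} U. \<gamma> \<in> coefs m d P) \<and> D = vfield m d U \<gamma>"
proof -
  note G = generic_proj_point
  have sd: "superderiv (WP m) d W (D W)" if "zariski_open W" "W \<subseteq> U" for W
    using D that by (auto simp: tangent_sections_def)
  have par: "D W (sec W x) \<in> sec W ` {y \<in> regs m W. has_parity (p + d) y}"
    if "zariski_open W" "W \<subseteq> U" "x \<in> regs m W" "has_parity p x" for W p x
    using sd[OF that(1,2)] that(3,4) unfolding superderiv_WP_iff[OF that(1)] by blast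
  have add: "D W (sec W (x + y)) = D W (sec W x) + D W (sec W y)"
    if "zariski_open W" "W \<subseteq> U" "x \<in> regs m W" "y \<in> regs m W" for W x y
    using sd[OF that(1,2)] that(3,4) unfolding superderiv_WP_iff[OF that(1)] by blast
  have scale: "D W (sec W (psmult c x)) = sp_scale (WP m) c (D W (sec W x))"
    if "zariski_open W" "W \<subseteq> U" "x \<in> regs m W" for W c x
    using sd[OF that(1,2)] that(3) unfolding superderiv_WP_iff[OF that(1)] by blast
  have leib: "D W (sec W (pmul x y)) = sp_mult (WP m) (D W (sec W x)) (sec W y) + koszul d p (sp_mult (WP m) (sec W x) (D W (sec W y)))"
    if "zariski_open W" "W \<subseteq> U" "x \<in> regs m W" "y \<in> regs m W" "has_parity p x" "has_parity q y" for W p q x y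
    using sd[OF that(1,2)] that(3-6) unfolding superderiv_WP_iff[OF that(1)] by blast
  have out: "D W f = 0" if "zariski_open W" "W \<subseteq> U" "f \<notin> sec W ` regs m W" for W f
    using sd[OF that(1,2)] that(3) unfolding superderiv_WP_iff[OF that(1)] by blast
  have out': "D W = 0" if "\<not> (zariski_open W \<and> W \<subseteq> U)" for W
    using D that by (auto simp: tangent_sections_def)
  have res: "sp_res (WP m) V (D W (sec W x)) = D V (sec V x)"
    if "zariski_open V" "zariski_open W" "V \<subseteq> W" "W \<subseteq> U" "x \<in> regs m W" for V W x
  proof -
    have "sec W x \<in> sp_all (WP m) W" using that by (simp add: sp_all_WP)
    then have "sp_res (WP m) V (D W (sec W x)) = D V (sp_res (WP m) V (sec W x))"
      using D that by (auto simp: tangent_sections_def)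
    then show ?thesis using that by simp
  qed
  have sec_D: "D W (sec W x) \<in> sec W ` regs m W" if W: "zariski_open W" "W \<subseteq> U" and x: "x \<in> regs m W" for W x
  proof -
    note parts = regs_parts[OF W(1) x]
    obtain y where y: "y \<in> regs m W" "D W (sec W (fst x, 0)) = sec W y"
      using par[OF W parts(1), of 0] by (auto simp: has_parity_def)
    obtain z where z: "z \<in> regs m W" "D W (sec W (0, snd x)) = sec W z"
      using par[OF W parts(2), of 1] by (auto simp: has_parity_def)
    have "D W (sec W x) = sec W (y + z)"
      using add[OF W parts] y z by (simp add: sec_add)
    then show ?thesis using regs_add[OF W(1) y(1) z(1)] by blast
  qed
  show ?thesis
  proof (cases "U = {}")
    case True
    \<comment> \<open>Over the empty set all sections vanish, so every coefficient gives the same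
      derivation; \<open>0\<close> is chosen.\<close>
    have "D W f = vfield m d U 0 W f" for W f
    proof (cases "zariski_open W \<and> W \<subseteq> U")
      case W: True
      then have "W = {}" using True by blast
      moreover have "D {} f = 0"
      proof (cases "f \<in> sec {} ` regs m {}")
        case f: True
        then obtain x where "x \<in> regs m W" "f = sec W x" using \<open>W = {}\<close> by blast
        then show ?thesis using sec_D[of W x] W \<open>W = {}\<close> by auto
      qed (use out[of W f] W \<open>W = {}\<close> in auto)
      ultimately show ?thesis by (simp add: vfield_def)
    qed (auto simp: out' vfield_def)
    moreover have "(0 :: 'a fpair) \<in> coefs m d {0}" by (simp add: coefs_def zero_prod_def reg_0[OF G])
    ultimately show ?thesis using True by (intro exI[of _ 0]) (auto simp: fun_eq_iff)
  next
    case False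
    then have gen: "{0} \<in> U" using zariski_open_generic[OF U] by blast
    define dom where "dom x = {P \<in> U. fst x \<in> reg 0 P} \<inter> {P \<in> U. snd x \<in> reg (- m) P}" for x
    have dom: "zariski_open (dom x)" "dom x \<subseteq> U" for x
      unfolding dom_def by (intro zariski_open_Int zariski_open_reg U) blast
    have dom_gen: "{0} \<in> dom x" "x \<in> regs m (dom x)" if "x \<in> regs m {}" for x
      using that gen by (auto simp: dom_def regs_def)
    define dh where "dh x = D (dom x) (sec (dom x) x) {0}" for x
    have dh_sec: "D W (sec W x) = sec W (dh x) \<and> (dh x \<in> regs m W)"
      if W: "zariski_open W" "W \<subseteq> U" "{0} \<in> W" and x: "x \<in> regs m W" for W x
    proof -
      obtain y where y: "y \<in> regs m W" "D W (sec W x) = sec W y" using sec_D[OF W(1,2) x] by blast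
      have x': "x \<in> regs m {}" using x by (auto simp: regs_def)
      have sub: "W \<subseteq> dom x" using x W by (auto simp: dom_def regs_def)
      obtain z where z: "D (dom x) (sec (dom x) x) = sec (dom x) z"
        using sec_D[OF dom dom_gen(2)[OF x']] by blast
      have "sec W y = sec W z"
        using res[OF W(1) dom(1) sub dom(2) dom_gen(2)[OF x']] z y sub by simp
      then have "y = z" using W(3) sec_cong_iff[of W y z] by auto
      moreover have "dh x = z" unfolding dh_def z using sec_generic[OF dom_gen(1)[OF x']] .
      ultimately show ?thesis using y by simp
    qed
    \<comment> \<open>Identities between two pairs are checked on the intersection of their domains,
      which still contains \<open>{0}\<close>.\<close>
    have dom2: "zariski_open (dom x \<inter> dom y)" "dom x \<inter> dom y \<subseteq> U" for x y
      using zariski_open_Int[OF dom(1) dom(1)] dom(2) by blast+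
    have dom2_gen: "{0} \<in> dom x \<inter> dom y" "x \<in> regs m (dom x \<inter> dom y)" "y \<in> regs m (dom x \<inter> dom y)"
      if "x \<in> regs m {}" "y \<in> regs m {}" for x y
      using that gen by (auto simp: dom_def regs_def)
    have "\<exists>\<gamma>. (\<forall>P\<in>U. \<gamma> \<in> coefs m d P) \<and> (\<forall>x\<in>regs m {}. dh x = dhat d \<gamma> x)"
    proof (rule derivation_classification)
      show "{0} \<in> U" "U \<subseteq> proj_points" using gen zariski_openD[OF U] by auto
    next
      fix P x assume P: "P \<in> U" and x: "fst x \<in> reg 0 P" "snd x \<in> reg (- m) P"
      have x': "x \<in> regs m {}"
        using x reg_subset_generic[of P] zariski_openD[OF U] P by (auto simp: regs_def)
      have "dh x \<in> regs m (dom x)" using dh_sec[OF dom dom_gen[OF x']] by blast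
      moreover have "P \<in> dom x" using P x by (auto simp: dom_def)
      ultimately show "fst (dh x) \<in> reg 0 P \<and> snd (dh x) \<in> reg (- m) P" by (auto simp: regs_def)
    next
      fix x y :: "'a fpair" assume xy: "x \<in> regs m {}" "y \<in> regs m {}"
      let ?W = "dom x \<inter> dom y"
      note W = dom2[of x y] dom2_gen[OF xy]
      have "sec ?W (dh (x + y)) = sec ?W (dh x + dh y)"
        using add[OF W(1,2,4,5)] dh_sec[OF W(1,2,3)] W(4,5) regs_add[OF W(1,4,5)] by (simp add: sec_add)
      then show "dh (x + y) = dh x + dh y" using W(3) sec_cong_iff[of ?W] by blast
    next
      fix c and x :: "'a fpair" assume x: "x \<in> regs m {}"
      let ?W = "dom x"
      note W = dom[of x] dom_gen[OF x]
      have "sec ?W (dh (psmult c x)) = sec ?W (psmult c (dh x))"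
        using scale[OF W(1,2,4)] dh_sec[OF W(1,2,3)] W(4) regs_psmult[OF W(1,4)] by simp
      then show "dh (psmult c x) = psmult c (dh x)" using W(3) sec_cong_iff[of ?W] by blast
    next
      fix p q and x y :: "'a fpair"
      assume xy: "x \<in> regs m {}" "y \<in> regs m {}" and p: "has_parity p x" "has_parity q y"
      let ?W = "dom x \<inter> dom y"
      note W = dom2[of x y] dom2_gen[OF xy]
      have "sec ?W (dh (pmul x y)) = sec ?W (pmul (dh x) y + koszul d p (pmul x (dh y)))"
        using leib[OF W(1,2,4,5) p] dh_sec[OF W(1,2,3)] W(4,5) regs_pmul[OF W(1,4,5)]
        by (simp add: sec_add koszul_sec)
      then show "dh (pmul x y) = pmul (dh x) y + koszul d p (pmul x (dh y))"
        using W(3) sec_cong_iff[of ?W] by blast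
    next
      fix p and x :: "'a fpair" assume x: "x \<in> regs m {}" and p: "has_parity p x"
      note W = dom[of x] dom_gen[OF x]
      obtain y where "has_parity (p + d) y" "D (dom x) (sec (dom x) x) = sec (dom x) y"
        using par[OF W(1,2,4) p] by blast
      then show "has_parity (p + d) (dh x)"
        using sec_generic[OF W(3), of y] by (simp add: dh_def)
    qed
    then obtain \<gamma> where \<gamma>: "\<forall>P\<in>U. \<gamma> \<in> coefs m d P" "\<forall>x\<in>regs m {}. dh x = dhat d \<gamma> x" by blast
    have "D W f = vfield m d U \<gamma> W f" for W f
    proof (cases "zariski_open W \<and> W \<subseteq> U")
      case W: True
      show ?thesis
      proof (cases "f \<in> sec W ` regs m W")
        case True
        then obtain x where x: "x \<in> regs m W" "f = sec W x" by blast
        have "D W (sec W x) = sec W (dhat d \<gamma> x)"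
        proof (cases "W = {}")
          case True
          then show ?thesis using sec_D[of W x] W x by auto
        next
          case False
          then have "{0} \<in> W" using zariski_open_generic W by blast
          moreover have "x \<in> regs m {}" using x by (auto simp: regs_def)
          ultimately show ?thesis using dh_sec[of W x] W x \<gamma>(2) by simp
        qed
        then show ?thesis using W x by (simp add: vfield_sec)
      next
        case False
        then show ?thesis using W out[of W f] by (simp add: vfield_def sp_all_WP)
      qed
    qed (auto simp: out' vfield_def)
    then show ?thesis using \<gamma>(1) gen by (intro exI[of _ \<gamma>]) (auto simp: fun_eq_iff)
  qed
qed

text \<open>On the chart where \<open>u\<close> is invertible, \<open>v/u\<close> detects the first
  coefficient, and \<open>u^(-m)\<close>, which \<open>vder\<close> kills, the second.\<close>

lemma vfield_inj:
  assumes U: "zariski_open U" "U \<noteq> {}" and eq: "vfield m d U \<gamma> = vfield m d U \<gamma>'"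
  shows "\<gamma> = \<gamma>'"
proof -
  let ?W = "U \<inter> {P \<in> proj_points. var_u \<notin> P}"
  have W: "zariski_open ?W" "?W \<subseteq> U" by (auto intro!: zariski_open_Int zariski_open_basic U)
  have gen: "{0} \<in> ?W" using zariski_open_generic[OF U] generic_proj_point var_u_generic by blast
  have dh: "dhat d \<gamma> x = dhat d \<gamma>' x" if x: "x \<in> regs m ?W" for x
  proof -
    have "sec ?W (dhat d \<gamma> x) = sec ?W (dhat d \<gamma>' x)"
      by (simp only: vfield_sec[OF W x, symmetric] eq)
    then show ?thesis using gen sec_cong_iff[of ?W] by blast
  qed
  have P: "P \<in> proj_points" "var_u \<notin> P" if "P \<in> insert {0} ?W" for P
    using that gen by auto
  have "vv powi 1 * uu powi (- 1) \<in> reg (1 + - 1) P" if "P \<in> insert {0} ?W" for P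
    using P[OF that] by (intro reg_mult reg_uu_powi reg_vv_powi) auto
  then have "vv / uu \<in> reg 0 P" if "P \<in> insert {0} ?W" for P
    using that by (simp add: field_simps)
  moreover have "uu powi (- m) \<in> reg (- m) P" if "P \<in> insert {0} ?W" for P
    using P[OF that] by (auto intro: reg_uu_powi)
  moreover have "0 \<in> reg n P" if "P \<in> insert {0} ?W" for P n
    using P[OF that] by (auto intro: reg_0)
  ultimately have "(vv / uu, 0) \<in> regs m ?W" "(0, uu powi (- m)) \<in> regs m ?W"
    by (auto simp: regs_def)
  from dh[OF this(1)] dh[OF this(2)] show ?thesis
  proof -
    assume 1: "dhat d \<gamma> (vv / uu, 0) = dhat d \<gamma>' (vv / uu, 0)"
      and 2: "dhat d \<gamma> (0, uu powi (- m)) = dhat d \<gamma>' (0, uu powi (- m))"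
    have "vder (vv / uu :: 'a poly poly fract) = 1 / uu"
      unfolding divide_inverse by (simp add: vder_mult vder_inverse)
    then show ?thesis
      using 1 2 by (cases \<gamma>; cases \<gamma>'; cases d) (auto simp: dhat_def vder_powi)
  qed
qed

interpretation fpair: vector_space "psmult :: 'k::field \<Rightarrow> 'k fpair \<Rightarrow> 'k fpair"
  by unfold_locales (auto simp: psmult_def cst_add cst_mult algebra_simps)

section \<open>The tangent sheaf as a subsheaf of a constant sheaf\<close>

lemma coefs_subspace:
  assumes P: "P \<in> proj_points"
  shows "fpair.subspace (coefs m d P)"
proof (cases "d = 0")
  case True
  have scale: "cst c * b - of_int m * (cst c * g) / (uu * vv) = cst c * (b - of_int m * g / (uu * vv))" for c b g
    by (simp add: algebra_simps)
  have add: "b + b' - of_int m * (g + g') / (uu * vv) = (b - of_int m * g / (uu * vv)) + (b' - of_int m * g' / (uu * vv))"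
    for b g b' g' :: "'a poly poly fract"
    by (simp add: algebra_simps add_divide_distrib)
  show ?thesis
    using True by (intro fpair.subspaceI)
      (auto simp: coefs_def psmult_def scale add reg_0[OF P] reg_0[OF generic_proj_point]
        intro: reg_add[OF P] reg_cst_mult[OF P] reg_add[OF generic_proj_point] reg_cst_mult[OF generic_proj_point])
next
  case False
  then show ?thesis
    by (intro fpair.subspaceI)
      (auto simp: coefs_def psmult_def zero_prod_def reg_0[OF P] intro!: reg_add[OF P] reg_cst_mult[OF P])
qed

lemma var_u_nz [simp]: "var_u \<noteq> 0" and var_v_nz [simp]: "var_v \<noteq> 0"
  by (auto simp: var_u_def var_v_def)

lemma coefs_generic: "P \<in> proj_points \<Longrightarrow> coefs m d P \<subseteq> coefs m d {0}"
  by (auto simp: coefs_def dest: subsetD[OF reg_subset_generic] split: if_splits)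

lemma coefs_affine:
  "var_u \<notin> P \<Longrightarrow> coefs m d P = (if d = 0 then reg 2 P \<times> reg 0 P else reg (2 - m) P \<times> reg m P)"
  by (auto simp: coefs_def)

text \<open>On the chart where \<open>u\<close> is invertible the conditions are products of two
  twists in either parity, so polar parts are taken componentwise. At the generic point the
  condition is \<open>G\<close> itself and \<open>0\<close> serves.\<close>

lemma coefs_polar_part:
  fixes P :: "'k::alg_closed_field pt"
  assumes P: "P \<in> proj_points" "var_u \<notin> P" and x: "x \<in> coefs m d {0}"
  shows "\<exists>s\<in>coefs m d {0}. s - x \<in> coefs m d P \<and>
    (\<forall>Q\<in>{Q \<in> proj_points. var_u \<notin> Q} - {P}. s \<in> coefs m d Q)"
proof -
  define n n' where "n = (if d = 0 then 2 else 2 - m)" and "n' = (if d = 0 then 0 else m)"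
  have coefs: "coefs m d Q = reg n Q \<times> reg n' Q" if "var_u \<notin> Q" for Q :: "'k pt"
    using that by (simp add: coefs_affine n_def n'_def)
  show ?thesis
  proof (cases "P = {0}")
    case True
    have "0 \<in> coefs m d Q" "- x \<in> coefs m d {0}" if "Q \<in> proj_points" for Q :: "'k pt"
      using fpair.subspace_0[OF coefs_subspace[OF that]]
        fpair.subspace_neg[OF coefs_subspace[OF generic_proj_point] x] by auto
    then show ?thesis using True generic_proj_point by (intro bexI[of _ 0]) auto
  next
    case False
    then obtain a where a: "P = pt a" using affine_point_cases[OF P] by blast
    have x': "fst x \<in> reg n {0}" "snd x \<in> reg n' {0}"
      using x unfolding coefs[OF var_u_generic] mem_Times_iff by blast+
    obtain s where s: "s \<in> reg n {0}" "s - fst x \<in> reg n (pt a)" "\<forall>b. b \<noteq> a \<longrightarrow> s \<in> reg n (pt b)"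
      using polar_part_pt[OF x'(1)] by blast
    obtain s' where s': "s' \<in> reg n' {0}" "s' - snd x \<in> reg n' (pt a)" "\<forall>b. b \<noteq> a \<longrightarrow> s' \<in> reg n' (pt b)"
      using polar_part_pt[OF x'(2)] by blast
    have "(s, s') \<in> coefs m d Q" if Q: "Q \<in> proj_points" "var_u \<notin> Q" "Q \<noteq> P" for Q
      unfolding coefs[OF Q(2)] mem_Times_iff using affine_point_cases[OF Q(1,2)] s(1,3) s'(1,3) Q(3) a by auto
    moreover have "(s, s') - x \<in> coefs m d P"
      unfolding coefs[OF P(2)] mem_Times_iff using s(2) s'(2) a by simp
    moreover have "(s, s') \<in> coefs m d {0}"
      unfolding coefs[OF var_u_generic] mem_Times_iff using s(1) s'(1) by simp
    ultimately show ?thesis by blast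
  qed
qed

text \<open>\<open>pt_inf\<close> is the only point containing \<open>u\<close>, so the complement
  of \<open>z\<close> is the affine chart.\<close>

lemma curve_sheaf_tangent:
  "curve_sheaf psmult (tangent_sheaf (WP m :: ('k::alg_closed_field pt, 'k, 'k ssec) superspace) d) (vfield m d)
     (coefs m d {0}) (coefs m d) {P \<in> proj_points. var_u \<notin> P} pt_inf"
proof -
  let ?A = "{P \<in> proj_points. var_u \<notin> P} :: 'k pt set"
  have insert: "insert pt_inf ?A = proj_points"
    using infinite_point_eq pt_inf_proj_point by auto
  show ?thesis
  proof (intro curve_sheaf.intro fpair.vector_space_axioms curve_sheaf_axioms.intro, unfold insert)
    fix U U' :: "'k pt set"
    assume "openin (base (tangent_sheaf (WP m :: ('k pt, 'k, 'k ssec) superspace) d)) U"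
    then have U: "zariski_open U" by (simp add: tangent_sheaf_def)
    show "sect (tangent_sheaf (WP m) d) U = vfield m d U ` {x \<in> coefs m d {0}. \<forall>P\<in>U. x \<in> coefs m d P}"
      using vfield_in_tangent_sections[OF U, of _ m d] tangent_section_vfield[OF U, of _ m d]
      by (fastforce simp: tangent_sheaf_def)
    show "inj_on (vfield m d U) {x \<in> coefs m d {0}. \<forall>P\<in>U. x \<in> coefs m d P}" if "U \<noteq> {}"
      using vfield_inj[OF U that] by (auto intro: inj_onI)
    show "finite (?A - U)" if "U \<noteq> {}" using zariski_open_cofinite[OF U that] .
    assume "openin (base (tangent_sheaf (WP m :: ('k pt, 'k, 'k ssec) superspace) d)) U'" "U \<noteq> {}" "U' \<noteq> {}"
    then show "U \<inter> U' \<noteq> {}"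
      using zariski_open_generic[OF U] zariski_open_generic[of U'] by (auto simp: tangent_sheaf_def)
  next
    fix U x y
    show "vfield m d U (x + y) = vfield m d U x + vfield m d U y"
      by (auto simp: vfield_def fun_eq_iff dhat_add_coef simp flip: sec_add)
  next
    fix U' U x assume "U' \<subseteq> (U :: 'k pt set)"
    then show "rest (tangent_sheaf (WP m) d) U' (vfield m d U x) = vfield m d U' x"
      by (auto simp: tangent_sheaf_def vfield_def fun_eq_iff)
  next
    fix c U x
    show "scal (tangent_sheaf (WP m) d) c (vfield m d U x) = vfield m d U (psmult c x)"
      by (auto simp: tangent_sheaf_def vfield_def fun_eq_iff dhat_psmult_coef)
  next
    fix x show "vfield m d {} x = 0"
      by (auto simp: vfield_def fun_eq_iff)
  next
    show "topspace (base (tangent_sheaf (WP m :: ('k pt, 'k, 'k ssec) superspace) d)) = proj_points"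
      by (simp add: tangent_sheaf_def topspace_zariski)
  next
    show "openin (base (tangent_sheaf (WP m :: ('k pt, 'k, 'k ssec) superspace) d)) ?A"
      by (simp add: tangent_sheaf_def zariski_open_basic)
  qed (use coefs_subspace generic_proj_point coefs_generic coefs_polar_part var_u_pt_inf in blast)+
qed

section \<open>The first cohomology of the tangent sheaf\<close>

text \<open>The twists O(2) and O leave no Laurent terms, so each component splits. The part
  \<open>w\<close> of the first component at infinity demands the shift \<open>t\<close> in the
  second, so \<open>t\<close> is set aside before the second component is split.\<close>

lemma N_even:
  fixes x :: "'k::alg_closed_field fpair"
  assumes x: "x \<in> coefs m 0 {0}"
  shows "\<exists>a b. x = a + b \<and> a \<in> coefs m 0 {0} \<and>
    (\<forall>P\<in>{P \<in> proj_points. var_u \<notin> P}. a \<in> coefs m 0 P) \<and> b \<in> coefs m 0 pt_inf"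
proof -
  note G = generic_proj_point
  have x': "fst x \<in> reg 2 {0}" "snd x \<in> reg 0 {0}" using x var_u_generic by (auto simp: coefs_def)
  obtain y w where g: "fst x = y + w" "\<forall>P\<in>proj_points. var_u \<notin> P \<longrightarrow> y \<in> reg 2 P" "w \<in> reg 2 pt_inf"
    using laurent_spanning[OF x'(1)] by auto
  define t where "t = of_int m * w / (uu * vv)"
  have w: "w \<in> reg 2 {0}" using g(3) reg_subset_generic[OF pt_inf_proj_point] by blast
  have "of_int m * (w * (uu powi (- 1) * vv powi (- 1))) \<in> reg (0 + (2 + (- 1 + - 1))) {0}"
    by (intro reg_mult[OF G] reg_of_int[OF G] w reg_uu_powi[OF G] reg_vv_powi[OF G]) (auto simp: var_u_def var_v_def)
  then have t: "t \<in> reg 0 {0}" by (simp add: t_def field_simps)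
  obtain y' w' where b: "snd x - t = y' + w'" "\<forall>P\<in>proj_points. var_u \<notin> P \<longrightarrow> y' \<in> reg 0 P" "w' \<in> reg 0 pt_inf"
    using laurent_spanning[OF reg_diff[OF G x'(2) t]] by auto
  have w': "w' \<in> reg 0 {0}" using b(3) reg_subset_generic[OF pt_inf_proj_point] by blast
  have "x = (y, y') + (w, w' + t)" using g(1) b(1) by (cases x) (auto simp: algebra_simps)
  moreover have "(y, y') \<in> coefs m 0 P" if "P \<in> proj_points" "var_u \<notin> P" for P
    using that g b by (auto simp: coefs_def)
  moreover have "(w, w' + t) \<in> coefs m 0 pt_inf"
    using g(3) b(3) reg_add[OF G w' t] by (simp add: coefs_def var_u_pt_inf t_def)
  ultimately show ?thesis
    using G var_u_generic by blast
qed

text \<open>As \<open>N\<close> is all of \<open>G\<close>, the empty family is a basis, and the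
  whole line can serve as the neighbourhood of \<open>pt_inf\<close>.\<close>

lemma H1_tangent_even:
  "has_dimension (H1_tangent (WP m :: ('k::alg_closed_field pt, 'k, 'k ssec) superspace) 0) 0"
proof -
  interpret curve_sheaf psmult "tangent_sheaf (WP m :: ('k pt, 'k, 'k ssec) superspace) 0" "vfield m 0"
    "coefs m 0 {0}" "coefs m 0" "{P \<in> proj_points. var_u \<notin> P}" pt_inf
    by (rule curve_sheaf_tangent)
  interpret curve_sheaf_basis psmult "tangent_sheaf (WP m :: ('k pt, 'k, 'k ssec) superspace) 0" "vfield m 0"
    "coefs m 0 {0}" "coefs m 0" "{P \<in> proj_points. var_u \<notin> P}" pt_inf "\<lambda>_ :: nat. 0" "{}" proj_points
  proof
    show "openin (base (tangent_sheaf (WP m :: ('k pt, 'k, 'k ssec) superspace) 0)) proj_points"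
      by (simp add: tangent_sheaf_def zariski_open_proj_points)
    show "pt_inf \<in> (proj_points :: 'k pt set)" by (rule pt_inf_proj_point)
    fix x :: "'k fpair" assume "x \<in> coefs m 0 {0}"
    from N_even[OF this] show "\<exists>c :: nat \<Rightarrow> 'k. x - (\<Sum>i\<in>{}. psmult (c i) 0) \<in> N"
      by (simp add: N_def)
  qed auto
  show ?thesis using has_dimension_H1 by (simp add: H1_tangent_def)
qed

section \<open>The odd part\<close>

definition odd_basis :: "int \<Rightarrow> nat + nat \<Rightarrow> 'k::field fpair" where
  "odd_basis m i = (case i of Inl j \<Rightarrow> (laurent (2 - m) j, 0) | Inr j \<Rightarrow> (0, laurent m j))"

text \<open>The bounds are \<open>-n-1\<close> for the two twists \<open>n = 2 - m\<close> and
  \<open>n = m\<close>.\<close>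

definition odd_index :: "int \<Rightarrow> (nat + nat) set" where
  "odd_index m = {1..nat (m - 3)} <+> {1..nat (- m - 1)}"

lemma sum_odd_basis:
  "(\<Sum>i\<in>odd_index m. psmult (c i) (odd_basis m i)) =
     ((\<Sum>j=1..nat (m - 3). cst (c (Inl j)) * laurent (2 - m) j),
      (\<Sum>j=1..nat (- m - 1). cst (c (Inr j)) * laurent m j))"
  unfolding odd_index_def by (subst sum.Plus) (auto simp: prod_eq_iff fst_sum snd_sum odd_basis_def psmult_def)

lemma laurent_reg:
  fixes P :: "'k::field pt"
  assumes "P \<in> proj_points" "var_u \<notin> P" "var_v \<notin> P"
  shows "laurent n i \<in> reg n P"
proof -
  have "uu powi (n + int i) * vv powi (- int i) \<in> reg ((n + int i) + - int i) P"
    using assms by (intro reg_mult reg_uu_powi reg_vv_powi) auto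
  moreover have "uu powi (n + int i) * vv powi (- int i) = (laurent n i :: 'k poly poly fract)"
    by (simp add: laurent_def power_int_add power_int_minus power_divide field_simps)
  ultimately show ?thesis by simp
qed

text \<open>The odd conditions are products at every point, including \<open>pt_inf\<close>, so
  spanning and independence are those of the two twists. The monomials have poles at most where
  \<open>u\<close> or \<open>v\<close> vanishes, so \<open>W\<close> is the chart where
  \<open>v\<close> is invertible.\<close>

lemma curve_sheaf_basis_odd:
  "curve_sheaf_basis psmult (tangent_sheaf (WP m :: ('k::alg_closed_field pt, 'k, 'k ssec) superspace) 1) (vfield m 1)
     (coefs m 1 {0}) (coefs m 1) {P \<in> proj_points. var_u \<notin> P} pt_inf (odd_basis m) (odd_index m)
     {P \<in> proj_points. var_v \<notin> P}"
proof -
  interpret curve_sheaf psmult "tangent_sheaf (WP m :: ('k pt, 'k, 'k ssec) superspace) 1" "vfield m 1"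
    "coefs m 1 {0}" "coefs m 1" "{P \<in> proj_points. var_u \<notin> P}" pt_inf
    by (rule curve_sheaf_tangent)
  have coefs: "coefs m 1 P = reg (2 - m) P \<times> reg m P" for P :: "'k pt" by (simp add: coefs_def)
  have basis: "odd_basis m i \<in> coefs m 1 P" if "P \<in> proj_points" "var_u \<notin> P" "var_v \<notin> P" for i and P :: "'k pt"
    using laurent_reg[OF that] reg_0[OF that(1)] by (auto simp: odd_basis_def coefs split: sum.split)
  show ?thesis
  proof
    show "openin (base (tangent_sheaf (WP m :: ('k pt, 'k, 'k ssec) superspace) 1)) {P \<in> proj_points. var_v \<notin> P}"
      by (simp add: tangent_sheaf_def zariski_open_basic)
    show "pt_inf \<in> {P \<in> proj_points :: 'k pt set. var_v \<notin> P}"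
      using pt_inf_proj_point var_v_pt_inf by blast
    show "odd_basis m i \<in> coefs m 1 ({0} :: 'k pt)" for i
      by (intro basis generic_proj_point) simp_all
    show "odd_basis m i \<in> coefs m 1 P" if "P \<in> {P \<in> proj_points. var_u \<notin> P} \<inter> {P \<in> proj_points. var_v \<notin> P}"
      for i and P :: "'k pt"
      using basis that by blast
    show "finite (odd_index m)" by (simp add: odd_index_def)
  next
    fix x :: "'k fpair" assume "x \<in> coefs m 1 {0}"
    then have x: "fst x \<in> reg (2 - m) {0}" "snd x \<in> reg m {0}" by (auto simp: coefs)
    obtain c y w where 1: "fst x = (\<Sum>i=1..nat (m - 3). cst (c i) * laurent (2 - m) i) + y + w"
      "\<forall>P\<in>proj_points. var_u \<notin> P \<longrightarrow> y \<in> reg (2 - m) P" "w \<in> reg (2 - m) pt_inf"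
      using laurent_spanning[OF x(1)] by (auto simp: algebra_simps)
    obtain c' y' w' where 2: "snd x = (\<Sum>i=1..nat (- m - 1). cst (c' i) * laurent m i) + y' + w'"
      "\<forall>P\<in>proj_points. var_u \<notin> P \<longrightarrow> y' \<in> reg m P" "w' \<in> reg m pt_inf"
      using laurent_spanning[OF x(2)] by blast
    have "x - (\<Sum>i\<in>odd_index m. psmult (case_sum c c' i) (odd_basis m i)) = (y, y') + (w, w')"
      unfolding sum_odd_basis using 1(1) 2(1) by (simp add: prod_eq_iff)
    moreover have "(y, y') \<in> coefs m 1 P" if "P \<in> proj_points" "var_u \<notin> P" for P
      using that 1 2 by (simp add: coefs)
    moreover have "(w, w') \<in> coefs m 1 pt_inf" using 1 2 by (simp add: coefs)
    ultimately have "x - (\<Sum>i\<in>odd_index m. psmult (case_sum c c' i) (odd_basis m i)) \<in> N"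
      unfolding N_def using generic_proj_point var_u_generic by blast
    then show "\<exists>c. x - (\<Sum>i\<in>odd_index m. psmult (c i) (odd_basis m i)) \<in> N" by blast
  next
    fix c :: "nat + nat \<Rightarrow> 'k" and i
    assume sum: "(\<Sum>i\<in>odd_index m. psmult (c i) (odd_basis m i)) \<in> N" and i: "i \<in> odd_index m"
    obtain y w where yw: "(\<Sum>i\<in>odd_index m. psmult (c i) (odd_basis m i)) = y + w"
      "\<forall>P\<in>{P \<in> proj_points. var_u \<notin> P}. y \<in> coefs m 1 P" "w \<in> coefs m 1 pt_inf"
      using sum unfolding N_def by blast
    have "y \<in> coefs m 1 (pt a)" for a
      using yw(2) pt_proj_point[of a] var_u_pt[of a] by blast
    then have y: "fst y \<in> reg (2 - m) (pt a)" "snd y \<in> reg m (pt a)" for a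
      unfolding coefs mem_Times_iff by blast+
    have w: "fst w \<in> reg (2 - m) pt_inf" "snd w \<in> reg m pt_inf" using yw(3) by (auto simp: coefs)
    have "(\<Sum>j=1..nat (- (2 - m) - 1). cst (c (Inl j)) * laurent (2 - m) j) = fst y + fst w"
      "(\<Sum>j=1..nat (- m - 1). cst (c (Inr j)) * laurent m j) = snd y + snd w"
      using yw(1) unfolding sum_odd_basis by (auto simp: prod_eq_iff)
    from laurent_independent[OF this(1) y(1) w(1)] laurent_independent[OF this(2) y(2) w(2)]
    show "c i = 0"
      using i by (auto simp: odd_index_def)
  qed
qed

theorem lemma4p3:
  fixes m :: int
    and X :: "('k::{alg_closed_field, field_char_0} pt, 'k, 'k ssec) superspace"
  assumes "X = WP m"
  shows "has_superdimension (H1_tangent X) 0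
           (if m < -1 then nat (- m - 1) else if m \<le> 3 then 0 else nat (m - 3))
         \<and> (m < -1 \<or> m > 3 \<longrightarrow> \<not> rigid X)"
proof -
  interpret curve_sheaf_basis psmult "tangent_sheaf (WP m :: ('k pt, 'k, 'k ssec) superspace) 1" "vfield m 1"
    "coefs m 1 {0}" "coefs m 1" "{P \<in> proj_points. var_u \<notin> P}" pt_inf "odd_basis m" "odd_index m"
    "{P \<in> proj_points. var_v \<notin> P}"
    by (rule curve_sheaf_basis_odd)
  \<comment> \<open>The two summands are never nonempty together: one requires \<open>m > 3\<close>,
    the other \<open>m < -1\<close>.\<close>
  have card: "card (odd_index m) = (if m < -1 then nat (- m - 1) else if m \<le> 3 then 0 else nat (m - 3))"
    by (simp add: odd_index_def card_Plus)
  have "has_superdimension (H1_tangent X) 0 (card (odd_index m))"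
    using has_dimension_H1 H1_tangent_even by (simp add: has_superdimension_def H1_tangent_def assms)
  moreover have "\<not> rigid X" if "m < -1 \<or> m > 3"
  proof -
    have "odd_index m \<noteq> {}" using card that by force
    then show ?thesis
      using carrier_H1_nontrivial unfolding rigid_def H1_tangent_def assms by blast
  qed
  ultimately show ?thesis by (simp only: card) simp
qed

end
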